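(* Assume $\det R_1\neq 0$ and $\det R_2=0$. For every integer $k\ge0$, the operator $A_R^k$ with domain $M_k\subset W^{k+2}(0,N+1)$ and values in $W^k(0,N+1)$, given by $A_R^kv=-(R_Qv)''$, is Fredholm, $\dim\ker(A_R^k)=0$, and $$\operatorname{codim}\operatorname{Im}(A_R^k)=\begin{cases}2(k+1), & \text{if } G^1_1,\ G^2_{N+1}\text{ are linearly independent},\\ k+1, & \text{if } G^1_1,\ G^2_{N+1}\text{ are linearly dependent,}\end{cases}$$ where the codimension is taken in $W^k(0,N+1)$.
   Context: $N\ge1$ is a natural number and $b_j$ ($-N\le j\le N$) are real numbers. $W^k(a,b)$ is the $L_2$-based Sobolev space of order $k$ ($W^0=L_2$); $\mathring W^1(a,b)$ is the subspace of those $u\in W^1(a,b)$ with $u(a)=u(b)=0$. The difference operator $R:L_2(\mathbb R)\to L_2(\mathbb R)$ is $(Rv)(t)=\sum_{j=-N}^N b_j v(t+j)$. Let $I_Q:L_2(0,N+1)\to L_2(\mathbb R)$ be extension by zero, $P_Q:L_2(\mathbb R)\to L_2(0,N+1)$ restriction to $(0,N+1)$, and $R_Q=P_QRI_Q:L_2(0,N+1)\to L_2(0,N+1)$. $R_1$ is the $(N+1)\times(N+1)$ matrix with entries $r_{ik}=b_{k-i}$ ($i,k=1,\dots,N+1$), and $R_2$ is the $N\times N$ matrix obtained from $R_1$ by deleting the last row and the last column. $G^1_1$ is the first column of the $N\times(N+1)$ matrix obtained from $R_1$ by deleting the first row; $G^2_{N+1}$ is the last ($(N+1)$-th) column of the $N\times(N+1)$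 matrix obtained from $R_1$ by deleting the last row. $M_k=\{u\in\mathring W^1(0,N+1): u\in W^{k+2}(0,N+1),\ R_Qu\in W^{k+2}(0,N+1)\}$, with the norm of $W^{k+2}(0,N+1)$. An operator is Fredholm if it is closed, its kernel has finite dimension, and its range is closed and of finite codimension in the target space. (The domain is not required to be dense.) *)

theory Defs
  imports "HOL-Analysis.Analysis" "Jordan_Normal_Form.Determinant"
begin

unbundle no vec_syntax
no_notation Matrix.vec_index (infixl "$" 100)
no_notation Matrix.scalar_prod (infix "\<bullet>" 70)

section \<open>Fredholm operators between normed subspaces of a vector space\<close>

definition norm_topology :: "'v::ab_group_add set \<Rightarrow> ('v \<Rightarrow> real) \<Rightarrow> 'v topology" where
  "norm_topology V nrm = Metric_space.mtopology V (\<lambda>x y. nrm (x - y))"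

definition kernel_on :: "'v set \<Rightarrow> ('v \<Rightarrow> 'w::zero) \<Rightarrow> 'v set" where
  "kernel_on D T = {u \<in> D. T u = 0}"

text \<open>
  A separate locale, since definitions in \<open>vector_space\<close> itself clash with their instances for
  \<open>real_vector\<close>.
\<close>

locale linear_space = vector_space scale
  for scale :: "'a::field \<Rightarrow> 'b::ab_group_add \<Rightarrow> 'b" (infixr "*s" 75)
begin

definition finite_dim :: "'b set \<Rightarrow> bool" where
  "finite_dim S \<longleftrightarrow> (\<exists>B. finite B \<and> S \<subseteq> span B)"

text \<open>The cosets of the elements of \<open>B\<close>, pairwise distinct, form a finite basis of \<open>V / S\<close>.\<close>

definition quotient_basis :: "'b set \<Rightarrow> 'b set \<Rightarrow> 'b set \<Rightarrow> bool" where
  "quotient_basis V S B \<longleftrightarrow> finite B \<and> B \<subseteq> V \<and>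
     (\<forall>v\<in>V. \<exists>!c. (\<forall>b. b \<notin> B \<longrightarrow> c b = 0) \<and> v - (\<Sum>b\<in>B. c b *s b) \<in> S)"

definition finite_codim :: "'b set \<Rightarrow> 'b set \<Rightarrow> bool" where
  "finite_codim V S \<longleftrightarrow> (\<exists>B. quotient_basis V S B)"

definition codim :: "'b set \<Rightarrow> 'b set \<Rightarrow> nat" where
  "codim V S = (THE n. \<exists>B. quotient_basis V S B \<and> card B = n)"

definition linear_operator_on :: "'b set \<Rightarrow> ('b \<Rightarrow> 'b) \<Rightarrow> bool" where
  "linear_operator_on D T \<longleftrightarrow> subspace D \<and>
     (\<forall>u\<in>D. \<forall>v\<in>D. T (u + v) = T u + T v) \<and> (\<forall>c. \<forall>u\<in>D. T (c *s u) = c *s T u)"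

text \<open>
  The operator \<open>T\<close> has domain \<open>D\<close> (not necessarily dense) in the space \<open>V\<close> with norm \<open>nV\<close>, and
  values in the space \<open>W\<close> with norm \<open>nW\<close>. A set that is \<open>closedin\<close> a topology is contained in
  its carrier, so \<open>D \<subseteq> V\<close> and \<open>T ` D \<subseteq> W\<close> are part of the closed graph condition.
\<close>

definition fredholm ::
  "'b set \<Rightarrow> ('b \<Rightarrow> real) \<Rightarrow> 'b set \<Rightarrow> ('b \<Rightarrow> real) \<Rightarrow> 'b set \<Rightarrow> ('b \<Rightarrow> 'b) \<Rightarrow> bool" where
  "fredholm V nV W nW D T \<longleftrightarrow>
     linear_operator_on D T \<and>
     closedin (prod_topology (norm_topology V nV) (norm_topology W nW)) ((\<lambda>u. (u, T u)) ` D) \<and>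
     finite_dim (kernel_on D T) \<and>
     closedin (norm_topology W nW) (T ` D) \<and>
     finite_codim W (T ` D)"

end

section \<open>Almost-everywhere classes of measurable functions\<close>

text \<open>
  The only types of sort \<open>{real_normed_field, euclidean_space}\<close> are (up to isomorphism) the reals
  and the complex numbers, so the type variable \<open>'a\<close> below covers both real-valued and
  complex-valued functions; all linear notions are taken over the field \<open>'a\<close>. Every
  Lebesgue measurable function agrees almost everywhere with a Borel function, so taking Borel
  representatives gives the usual classes.
\<close>

definition ae_eq :: "(real \<Rightarrow> 'a::{real_normed_field, euclidean_space}) \<Rightarrow> (real \<Rightarrow> 'a) \<Rightarrow> bool" where
  "ae_eq f g \<longleftrightarrow>
     f \<in> borel_measurable lborel \<and> g \<in> borel_measurable lborel \<and> (AE x in lborel. f x = g x)"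

quotient_type (overloaded) 'a ae_fun =
  "real \<Rightarrow> 'a::{real_normed_field, euclidean_space}" / partial: ae_eq
  morphisms ae_rep ae_class
proof (rule part_equivpI)
  show "\<exists>f. ae_eq f (f :: real \<Rightarrow> 'a)"
    by (rule exI[of _ "\<lambda>_. 0"]) (simp add: ae_eq_def)
  show "symp (ae_eq :: (real \<Rightarrow> 'a) \<Rightarrow> _)"
    by (auto simp: symp_def ae_eq_def elim: eventually_mono)
  show "transp (ae_eq :: (real \<Rightarrow> 'a) \<Rightarrow> _)"
    by (auto simp: transp_def ae_eq_def elim: eventually_elim2)
qed

instantiation ae_fun :: ("{real_normed_field, euclidean_space}") ab_group_add
begin

lift_definition zero_ae_fun :: "'a ae_fun" is "\<lambda>_. 0"
  by (simp add: ae_eq_def)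

lift_definition plus_ae_fun :: "'a ae_fun \<Rightarrow> 'a ae_fun \<Rightarrow> 'a ae_fun" is "\<lambda>f g x. f x + g x"
  by (auto simp: ae_eq_def elim: eventually_elim2)

lift_definition uminus_ae_fun :: "'a ae_fun \<Rightarrow> 'a ae_fun" is "\<lambda>f x. - f x"
  by (auto simp: ae_eq_def)

lift_definition minus_ae_fun :: "'a ae_fun \<Rightarrow> 'a ae_fun \<Rightarrow> 'a ae_fun" is "\<lambda>f g x. f x - g x"
  by (auto simp: ae_eq_def elim: eventually_elim2)

instance
  by standard (transfer; auto simp: ae_eq_def)+

end

lift_definition ae_smult ::
  "'a::{real_normed_field, euclidean_space} \<Rightarrow> 'a ae_fun \<Rightarrow> 'a ae_fun" is "\<lambda>c f x. c * f x"
  by (auto simp: ae_eq_def elim: eventually_mono)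

global_interpretation ae: linear_space ae_smult
  by unfold_locales (transfer; auto simp: ae_eq_def algebra_simps)+

lift_definition translate ::
  "real \<Rightarrow> 'a::{real_normed_field, euclidean_space} ae_fun \<Rightarrow> 'a ae_fun" is "\<lambda>s f t. f (t + s)"
proof -
  fix s :: real and f g :: "real \<Rightarrow> 'a"
  assume *: "ae_eq f g"
  have "AE t in distr lborel borel ((+) s). f t = g t"
    using * unfolding lborel_distr_plus by (simp add: ae_eq_def)
  then have "AE t in lborel. f (s + t) = g (s + t)"
    by (rule AE_distrD[rotated]) simp
  moreover have [measurable]: "f \<in> borel_measurable borel" "g \<in> borel_measurable borel"
    using * by (simp_all add: ae_eq_def)
  ultimately show "ae_eq (\<lambda>t. f (t + s)) (\<lambda>t. g (t + s))"
    by (simp add: ae_eq_def add.commute)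
qed

lift_definition restr ::
  "real \<Rightarrow> real \<Rightarrow> 'a::{real_normed_field, euclidean_space} ae_fun \<Rightarrow> 'a ae_fun"
  is "\<lambda>a b f t. if t \<in> {a<..<b} then f t else 0"
  by (auto simp: ae_eq_def elim!: eventually_mono)

section \<open>The spaces \<open>L\<^sub>2(a,b)\<close> and \<open>W\<^sup>k(a,b)\<close>\<close>

lift_definition square_integrable :: "'a::{real_normed_field, euclidean_space} ae_fun \<Rightarrow> bool"
  is "\<lambda>f. integrable lborel (\<lambda>t. (norm (f t))\<^sup>2)"
  by (rule integrable_cong_AE) (auto simp: ae_eq_def elim: eventually_mono)

lift_definition L2_norm :: "'a::{real_normed_field, euclidean_space} ae_fun \<Rightarrow> real"
  is "\<lambda>f. sqrt (LINT t|lborel. (norm (f t))\<^sup>2)"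
  by (intro arg_cong[where f = sqrt] integral_cong_AE) (auto simp: ae_eq_def elim: eventually_mono)

text \<open>A function on \<open>(a,b)\<close> is represented by its extension by zero to the real line.\<close>

definition L2 :: "real \<Rightarrow> real \<Rightarrow> 'a::{real_normed_field, euclidean_space} ae_fun set" where
  "L2 a b = {u. square_integrable u \<and> restr a b u = u}"

definition test_function :: "real \<Rightarrow> real \<Rightarrow> (real \<Rightarrow> real) \<Rightarrow> bool" where
  "test_function a b \<phi> \<longleftrightarrow>
     (\<forall>n x. (deriv ^^ n) \<phi> field_differentiable at x) \<and>
     (\<exists>K. compact K \<and> K \<subseteq> {a<..<b} \<and> (\<forall>x. x \<notin> K \<longrightarrow> \<phi> x = 0))"

lemma test_function_measurable:
  assumes "test_function a b \<phi>"
  shows "(deriv ^^ n) \<phi> \<in> borel_measurable borel"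
proof (rule borel_measurable_continuous_onI)
  show "continuous_on UNIV ((deriv ^^ n) \<phi>)"
    using assms by (intro continuous_at_imp_continuous_on ballI field_differentiable_imp_continuous_at)
      (simp add: test_function_def)
qed

text \<open>Weak derivative of order \<open>j\<close> on \<open>(a,b)\<close>, for elements of \<open>L2 a b\<close>.\<close>

lift_definition has_weak_deriv ::
  "real \<Rightarrow> real \<Rightarrow> nat \<Rightarrow> 'a::{real_normed_field, euclidean_space} ae_fun \<Rightarrow> 'a ae_fun \<Rightarrow> bool"
  is "\<lambda>a b j f g. \<forall>\<phi>. test_function a b \<phi> \<longrightarrow>
        (LINT t|lborel. (deriv ^^ j) \<phi> t *\<^sub>R f t) = (- 1) ^ j * (LINT t|lborel. \<phi> t *\<^sub>R g t)"
proof -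
  fix a b :: real and j :: nat and f f' g g' :: "real \<Rightarrow> 'a"
  assume f: "ae_eq f f'" and g: "ae_eq g g'"
  have *: "(LINT t|lborel. (deriv ^^ i) \<phi> t *\<^sub>R h t) = (LINT t|lborel. (deriv ^^ i) \<phi> t *\<^sub>R h' t)"
    if "ae_eq h h'" "test_function a b \<phi>" for h h' :: "real \<Rightarrow> 'a" and \<phi> i
    using that(1) test_function_measurable[OF that(2), of i]
    by (intro integral_cong_AE) (auto simp: ae_eq_def elim: eventually_mono)
  show "(\<forall>\<phi>. test_function a b \<phi> \<longrightarrow>
        (LINT t|lborel. (deriv ^^ j) \<phi> t *\<^sub>R f t) = (- 1) ^ j * (LINT t|lborel. \<phi> t *\<^sub>R g t)) =
    (\<forall>\<phi>. test_function a b \<phi> \<longrightarrow>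
        (LINT t|lborel. (deriv ^^ j) \<phi> t *\<^sub>R f' t) = (- 1) ^ j * (LINT t|lborel. \<phi> t *\<^sub>R g' t))"
    using *[OF f, of _ j] *[OF g, of _ 0] by simp
qed

definition weak_deriv ::
  "real \<Rightarrow> real \<Rightarrow> nat \<Rightarrow> 'a::{real_normed_field, euclidean_space} ae_fun \<Rightarrow> 'a ae_fun" where
  "weak_deriv a b j u = (THE w. w \<in> L2 a b \<and> has_weak_deriv a b j u w)"

definition sobolev ::
  "real \<Rightarrow> real \<Rightarrow> nat \<Rightarrow> 'a::{real_normed_field, euclidean_space} ae_fun set" where
  "sobolev a b k = {u \<in> L2 a b. \<forall>j\<le>k. \<exists>w\<in>L2 a b. has_weak_deriv a b j u w}"

definition sobolev_norm ::
  "real \<Rightarrow> real \<Rightarrow> nat \<Rightarrow> 'a::{real_normed_field, euclidean_space} ae_fun \<Rightarrow> real" where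
  "sobolev_norm a b k u = sqrt (\<Sum>j\<le>k. (L2_norm (weak_deriv a b j u))\<^sup>2)"

lift_definition continuous_rep ::
  "real \<Rightarrow> real \<Rightarrow> 'a::{real_normed_field, euclidean_space} ae_fun \<Rightarrow> (real \<Rightarrow> 'a) \<Rightarrow> bool"
  is "\<lambda>a b f g. continuous_on {a..b} g \<and> (AE t in lborel. t \<in> {a<..<b} \<longrightarrow> f t = g t)"
  by (intro ext conj_cong refl iffI) (auto simp: ae_eq_def elim: eventually_elim2)

text \<open>The boundary values of an element of \<open>W\<^sup>1\<close> are those of its continuous representative.\<close>

definition sobolev1_0 ::
  "real \<Rightarrow> real \<Rightarrow> 'a::{real_normed_field, euclidean_space} ae_fun set" where
  "sobolev1_0 a b = {u \<in> sobolev a b 1. \<exists>g. continuous_rep a b u g \<and> g a = 0 \<and> g b = 0}"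

section \<open>The difference operator and the associated matrices\<close>

definition diff_op ::
  "nat \<Rightarrow> (int \<Rightarrow> real) \<Rightarrow> 'a::{real_normed_field, euclidean_space} ae_fun \<Rightarrow> 'a ae_fun" where
  "diff_op N b v = (\<Sum>j\<in>{- int N..int N}. ae_smult (of_real (b j)) (translate (of_int j) v))"

text \<open>
  With functions on \<open>(0, N+1)\<close> represented by their zero extensions, the extension operator
  \<open>I\<^sub>Q\<close> is the inclusion and the restriction operator \<open>P\<^sub>Q\<close> is \<open>restr 0 (N+1)\<close>.
\<close>

definition diff_op_Q ::
  "nat \<Rightarrow> (int \<Rightarrow> real) \<Rightarrow> 'a::{real_normed_field, euclidean_space} ae_fun \<Rightarrow> 'a ae_fun" where
  "diff_op_Q N b u = restr 0 (real N + 1) (diff_op N b u)"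

definition dom_A ::
  "nat \<Rightarrow> (int \<Rightarrow> real) \<Rightarrow> nat \<Rightarrow> 'a::{real_normed_field, euclidean_space} ae_fun set" where
  "dom_A N b k = {u \<in> sobolev1_0 0 (real N + 1).
     u \<in> sobolev 0 (real N + 1) (k + 2) \<and> diff_op_Q N b u \<in> sobolev 0 (real N + 1) (k + 2)}"

definition op_A ::
  "nat \<Rightarrow> (int \<Rightarrow> real) \<Rightarrow> 'a::{real_normed_field, euclidean_space} ae_fun \<Rightarrow> 'a ae_fun" where
  "op_A N b v = - weak_deriv 0 (real N + 1) 2 (diff_op_Q N b v)"

text \<open>Matrix and vector indices are zero-based; \<open>b (k - i)\<close> is unaffected by the shift.\<close>

definition mat_R1 :: "nat \<Rightarrow> (int \<Rightarrow> real) \<Rightarrow> real Matrix.mat" where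
  "mat_R1 N b = Matrix.mat (N + 1) (N + 1) (\<lambda>(i, k). b (int k - int i))"

definition mat_R2 :: "nat \<Rightarrow> (int \<Rightarrow> real) \<Rightarrow> real Matrix.mat" where
  "mat_R2 N b = mat_delete (mat_R1 N b) N N"

definition delete_row :: "'c Matrix.mat \<Rightarrow> nat \<Rightarrow> 'c Matrix.mat" where
  "delete_row A r = Matrix.mat (dim_row A - 1) (dim_col A)
     (\<lambda>(i, k). A $$ (if i < r then i else Suc i, k))"

definition vec_G1 :: "nat \<Rightarrow> (int \<Rightarrow> real) \<Rightarrow> real Matrix.vec" where
  "vec_G1 N b = col (delete_row (mat_R1 N b) 0) 0"

definition vec_G2 :: "nat \<Rightarrow> (int \<Rightarrow> real) \<Rightarrow> real Matrix.vec" where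
  "vec_G2 N b = col (delete_row (mat_R1 N b) N) N"

definition lin_indep_pair :: "'c::comm_ring_1 Matrix.vec \<Rightarrow> 'c Matrix.vec \<Rightarrow> bool" where
  "lin_indep_pair v w \<longleftrightarrow>
     (\<forall>\<alpha> \<beta>. \<alpha> \<cdot>\<^sub>v v + \<beta> \<cdot>\<^sub>v w = 0\<^sub>v (dim_vec v) \<longrightarrow> \<alpha> = 0 \<and> \<beta> = 0)"

end

theory Submission
  imports Defs
begin

text \<open>
  Cut \<open>(0,N+1)\<close> into unit intervals: on them \<open>R\<^sub>Q\<close> acts as the matrix \<open>R\<^sub>1\<close>. For \<open>u\<close> in \<open>W\<^sup>1\<close> the derivative
  of \<open>R\<^sub>Q u\<close> is \<open>R\<^sub>Q u'\<close> plus point masses at \<open>1,\<dots>,N\<close> given by the vector \<open>u(0) G\<^sup>1\<^sub>1 - u(N+1) G\<^sup>2\<^sub>N\<^sub>+\<^sub>1\<close>.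
  So \<open>A\<^sub>R\<^sup>k u = - R\<^sub>Q u''\<close>, which is injective, and its range and graph are closed because weak derivatives
  pass to \<open>L\<^sub>2\<close>-limits.

  For the codimension let \<open>S\<close> be the inverse of \<open>R\<^sub>1\<close>. A function \<open>w\<close> is \<open>R\<^sub>Q u\<close> with \<open>u\<close> in the domain iff all
  jumps of the piecewise function \<open>S w\<^sup>(\<^sup>\<mu>\<^sup>)\<close>, \<open>\<mu> \<le> k + 1\<close>, vanish and \<open>S w\<close> is zero at both ends.
  Since \<open>det R\<^sub>2 = 0\<close>, the corner entries of \<open>S\<close> vanish and the kernel of \<open>R\<^sub>2\<close> is spanned by the last column
  of \<open>S\<close>. Hence the end values of \<open>S w\<close> are proportional to one functional \<open>\<alpha>\<close> of the values of \<open>w\<close> at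
  \<open>0,\<dots>,N+1\<close>, and all jumps vanish iff one of them, \<open>\<tau>\<close>, vanishes and, when the two columns are independent,
  also \<open>\<alpha> = 0\<close>. The conditions are therefore \<open>\<tau>(w\<^sup>(\<^sup>\<mu>\<^sup>)) = 0\<close> for all \<open>\<mu>\<close>, and \<open>\<alpha>(w\<^sup>(\<^sup>\<mu>\<^sup>)) = 0\<close> for all \<open>\<mu>\<close> or only
  for \<open>\<mu> = 0\<close>: these are \<open>2 (k + 2)\<close> or \<open>k + 3\<close> independent functionals. Passing from \<open>w\<close> to \<open>- w''\<close> kills the two
  dimensional space of affine functions, which meets their common kernel trivially.
\<close>

no_notation Finite_Cartesian_Product.vector_scalar_mult (infixl "*s" 70)

section \<open>Smooth functions with compact support\<close>

text \<open>Weak derivatives are handled as distributions: a class acts on continuous functions by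
  \<open>pairing\<close>, and every statement about traces or jumps is an integration by parts
  against a C^1 function that need not vanish at the ends. Shrinking bumps show that no L_2 function
  can absorb a point mass, so the jump conditions are necessary as well as sufficient. The algebra
  rests on one identity. If d lists the jumps of S w and x, y are its end values at 0 and N+1, the
  Toeplitz structure gives R_2 d = x G1 - y G2, where G1 and G2 are the two columns of the
  statement. The last row of S, its zero corner entry dropped, is a left null vector of R_2 whose
  product with G2 is 1; multiplying by it expresses y through x. Traces of orders up to k + 1 at the
  integers can be prescribed at will, so independence of the functionals is a question about vectors
  with N+2 coordinates. Closedness of the range needs no compactness: S recovers the derivatives of
  u of order 2 and higher from those of A u, and an explicit solution of the Dirichlet problem
  supplies orders 0 and 1.\<close>

definition flat :: "real poly \<Rightarrow> real \<Rightarrow> real" where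
  "flat p x = (if x > 0 then poly p (1 / x) * exp (- (1 / x)) else 0)"

lemma poly_times_exp_tendsto_0: "((\<lambda>y::real. poly p y * exp (- y)) \<longlongrightarrow> 0) at_top"
proof -
  have "((\<lambda>y::real. \<Sum>i\<le>degree p. coeff p i * (y ^ i / exp y)) \<longlongrightarrow> (\<Sum>i\<le>degree p. coeff p i * 0)) at_top"
    by (intro tendsto_intros tendsto_power_div_exp_0)
  then show ?thesis
    by (simp add: poly_altdef sum_distrib_right exp_minus divide_inverse mult.assoc)
qed

text \<open>In the variable y = 1/x differentiation becomes p -> y^2 (p - p'), so the family is
  closed under it. At 0 only the limit from the right needs an argument: there exp(-y) beats every
  polynomial in y.\<close>

lemma flat_deriv: "(flat p has_field_derivative flat (monom 1 2 * (p - pderiv p)) x) (at x)"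
proof -
  consider "x > 0" | "x < 0" | "x = 0" by linarith
  then show ?thesis
  proof cases
    case 1
    have "((\<lambda>x. poly p (1 / x) * exp (- (1 / x))) has_field_derivative
        flat (monom 1 2 * (p - pderiv p)) x) (at x)"
      using 1 by (auto intro!: derivative_eq_intros DERIV_chain'[OF _ poly_DERIV]
          simp: flat_def poly_monom field_simps power2_eq_square)
    then show ?thesis
      by (rule has_field_derivative_transform_within_open[of _ _ _ "{0<..}"]) (use 1 in \<open>auto simp: flat_def\<close>)
  next
    case 2
    have "((\<lambda>x. 0) has_field_derivative flat (monom 1 2 * (p - pderiv p)) x) (at x)"
      using 2 by (auto simp: flat_def)
    then show ?thesis
      by (rule has_field_derivative_transform_within_open[of _ _ _ "{..<0}"]) (use 2 in \<open>auto simp: flat_def\<close>)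
  next
    case 3
    have "((\<lambda>y. flat p y / y) \<longlongrightarrow> 0) (at_left 0)"
      by (rule tendsto_eventually) (auto simp: flat_def eventually_at_filter)
    moreover have "((\<lambda>y. flat p y / y) \<longlongrightarrow> 0) (at_right 0)"
    proof -
      \<comment> \<open>Dividing by the argument multiplies the polynomial in its inverse by the
        variable, hence \<open>pCons 0 p\<close>.\<close>
      have "((\<lambda>y. poly (pCons 0 p) (inverse y) * exp (- (inverse y))) \<longlongrightarrow> 0) (at_right 0)"
        by (rule filterlim_compose[OF poly_times_exp_tendsto_0 filterlim_inverse_at_top_right])
      then show ?thesis
        by (rule Lim_transform_eventually) (auto simp: eventually_at_filter flat_def divide_inverse)
    qed
    ultimately have "((\<lambda>y. flat p y / y) \<longlongrightarrow> 0) (at 0)"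
      by (simp add: filterlim_at_split)
    then show ?thesis
      using 3 by (simp add: has_field_derivative_iff flat_def)
  qed
qed

text \<open>Once every member is known to have its derivative in the set, all iterated derivatives
  exist by induction, without any formula for them.\<close>

inductive_set flat_algebra :: "(real \<Rightarrow> real) set" where
  flat_affine: "(\<lambda>t. flat p (m * t + c)) \<in> flat_algebra"
| flat_add: "f \<in> flat_algebra \<Longrightarrow> g \<in> flat_algebra \<Longrightarrow> (\<lambda>t. f t + g t) \<in> flat_algebra"
| flat_mult: "f \<in> flat_algebra \<Longrightarrow> g \<in> flat_algebra \<Longrightarrow> (\<lambda>t. f t * g t) \<in> flat_algebra"

lemma flat_algebra_has_deriv:
  assumes "f \<in> flat_algebra"
  shows "\<exists>g\<in>flat_algebra. \<forall>x. (f has_field_derivative g x) (at x)"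
  using assms
proof induction
  case (flat_affine p m c)
  let ?q = "Polynomial.smult m (monom 1 2 * (p - pderiv p))"
  have "((\<lambda>t. flat p (m * t + c)) has_field_derivative flat ?q (m * x + c)) (at x)" for x
  proof -
    have "((\<lambda>t. flat p (m * t + c)) has_field_derivative
        flat (monom 1 2 * (p - pderiv p)) (m * x + c) * m) (at x)"
      by (rule DERIV_chain2[OF flat_deriv]) (auto intro!: derivative_eq_intros)
    then show ?thesis
      by (simp add: flat_def mult_ac split: if_splits)
  qed
  then show ?case
    by (intro bexI[of _ "\<lambda>x. flat ?q (m * x + c)"] flat_algebra.flat_affine) auto
next
  case (flat_add f g)
  then obtain f' g' where "f' \<in> flat_algebra" "g' \<in> flat_algebra"
    "\<forall>x. (f has_field_derivative f' x) (at x)" "\<forall>x. (g has_field_derivative g' x) (at x)"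
    by blast
  then show ?case
    by (intro bexI[of _ "\<lambda>x. f' x + g' x"]) (auto intro!: derivative_eq_intros flat_algebra.flat_add)
next
  case (flat_mult f g)
  then obtain f' g' where "f' \<in> flat_algebra" "g' \<in> flat_algebra"
    "\<forall>x. (f has_field_derivative f' x) (at x)" "\<forall>x. (g has_field_derivative g' x) (at x)"
    by blast
  with flat_mult show ?case
    by (intro bexI[of _ "\<lambda>x. f' x * g x + f x * g' x"])
      (auto intro!: derivative_eq_intros flat_algebra.flat_add flat_algebra.flat_mult simp: mult_ac)
qed

lemma flat_algebra_deriv: "f \<in> flat_algebra \<Longrightarrow> deriv f \<in> flat_algebra"
  using flat_algebra_has_deriv[of f] DERIV_imp_deriv[of f] by (metis ext)

lemma test_function_flat_algebra:
  assumes "f \<in> flat_algebra" "a < c" "d < b" "\<And>x. x \<notin> {c..d} \<Longrightarrow> f x = 0"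
  shows "test_function a b f"
  unfolding test_function_def
proof (intro conjI allI)
  fix n x
  have "(deriv ^^ n) f \<in> flat_algebra"
    by (induction n) (use assms in \<open>auto intro: flat_algebra_deriv\<close>)
  then show "(deriv ^^ n) f field_differentiable at x"
    using flat_algebra_has_deriv field_differentiable_def by blast
  show "\<exists>K. compact K \<and> K \<subseteq> {a<..<b} \<and> (\<forall>x. x \<notin> K \<longrightarrow> f x = 0)"
    using assms by (intro exI[of _ "{c..d}"]) auto
qed

text \<open>A rising and a falling factor exp(-1/y), with \<open>m\<close> the steepness. Letting
  \<open>m\<close> grow approximates an indicator; tying \<open>m\<close> to the inverse of the half
  width keeps the height at the centre fixed. Both regimes are used.\<close>

definition bump :: "real \<Rightarrow> real \<Rightarrow> real \<Rightarrow> real \<Rightarrow> real" where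
  "bump c d m t = flat 1 (m * (t - c)) * flat 1 (m * (d - t))"

lemma bump_flat_algebra: "bump c d m \<in> flat_algebra"
proof -
  have "bump c d m = (\<lambda>t. flat 1 (m * t + (- m * c)) * flat 1 ((- m) * t + m * d))"
    by (simp add: bump_def fun_eq_iff algebra_simps)
  then show ?thesis
    by (simp only:) (intro flat_algebra.flat_affine flat_algebra.flat_mult)
qed

lemma flat_one_bounds: "0 \<le> flat 1 x" "flat 1 x \<le> 1"
  by (auto simp: flat_def)

lemma bump_bounds: "0 \<le> bump c d m t" "bump c d m t \<le> 1"
  unfolding bump_def using flat_one_bounds by (auto intro: mult_le_one)

lemma bump_eq_0: "m > 0 \<Longrightarrow> t \<notin> {c..d} \<Longrightarrow> bump c d m t = 0"
  by (auto simp: bump_def flat_def zero_less_mult_iff)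

lemma bump_pos: "m > 0 \<Longrightarrow> t \<in> {c<..<d} \<Longrightarrow> bump c d m t > 0"
  by (auto simp: bump_def flat_def)

lemma test_function_bump: "m > 0 \<Longrightarrow> a < c \<Longrightarrow> d < b \<Longrightarrow> test_function a b (bump c d m)"
  by (rule test_function_flat_algebra[OF bump_flat_algebra]) (auto intro: bump_eq_0)

lemma flat_one_tendsto_1: "(flat 1 \<longlongrightarrow> 1) at_top"
proof -
  have "((\<lambda>x::real. exp (- (1 / x))) \<longlongrightarrow> exp (- 0)) at_top"
    by (intro tendsto_intros tendsto_divide_0[OF tendsto_const] filterlim_at_top_imp_at_infinity filterlim_ident)
  then have "((\<lambda>x::real. exp (- (1 / x))) \<longlongrightarrow> 1) at_top"
    by simp
  then show ?thesis
    by (rule Lim_transform_eventually) (auto simp: flat_def eventually_at_top_dense intro!: exI[of _ 0])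
qed

text \<open>The ends move inwards by 1/(n+1), so that the support stays strictly inside the interval
  and the bump is a test function there; the steepness n+1 still sends both arguments of
  \<open>flat\<close> to infinity at every inner point.\<close>

lemma bump_tendsto_indicator:
  "(\<lambda>n. bump (c + 1 / real (Suc n)) (d - 1 / real (Suc n)) (real (Suc n)) t)
     \<longlonglongrightarrow> indicator {c<..<d} t"
proof -
  have eq: "bump (c + 1 / real (Suc n)) (d - 1 / real (Suc n)) (real (Suc n)) t =
      flat 1 (real (Suc n) * (t - c) - 1) * flat 1 (real (Suc n) * (d - t) - 1)" for n
  proof -
    have "real (Suc n) * (t - (c + 1 / real (Suc n))) = real (Suc n) * (t - c) - 1"
      "real (Suc n) * (d - 1 / real (Suc n) - t) = real (Suc n) * (d - t) - 1"
      by (simp_all add: right_diff_distrib distrib_left del: of_nat_Suc)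
    then show ?thesis
      by (simp add: bump_def)
  qed
  show ?thesis
  proof (cases "t \<in> {c<..<d}")
    case True
    have lin: "filterlim (\<lambda>n. real (Suc n) * x - 1) at_top sequentially" if "x > 0" for x :: real
    proof -
      have "filterlim (\<lambda>n. (-1) + x * real (Suc n)) at_top sequentially"
        using that
        by (intro filterlim_tendsto_add_at_top[OF tendsto_const] filterlim_tendsto_pos_mult_at_top[OF tendsto_const]
            filterlim_compose[OF filterlim_real_sequentially filterlim_Suc])
      then show ?thesis
        by (simp add: algebra_simps)
    qed
    have "(\<lambda>n. bump (c + 1 / real (Suc n)) (d - 1 / real (Suc n)) (real (Suc n)) t) \<longlonglongrightarrow> 1 * 1"
      unfolding eq
      by (intro tendsto_mult filterlim_compose[OF flat_one_tendsto_1] lin) (use True in auto)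
    then show ?thesis
      using True by simp
  next
    case False
    then have "bump (c + 1 / real (Suc n)) (d - 1 / real (Suc n)) (real (Suc n)) t = 0" for n
    proof -
      have "t \<notin> {c + e..d - e}" if "e > 0" for e
        using False that by auto
      then show ?thesis
        by (intro bump_eq_0) (simp_all del: of_nat_Suc)
    qed
    then show ?thesis
      using False by simp
  qed
qed

section \<open>Calculus of test functions\<close>

lemma test_function_deriv: "test_function a b \<phi> \<Longrightarrow> (\<phi> has_field_derivative deriv \<phi> x) (at x)"
  unfolding test_function_def using field_differentiable_derivI[of \<phi> x]
  by (metis funpow_0)

lemma test_function_deriv_test:
  assumes "test_function a b \<phi>" shows "test_function a b (deriv \<phi>)"
proof -
  obtain K where K: "compact K" "K \<subseteq> {a<..<b}" "\<forall>x. x \<notin> K \<longrightarrow> \<phi> x = 0"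
    using assms by (auto simp: test_function_def)
  have "deriv \<phi> x = 0" if "x \<notin> K" for x
  proof (rule DERIV_imp_deriv)
    show "(\<phi> has_field_derivative 0) (at x)"
      by (rule has_field_derivative_transform_within_open[of "\<lambda>_. 0" _ _ "- K"])
        (use K that in \<open>auto simp: compact_imp_closed open_Compl\<close>)
  qed
  moreover have "(deriv ^^ n) (deriv \<phi>) field_differentiable at x" for n x
    using assms unfolding test_function_def by (metis funpow_Suc_right o_apply)
  ultimately show ?thesis
    using K unfolding test_function_def by blast
qed

lemma test_function_continuous: "test_function a b \<phi> \<Longrightarrow> continuous_on S \<phi>"
  by (rule DERIV_continuous_on[OF has_field_derivative_at_within[OF test_function_deriv]])

lemma test_function_borel [measurable_dest]: "test_function a b \<phi> \<Longrightarrow> \<phi> \<in> borel_measurable borel"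
  using test_function_measurable[of a b \<phi> 0] by simp

lemma test_function_mono: "test_function a b \<phi> \<Longrightarrow> a' \<le> a \<Longrightarrow> b \<le> b' \<Longrightarrow> test_function a' b' \<phi>"
  unfolding test_function_def by force

lemma test_function_support:
  assumes "test_function a b \<phi>" "a < b"
  obtains c d where "a < c" "c \<le> d" "d < b" "\<And>x. x \<notin> {c..d} \<Longrightarrow> \<phi> x = 0"
proof -
  obtain K where K: "compact K" "K \<subseteq> {a<..<b}" "\<forall>x. x \<notin> K \<longrightarrow> \<phi> x = 0"
    using assms by (auto simp: test_function_def)
  show ?thesis
  proof (cases "K = {}")
    case True
    \<comment> \<open>The zero function may have empty support; the midpoint then serves as a
      degenerate interval.\<close>
    with K assms that[of "(a + b) / 2" "(a + b) / 2"] show ?thesis by auto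
  next
    case False
    then obtain c d where "c \<in> K" "\<forall>x\<in>K. c \<le> x" "d \<in> K" "\<forall>x\<in>K. x \<le> d"
      using K(1) compact_attains_inf compact_attains_sup by metis
    moreover from this K(2) have "a < c" "d < b" by auto
    moreover have "\<phi> x = 0" if "x \<notin> {c..d}" for x
      using that K(3) \<open>\<forall>x\<in>K. c \<le> x\<close> \<open>\<forall>x\<in>K. x \<le> d\<close> by (meson atLeastAtMost_iff)
    ultimately show ?thesis
      using that[of c d] by blast
  qed
qed

lemma test_function_eq_0: "test_function a b \<phi> \<Longrightarrow> x \<notin> {a<..<b} \<Longrightarrow> \<phi> x = 0"
  unfolding test_function_def by blast

lemma test_function_bounded:
  assumes "test_function a b \<phi>" obtains C where "\<And>x. \<bar>\<phi> x\<bar> \<le> C"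
proof -
  obtain K where K: "compact K" "\<forall>x. x \<notin> K \<longrightarrow> \<phi> x = 0"
    using assms by (auto simp: test_function_def)
  have "bounded (\<phi> ` K)"
    using K test_function_continuous[OF assms] compact_continuous_image compact_imp_bounded by blast
  then obtain C where "\<forall>x\<in>K. \<bar>\<phi> x\<bar> \<le> C"
    by (auto simp: bounded_real)
  with K show ?thesis
    by (intro that[of "max C 0"]) (metis abs_zero max.cobounded2 max.coboundedI1)
qed

lemma test_function_integrable:
  assumes "test_function a b \<phi>" shows "integrable lborel \<phi>"
proof -
  obtain K where K: "compact K" "\<forall>x. x \<notin> K \<longrightarrow> \<phi> x = 0"
    using assms by (auto simp: test_function_def)
  have "set_integrable lborel K \<phi>"
    unfolding set_integrable_def
    by (rule borel_integrable_compact[OF K(1) test_function_continuous[OF assms]])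
  moreover have "(\<lambda>x. indicator K x *\<^sub>R \<phi> x) = \<phi>"
    by (rule ext) (use K in \<open>auto simp: indicator_def\<close>)
  ultimately show ?thesis
    by (simp add: set_integrable_def)
qed

text \<open>The integral from the left end of the support is zero again to the right of it exactly
  because the total integral vanishes. This identifies the derivatives among the test functions, as
  the du Bois-Reymond argument requires.\<close>

lemma test_function_antiderivative:
  assumes \<psi>: "test_function a b \<psi>" and "a < b" and int0: "(LINT t|lborel. \<psi> t) = 0"
  shows "\<exists>\<phi>. test_function a b \<phi> \<and> deriv \<phi> = \<psi>"
proof -
  obtain c d where cd: "a < c" "c \<le> d" "d < b" "\<And>x. x \<notin> {c..d} \<Longrightarrow> \<psi> x = 0"
    using test_function_support[OF \<psi> \<open>a < b\<close>] by blast
  define \<phi> where "\<phi> t = (if t \<le> c then 0 else integral {c..t} \<psi>)" for t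
  have int: "\<psi> integrable_on {x..y}" for x y
    by (rule integrable_continuous_interval[OF test_function_continuous[OF \<psi>]])
  have eq: "\<phi> t = integral {e..t} \<psi>" if "e \<le> c" "e \<le> t" for t e
  proof -
    have z: "integral {e..min t c} \<psi> = 0"
    proof -
      have "integral {e..min t c} \<psi> = integral {e..min t c} (\<lambda>_. 0)"
        by (rule integral_spike[of "{c}"]) (auto simp: cd(4))
      then show ?thesis by simp
    qed
    show ?thesis
    proof (cases "t \<le> c")
      case True
      with z show ?thesis by (simp add: \<phi>_def min_def)
    next
      case False
      have "integral {e..c} \<psi> + integral {c..t} \<psi> = integral {e..t} \<psi>"
        using False that int by (intro Henstock_Kurzweil_Integration.integral_combine) auto
      with z False show ?thesis by (simp add: \<phi>_def min_def)
    qed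
  qed
  have deriv: "(\<phi> has_field_derivative \<psi> x) (at x)" for x
  proof -
    \<comment> \<open>A base point to the left of both the support and \<open>x\<close> makes
      \<open>x\<close> an inner point, so the derivative within the interval is the full
      derivative.\<close>
    define e where "e = min c x - 1"
    have "((\<lambda>t. integral {e..t} \<psi>) has_field_derivative \<psi> x) (at x within {e..x+1})"
      by (rule integral_has_real_derivative[OF test_function_continuous[OF \<psi>]]) (auto simp: e_def)
    then have "((\<lambda>t. integral {e..t} \<psi>) has_field_derivative \<psi> x) (at x within {e<..<x+1})"
      by (rule DERIV_subset) auto
    then have "((\<lambda>t. integral {e..t} \<psi>) has_field_derivative \<psi> x) (at x)"
      by (subst (asm) at_within_open) (auto simp: e_def)
    then show ?thesis
      by (rule has_field_derivative_transform_within_open[of _ _ _ "{e<..<x+1}"])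
        (auto simp: e_def intro!: eq[symmetric])
  qed
  have dphi: "deriv \<phi> = \<psi>"
    using deriv by (auto intro!: DERIV_imp_deriv)
  have tot: "integral {c..d} \<psi> = 0"
  proof -
    have "(LINT t:{c..d}|lborel. \<psi> t) = integral {c..d} \<psi>"
      by (rule set_borel_integral_eq_integral)
        (simp only: set_integrable_def, intro integrable_mult_indicator test_function_integrable[OF \<psi>], simp)
    moreover have "(LINT t:{c..d}|lborel. \<psi> t) = (LINT t|lborel. \<psi> t)"
      unfolding set_lebesgue_integral_def
      by (intro Bochner_Integration.integral_cong) (use cd(4) in \<open>force simp: indicator_def\<close>)+
    ultimately show ?thesis using int0 by simp
  qed
  have "\<phi> x = 0" if "x \<notin> {c..d}" for x
  proof (cases "x \<le> c")
    case False
    then have "d < x" using that by auto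
    have "integral {c..d} \<psi> + integral {d..x} \<psi> = integral {c..x} \<psi>"
      using cd \<open>d < x\<close> int by (intro Henstock_Kurzweil_Integration.integral_combine) auto
    moreover have "integral {d..x} \<psi> = integral {d..x} (\<lambda>_. 0)"
      by (rule integral_spike[of "{d}"]) (auto simp: cd(4))
    ultimately show ?thesis
      using tot by (simp add: \<phi>_def)
  qed (simp add: \<phi>_def)
  moreover have "(deriv ^^ n) \<phi> field_differentiable at x" for n x
  proof (cases n)
    case 0
    then show ?thesis using deriv by (auto simp: field_differentiable_def)
  next
    case (Suc m)
    then show ?thesis
      using \<psi> dphi unfolding test_function_def by (simp add: funpow_Suc_right del: funpow.simps)
  qed
  ultimately have "test_function a b \<phi>"
    using cd unfolding test_function_def by (intro conjI exI[of _ "{c..d}"]) auto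
  with dphi show ?thesis by blast
qed

section \<open>Primitives of integrable functions\<close>

text \<open>Bumps converge boundedly to indicators, so \<open>q\<close> has zero integral over every
  open subinterval. Intervals are stable under intersection and generate the Borel sets, so the
  integral vanishes over every Borel set.\<close>

lemma fundamental_lemma:
  fixes q :: "real \<Rightarrow> 'a::{real_normed_field, euclidean_space}"
  assumes q: "integrable lborel q"
    and orth: "\<And>\<phi>. test_function a b \<phi> \<Longrightarrow> (LINT t|lborel. \<phi> t *\<^sub>R q t) = 0"
  shows "AE t in lborel. t \<in> {a<..<b} \<longrightarrow> q t = 0"
proof -
  have [measurable]: "q \<in> borel_measurable borel"
    using q by auto
  define q' where "q' t = indicator {a<..<b} t *\<^sub>R q t" for t
  have q': "integrable lborel q'"
    unfolding q'_def by (intro integrable_mult_indicator q) simp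
  have [measurable]: "q' \<in> borel_measurable borel"
    using q' by auto
  have intervals: "(LINT t:{c<..<d}|lborel. q' t) = 0" for c d
  proof -
    \<comment> \<open>Test functions on (a,b) reach only the part of (c,d) inside (a,b); elsewhere
      \<open>q'\<close> is zero.\<close>
    define c' d' where "c' = max a c" and "d' = min b d"
    let ?\<phi> = "\<lambda>n. bump (c' + 1 / real (Suc n)) (d' - 1 / real (Suc n)) (real (Suc n))"
    have test: "test_function a b (?\<phi> n)" for n
    proof (rule test_function_bump)
      have "1 / real (Suc n) > 0" by simp
      then show "a < c' + 1 / real (Suc n)" "d' - 1 / real (Suc n) < b"
        unfolding c'_def d'_def by linarith+
    qed simp
    have "(\<lambda>n. LINT t|lborel. ?\<phi> n t *\<^sub>R q t) \<longlonglongrightarrow> (LINT t|lborel. indicator {c'<..<d'} t *\<^sub>R q t)"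
    proof (rule integral_dominated_convergence[where w = "\<lambda>t. norm (q t)"])
      show "(\<lambda>t. ?\<phi> n t *\<^sub>R q t) \<in> borel_measurable lborel" for n
        using test_function_borel[OF test[of n]] by (intro borel_measurable_scaleR) auto
      show "AE t in lborel. (\<lambda>n. ?\<phi> n t *\<^sub>R q t) \<longlonglongrightarrow> indicator {c'<..<d'} t *\<^sub>R q t"
        by (intro AE_I2 tendsto_scaleR bump_tendsto_indicator tendsto_const)
      show "AE t in lborel. norm (?\<phi> n t *\<^sub>R q t) \<le> norm (q t)" for n
        using bump_bounds by (intro AE_I2) (simp add: mult_left_le_one_le)
    qed (use q in auto)
    then have "(LINT t|lborel. indicator {c'<..<d'} t *\<^sub>R q t) = 0"
      using orth[OF test] by (simp add: LIMSEQ_const_iff)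
    moreover have "indicator {c'<..<d'} t *\<^sub>R q t = indicator {c<..<d} t *\<^sub>R q' t" for t
      by (auto simp: c'_def d'_def q'_def indicator_def)
    ultimately show ?thesis
      by (simp add: set_lebesgue_integral_def)
  qed
  have "(LINT t:A|lborel. q' t) = 0" if "A \<in> sets lborel" for A
  proof -
    let ?G = "range (\<lambda>(c, d). {c<..<d :: real})"
    have sets_eq: "sigma_sets UNIV ?G = sets borel"
      using arg_cong[OF borel_eq_box[where 'a = real], of sets] by (simp add: box_real)
    have "Int_stable ?G"
    proof (rule Int_stableI)
      fix A B :: "real set"
      assume "A \<in> ?G" "B \<in> ?G"
      then obtain c d c' d' where "A = {c<..<d}" "B = {c'<..<d'}" by auto
      then have "A \<inter> B = {max c c'<..<min d d'}" by auto
      then show "A \<inter> B \<in> ?G" by auto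
    qed
    moreover have "?G \<subseteq> Pow UNIV" by simp
    moreover have "A \<in> sigma_sets UNIV ?G"
      using that sets_eq by simp
    ultimately show ?thesis
    proof (induction rule: sigma_sets_induct_disjoint)
      case (basic A)
      then show ?case using intervals by auto
    next
      case empty
      show ?case unfolding set_lebesgue_integral_def by simp
    next
      case (compl A)
      then have A[measurable]: "A \<in> sets borel"
        by (simp add: sets_eq)
      \<comment> \<open>Complements need the total integral, which is that over (a,b) because
        \<open>q'\<close> vanishes elsewhere.\<close>
      have "(LINT t|lborel. q' t) = 0"
        using intervals[of a b] unfolding set_lebesgue_integral_def q'_def scaleR_scaleR indicator_inter_arith[symmetric]
        by simp
      moreover have "(LINT t:UNIV - A|lborel. q' t) = (LINT t|lborel. q' t - indicator A t *\<^sub>R q' t)"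
        unfolding set_lebesgue_integral_def
        by (intro Bochner_Integration.integral_cong) (auto simp: indicator_def)
      moreover have "\<dots> = (LINT t|lborel. q' t) - (LINT t:A|lborel. q' t)"
        unfolding set_lebesgue_integral_def
        by (intro Bochner_Integration.integral_diff q' integrable_mult_indicator) simp
      ultimately show ?case using compl by simp
    next
      case (union F)
      then have F: "F i \<in> sets lborel" for i
        by (simp add: sets_eq)
      have "(LINT t:\<Union>(range F)|lborel. q' t) = (\<Sum>i. LINT t:F i|lborel. q' t)"
      proof (rule lebesgue_integral_countable_add)
        show "set_integrable lborel (\<Union>(range F)) q'"
          unfolding set_integrable_def using F by (intro integrable_mult_indicator q') auto
        show "F i \<inter> F j = {}" if "i \<noteq> j" for i j
          using union that by (auto simp: disjoint_family_on_def)
      qed (rule F)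
      then show ?case using union by simp
    qed
  qed
  then have "AE t in lborel. q' t = 0"
    by (intro sigma_finite_measure.density_zero[OF sigma_finite_lborel] q')
  then show ?thesis
    by (auto simp: q'_def elim!: eventually_mono)
qed

text \<open>Integrating from minus infinity avoids a base point. For a function that vanishes to the
  left of \<open>a\<close> this is the integral from \<open>a\<close>.\<close>

definition prim :: "(real \<Rightarrow> 'a::{real_normed_field, euclidean_space}) \<Rightarrow> real \<Rightarrow> 'a" where
  "prim v t = (LINT s:{..t}|lborel. v s)"

lemma set_integrable_lborel:
  fixes v :: "real \<Rightarrow> 'a::{real_normed_field, euclidean_space}"
  shows "integrable lborel v \<Longrightarrow> A \<in> sets borel \<Longrightarrow> set_integrable lborel A v"
  unfolding set_integrable_def by (intro integrable_mult_indicator) auto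

lemma prim_diff:
  assumes "integrable lborel v" "c \<le> d"
  shows "prim v d - prim v c = (LINT s:{c<..d}|lborel. v s)"
proof -
  have "{..d} = {..c} \<union> {c<..d}" using assms by auto
  then have "prim v d = (LINT s:{..c} \<union> {c<..d}|lborel. v s)"
    by (simp add: prim_def)
  also have "\<dots> = prim v c + (LINT s:{c<..d}|lborel. v s)"
    unfolding prim_def by (rule set_integral_Un) (auto intro: set_integrable_lborel assms)
  finally show ?thesis by simp
qed

lemma prim_continuous:
  assumes v: "integrable lborel v"
  shows "continuous_on S (prim v)"
proof (rule continuous_at_imp_continuous_on, rule ballI)
  fix x
  have [measurable]: "v \<in> borel_measurable borel"
    using v by auto
  show "isCont (prim v) x"
    unfolding continuous_at_sequentially o_def prim_def set_lebesgue_integral_def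
  proof (intro allI impI)
    fix X assume X: "X \<longlonglongrightarrow> x"
    show "(\<lambda>n. LINT s|lborel. indicator {..X n} s *\<^sub>R v s) \<longlonglongrightarrow> (LINT s|lborel. indicator {..x} s *\<^sub>R v s)"
    proof (rule integral_dominated_convergence[where w = "\<lambda>t. norm (v t)"])
      show "AE s in lborel. (\<lambda>n. indicator {..X n} s *\<^sub>R v s) \<longlonglongrightarrow> indicator {..x} s *\<^sub>R v s"
        using AE_lborel_singleton[of x]
      proof eventually_elim
        case (elim s)
        have "eventually (\<lambda>n. indicator {..X n} s *\<^sub>R v s = indicator {..x} s *\<^sub>R v s) sequentially"
        proof (cases "s < x")
          case True
          show ?thesis
            using order_tendstoD(1)[OF X True] by eventually_elim (use True in \<open>auto simp: indicator_def\<close>)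
        next
          case False
          with elim have "x < s" by simp
          from order_tendstoD(2)[OF X this] show ?thesis
            by eventually_elim (use \<open>x < s\<close> in \<open>auto simp: indicator_def\<close>)
        qed
        then show ?case by (rule tendsto_eventually)
      qed
    qed (use v in \<open>auto simp: indicator_def\<close>)
  qed
qed

lemma prim_eq_0:
  assumes "\<And>s. s \<notin> {a<..<b} \<Longrightarrow> v s = 0" "t \<le> a"
  shows "prim v t = 0"
proof -
  have "indicator {..t} s *\<^sub>R v s = 0" for s
    using assms by (auto simp: indicator_def)
  then show ?thesis by (simp only: prim_def set_lebesgue_integral_def) simp
qed

lemma integral_interval_scaleR:
  fixes v :: "'a::{real_normed_field, euclidean_space}"
  assumes deriv: "\<And>x. (\<phi> has_field_derivative \<phi>' x) (at x)" and cont: "continuous_on UNIV \<phi>'" and "s \<le> d"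
  shows "(LINT t|lborel. (indicator {s..d} t * \<phi>' t) *\<^sub>R v) = (\<phi> d - \<phi> s) *\<^sub>R v"
proof -
  have "has_bochner_integral lborel (\<lambda>t. \<phi>' t * indicator {s..d} t) (\<phi> d - \<phi> s)"
    using cont by (intro has_bochner_integral_FTC_Icc_real deriv \<open>s \<le> d\<close>) (auto simp: continuous_on_eq_continuous_at)
  then show ?thesis
    by (simp add: mult.commute has_bochner_integral_iff)
qed

text \<open>Since \<open>v\<close> is merely integrable, \<open>prim v\<close> has no pointwise
  derivative to work with. The formula is Fubini's theorem for \<phi>'(t) v(s) on the triangle c < s
  \<le> t < d; the constant part follows from the fundamental theorem for \<phi>.\<close>

lemma integration_by_parts_prim:
  fixes v :: "real \<Rightarrow> 'a::{real_normed_field, euclidean_space}"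
  assumes v: "integrable lborel v"
    and deriv: "\<And>x. (\<phi> has_field_derivative \<phi>' x) (at x)" and cont: "continuous_on UNIV \<phi>'"
    and "c \<le> d"
  shows "(LINT t:{c<..<d}|lborel. \<phi>' t *\<^sub>R (C + prim v t)) =
    \<phi> d *\<^sub>R (C + prim v d) - \<phi> c *\<^sub>R (C + prim v c) - (LINT t:{c<..<d}|lborel. \<phi> t *\<^sub>R v t)"
proof -
  have [measurable]: "v \<in> borel_measurable borel" using v by auto
  have [measurable]: "\<phi>' \<in> borel_measurable borel" by (rule borel_measurable_continuous_onI[OF cont])
  have cont\<phi>: "continuous_on UNIV \<phi>" by (rule DERIV_continuous_on[OF has_field_derivative_at_within[OF deriv]])
  have [measurable]: "\<phi> \<in> borel_measurable borel" by (rule borel_measurable_continuous_onI[OF cont\<phi>])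
  have "compact ((\<lambda>t. (\<phi> t, \<phi>' t)) ` {c..d})"
    using cont cont\<phi> by (intro compact_continuous_image continuous_intros) (auto intro: continuous_on_subset)
  then have "bounded ((\<lambda>t. (\<phi> t, \<phi>' t)) ` {c..d})" by (rule compact_imp_bounded)
  then obtain M where M: "\<And>t. t \<in> {c..d} \<Longrightarrow> norm (\<phi> t, \<phi>' t) \<le> M"
    unfolding bounded_iff by fast
  have M': "\<bar>\<phi>' t\<bar> \<le> M" "\<bar>\<phi> t\<bar> \<le> M" if "t \<in> {c..d}" for t
    using norm_snd_le[of "\<phi>' t" "\<phi> t"] norm_fst_le[of "\<phi> t" "\<phi>' t"] M[OF that] by auto
  define f where "f t s = (if c < t \<and> t < d \<and> c < s \<and> s \<le> t then \<phi>' t else 0) *\<^sub>R v s" for t s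
  have f_meas [measurable]: "(\<lambda>(t, s). f t s) \<in> borel_measurable (lborel \<Otimes>\<^sub>M lborel)"
    unfolding f_def by measurable
  have f_meas' [measurable]: "(\<lambda>s. f t s) \<in> borel_measurable lborel" for t
    unfolding f_def by measurable
  have f_bound: "norm (f t s) \<le> indicator {c..d} t * (M * norm (v s))" for t s
    using M'[of t] by (auto simp: f_def indicator_def intro!: mult_right_mono)
  have f_int1: "integrable lborel (\<lambda>s. f t s)" for t
    by (rule Bochner_Integration.integrable_bound[of _ "\<lambda>s. indicator {c..d} t * (M * norm (v s))"])
      (use v f_bound in \<open>auto intro!: AE_I2 order_trans[OF f_bound]\<close>)
  have "integrable (lborel \<Otimes>\<^sub>M lborel) (\<lambda>(t, s). f t s)"
  proof (rule lborel_pair.Fubini_integrable)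
    show "integrable lborel (\<lambda>t. LINT s|lborel. norm (case (t, s) of (t, s) \<Rightarrow> f t s))"
    proof (rule Bochner_Integration.integrable_bound)
      show "integrable lborel (\<lambda>t. indicator {c..d} t *\<^sub>R (M * (LINT s|lborel. norm (v s))))"
        by (intro integrable_real_indicator integrable_scaleR_left) (simp_all add: emeasure_lborel_Icc_eq)
      show "(\<lambda>t. LINT s|lborel. norm (case (t, s) of (t, s) \<Rightarrow> f t s)) \<in> borel_measurable lborel"
        by measurable
      show "AE t in lborel. norm (LINT s|lborel. norm (case (t, s) of (t, s) \<Rightarrow> f t s))
          \<le> norm (indicator {c..d} t *\<^sub>R (M * (LINT s|lborel. norm (v s))))"
      proof (rule AE_I2)
        fix t
        have "(LINT s|lborel. norm (f t s)) \<le> (LINT s|lborel. indicator {c..d} t * (M * norm (v s)))"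
          by (intro integral_mono integrable_norm f_int1 f_bound) (use v in auto)
        then show "norm (LINT s|lborel. norm (case (t, s) of (t, s) \<Rightarrow> f t s))
          \<le> norm (indicator {c..d} t *\<^sub>R (M * (LINT s|lborel. norm (v s))))"
          by simp
      qed
    qed
  qed (use f_int1 in auto)
  then have fubini: "(LINT s|lborel. LINT t|lborel. f t s) = (LINT t|lborel. LINT s|lborel. f t s)"
    by (rule lborel_pair.Fubini_integral)
  have inner_s: "(LINT s|lborel. f t s) = indicator {c<..<d} t *\<^sub>R \<phi>' t *\<^sub>R (prim v t - prim v c)" for t
  proof (cases "t \<in> {c<..<d}")
    case True
    then have "f t s = \<phi>' t *\<^sub>R (indicator {c<..t} s *\<^sub>R v s)" for s
      by (simp add: f_def)
    then have "(LINT s|lborel. f t s) = \<phi>' t *\<^sub>R (LINT s:{c<..t}|lborel. v s)"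
      by (simp only: set_lebesgue_integral_def integral_scaleR_right)
    with True show ?thesis
      by (simp add: prim_diff[OF v])
  next
    case False
    then have "f t s = 0" for s by (auto simp: f_def)
    with False show ?thesis by simp
  qed
  have inner_t: "(LINT t|lborel. f t s) = indicator {c<..<d} s *\<^sub>R (\<phi> d - \<phi> s) *\<^sub>R v s" for s
  proof (cases "s \<in> {c<..<d}")
    case True
    then have "(LINT t|lborel. (indicator {s..d} t * \<phi>' t) *\<^sub>R v s) = (\<phi> d - \<phi> s) *\<^sub>R v s"
      by (intro integral_interval_scaleR deriv cont) simp
    moreover have "(LINT t|lborel. f t s) = (LINT t|lborel. (indicator {s..d} t * \<phi>' t) *\<^sub>R v s)"
    proof (rule integral_cong_AE)
      show "AE t in lborel. f t s = (indicator {s..d} t * \<phi>' t) *\<^sub>R v s"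
        using AE_lborel_singleton[of d] by eventually_elim (use True in \<open>auto simp: f_def indicator_def\<close>)
    qed (unfold f_def, measurable)
    ultimately show ?thesis using True by simp
  next
    case False
    then have "f t s = 0" for t by (auto simp: f_def)
    with False show ?thesis by simp
  qed
  let ?I = "\<lambda>t. indicator {c<..<d} t"
  have int_v: "integrable lborel (\<lambda>t. ?I t *\<^sub>R v t)"
    by (intro integrable_mult_indicator v) simp
  have int_\<phi>v: "integrable lborel (\<lambda>t. ?I t *\<^sub>R \<phi> t *\<^sub>R v t)"
    by (rule Bochner_Integration.integrable_bound[of _ "\<lambda>t. M * norm (v t)"])
      (use v M'(2) in \<open>auto simp: indicator_def intro!: AE_I2 mult_right_mono order_trans[OF _ abs_ge_self]\<close>)
  have bd_int: "integrable lborel (\<lambda>t. ?I t *\<^sub>R h t)" if "continuous_on UNIV h" for h :: "real \<Rightarrow> 'a"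
  proof -
    have "integrable lborel (\<lambda>t. indicator {c..d} t *\<^sub>R h t)"
      by (rule borel_integrable_compact) (use that in \<open>auto intro: continuous_on_subset\<close>)
    then have "integrable lborel (\<lambda>t. ?I t *\<^sub>R indicator {c..d} t *\<^sub>R h t)"
      by (rule integrable_mult_indicator[rotated]) simp
    then show ?thesis
      by (rule Bochner_Integration.integrable_cong[THEN iffD1, rotated 2]) (auto simp: indicator_def)
  qed
  have int_prim: "integrable lborel (\<lambda>t. ?I t *\<^sub>R \<phi>' t *\<^sub>R (prim v t - prim v c))"
    by (intro bd_int continuous_intros cont prim_continuous v)
  have int_const: "integrable lborel (\<lambda>t. ?I t *\<^sub>R \<phi>' t *\<^sub>R (C + prim v c))"
    by (intro bd_int continuous_intros cont)
  have "(LINT s|lborel. ?I s *\<^sub>R v s) = (LINT s:{c<..d}|lborel. v s)"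
    unfolding set_lebesgue_integral_def
    by (rule integral_cong_AE; (measurable)?)
      (use AE_lborel_singleton[of d] in eventually_elim, auto simp: indicator_def)
  then have Iv: "(LINT s|lborel. ?I s *\<^sub>R v s) = prim v d - prim v c"
    by (simp add: prim_diff[OF v \<open>c \<le> d\<close>])
  have const: "(LINT t|lborel. ?I t *\<^sub>R \<phi>' t *\<^sub>R (C + prim v c)) = (\<phi> d - \<phi> c) *\<^sub>R (C + prim v c)"
  proof -
    have "(LINT t|lborel. ?I t *\<^sub>R \<phi>' t *\<^sub>R (C + prim v c)) =
        (LINT t|lborel. (indicator {c..d} t * \<phi>' t) *\<^sub>R (C + prim v c))"
    proof (rule integral_cong_AE)
      show "AE t in lborel. ?I t *\<^sub>R \<phi>' t *\<^sub>R (C + prim v c) = (indicator {c..d} t * \<phi>' t) *\<^sub>R (C + prim v c)"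
        using AE_lborel_singleton[of d] AE_lborel_singleton[of c]
        by eventually_elim (auto simp: indicator_def)
    qed measurable
    also have "\<dots> = (\<phi> d - \<phi> c) *\<^sub>R (C + prim v c)"
      by (intro integral_interval_scaleR deriv cont \<open>c \<le> d\<close>)
    finally show ?thesis .
  qed
  have "(LINT t|lborel. ?I t *\<^sub>R \<phi>' t *\<^sub>R (C + prim v t)) =
      (LINT t|lborel. ?I t *\<^sub>R \<phi>' t *\<^sub>R (prim v t - prim v c) + ?I t *\<^sub>R \<phi>' t *\<^sub>R (C + prim v c))"
    by (intro Bochner_Integration.integral_cong) (auto simp: algebra_simps)
  also have "\<dots> = (LINT s|lborel. ?I s *\<^sub>R (\<phi> d - \<phi> s) *\<^sub>R v s) + (\<phi> d - \<phi> c) *\<^sub>R (C + prim v c)"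
    unfolding Bochner_Integration.integral_add[OF int_prim int_const] const
    using fubini by (simp only: inner_s inner_t)
  also have "(LINT s|lborel. ?I s *\<^sub>R (\<phi> d - \<phi> s) *\<^sub>R v s) =
      (LINT s|lborel. \<phi> d *\<^sub>R (?I s *\<^sub>R v s) - ?I s *\<^sub>R \<phi> s *\<^sub>R v s)"
    by (intro Bochner_Integration.integral_cong) (auto simp: algebra_simps)
  also have "\<dots> = \<phi> d *\<^sub>R (prim v d - prim v c) - (LINT s|lborel. ?I s *\<^sub>R \<phi> s *\<^sub>R v s)"
    unfolding Bochner_Integration.integral_diff[OF integrable_scaleR_right[OF int_v] int_\<phi>v]
      integral_scaleR_right Iv ..
  finally show ?thesis
    by (simp add: set_lebesgue_integral_def algebra_simps)
qed

lemma test_function_add_mult: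
  assumes f: "test_function a b f" and g: "test_function a b g"
  shows "test_function a b (\<lambda>t. f t + c * g t)"
proof -
  have df: "\<forall>n x. (deriv ^^ n) f field_differentiable at x"
    and dg: "\<forall>n x. (deriv ^^ n) g field_differentiable at x"
    using f g by (auto simp: test_function_def)
  have eq: "(deriv ^^ n) (\<lambda>t. f t + c * g t) = (\<lambda>t. (deriv ^^ n) f t + c * (deriv ^^ n) g t)" for n
  proof (induction n)
    case (Suc n)
    have "deriv (\<lambda>t. (deriv ^^ n) f t + c * (deriv ^^ n) g t) x =
        deriv ((deriv ^^ n) f) x + c * deriv ((deriv ^^ n) g) x" for x
      using df dg by (simp add: field_differentiable_mult field_differentiable_const)
    then show ?case by (simp add: Suc fun_eq_iff)
  qed simp
  obtain K K' where "compact K" "K \<subseteq> {a<..<b}" "\<forall>x. x \<notin> K \<longrightarrow> f x = 0"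
    and "compact K'" "K' \<subseteq> {a<..<b}" "\<forall>x. x \<notin> K' \<longrightarrow> g x = 0"
    using f g unfolding test_function_def by blast
  then have "\<exists>K. compact K \<and> K \<subseteq> {a<..<b} \<and> (\<forall>x. x \<notin> K \<longrightarrow> f x + c * g x = 0)"
    by (intro exI[of _ "K \<union> K'"]) auto
  with df dg show ?thesis
    unfolding test_function_def eq
    by (auto intro!: field_differentiable_add field_differentiable_mult field_differentiable_const)
qed

lemma bump_integral_pos:
  assumes "c < d" shows "(LINT t|lborel. bump c d 1 t) > 0"
proof -
  have test: "test_function (c - 1) (d + 1) (bump c d 1)" by (rule test_function_bump) auto
  have "(LINT t|lborel. bump c d 1 t) \<noteq> 0"
  proof
    assume "(LINT t|lborel. bump c d 1 t) = 0"
    then have "AE t in lborel. bump c d 1 t = 0"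
      using integral_nonneg_eq_0_iff_AE[OF test_function_integrable[OF test]] bump_bounds by simp
    then have "AE t in lborel. t \<notin> {c<..<d}"
      by eventually_elim (use bump_pos[of 1 _ c d] in force)
    then have "{c<..<d} \<in> null_sets lborel"
      by (subst AE_iff_null_sets) auto
    then have "emeasure lborel {c<..<d} = 0"
      by (rule null_setsD1)
    with assms show False by simp
  qed
  moreover have "(LINT t|lborel. bump c d 1 t) \<ge> 0" using bump_bounds by simp
  ultimately show ?thesis by simp
qed

text \<open>\<open>u - prim v\<close> annihilates every derivative of a test function. Subtracting a
  multiple of one fixed bump gives any test function integral zero and so makes it a derivative;
  hence \<open>u - prim v\<close> acts on test functions as a constant does.\<close>

lemma du_bois_reymond:
  fixes u v :: "real \<Rightarrow> 'a::{real_normed_field, euclidean_space}"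
  assumes "a < b" and u: "integrable lborel u" and v: "integrable lborel v"
    and weak: "\<And>\<phi>. test_function a b \<phi> \<Longrightarrow>
      (LINT t|lborel. deriv \<phi> t *\<^sub>R u t) = - (LINT t|lborel. \<phi> t *\<^sub>R v t)"
  shows "\<exists>C. AE t in lborel. t \<in> {a<..<b} \<longrightarrow> u t = C + prim v t"
proof -
  let ?I = "\<lambda>t. indicator {a<..<b} t"
  define w where "w t = ?I t *\<^sub>R (u t - prim v t)" for t
  have int_prim: "integrable lborel (\<lambda>t. ?I t *\<^sub>R prim v t)"
  proof -
    have "integrable lborel (\<lambda>t. indicator {a..b} t *\<^sub>R prim v t)"
      by (rule borel_integrable_compact) (auto intro: prim_continuous v)
    then have "integrable lborel (\<lambda>t. ?I t *\<^sub>R indicator {a..b} t *\<^sub>R prim v t)"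
      by (rule integrable_mult_indicator[rotated]) simp
    then show ?thesis
      by (rule Bochner_Integration.integrable_cong[THEN iffD1, rotated 2]) (auto simp: indicator_def)
  qed
  have w: "integrable lborel w"
    unfolding w_def scaleR_diff_right
    by (intro Bochner_Integration.integrable_diff integrable_mult_indicator u int_prim) simp
  have int_test: "integrable lborel (\<lambda>t. \<phi> t *\<^sub>R h t)"
    if \<phi>: "test_function a b \<phi>" and h: "integrable lborel h" for \<phi> and h :: "real \<Rightarrow> 'a"
  proof -
    obtain C where C: "\<And>x. \<bar>\<phi> x\<bar> \<le> C" using test_function_bounded[OF \<phi>] by blast
    have [measurable]: "\<phi> \<in> borel_measurable borel" "h \<in> borel_measurable borel"
      using test_function_borel[OF \<phi>] h by auto
    show ?thesis
      by (rule Bochner_Integration.integrable_bound[of _ "\<lambda>t. C * norm (h t)"])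
       (use h C in \<open>auto intro!: AE_I2 mult_right_mono order_trans[OF _ abs_ge_self]\<close>)
  qed
  have orth_deriv: "(LINT t|lborel. deriv \<phi> t *\<^sub>R w t) = 0" if \<phi>: "test_function a b \<phi>" for \<phi>
  proof -
    note \<phi>' = test_function_deriv_test[OF \<phi>]
    have zero: "\<phi> a = 0" "\<phi> b = 0" using test_function_eq_0[OF \<phi>] by auto
    have "(LINT t:{a<..<b}|lborel. deriv \<phi> t *\<^sub>R (0 + prim v t)) = - (LINT t:{a<..<b}|lborel. \<phi> t *\<^sub>R v t)"
      using \<open>a < b\<close> by (subst integration_by_parts_prim[OF v test_function_deriv[OF \<phi>] test_function_continuous[OF \<phi>']])
        (simp_all add: zero)
    moreover have "(LINT t:{a<..<b}|lborel. \<phi> t *\<^sub>R v t) = (LINT t|lborel. \<phi> t *\<^sub>R v t)"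
      unfolding set_lebesgue_integral_def
      by (intro Bochner_Integration.integral_cong)
        (use test_function_eq_0[OF \<phi>] in \<open>force simp: indicator_def\<close>)+
    moreover have "(LINT t|lborel. deriv \<phi> t *\<^sub>R w t) =
       (LINT t|lborel. deriv \<phi> t *\<^sub>R u t - deriv \<phi> t *\<^sub>R (?I t *\<^sub>R prim v t))"
      by (intro Bochner_Integration.integral_cong)
        (use test_function_eq_0[OF \<phi>'] in \<open>force simp: indicator_def w_def algebra_simps\<close>)+
    moreover have "\<dots> = (LINT t|lborel. deriv \<phi> t *\<^sub>R u t) - (LINT t|lborel. deriv \<phi> t *\<^sub>R (?I t *\<^sub>R prim v t))"
      by (intro Bochner_Integration.integral_diff int_test \<phi>' u int_prim)
    ultimately show ?thesis
      using weak[OF \<phi>] by (simp add: set_lebesgue_integral_def mult.commute)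
  qed
  define c d where "c = (2 * a + b) / 3" and "d = (a + 2 * b) / 3"
  have cd: "a < c" "c < d" "d < b" using \<open>a < b\<close> by (auto simp: c_def d_def field_simps)
  define \<theta> where "\<theta> = bump c d 1"
  have \<theta>: "test_function a b \<theta>" unfolding \<theta>_def by (rule test_function_bump) (use cd in auto)
  define J where "J = (LINT t|lborel. \<theta> t)"
  have "J > 0" unfolding J_def \<theta>_def by (rule bump_integral_pos) (use cd in simp)
  \<comment> \<open>The constant is forced by testing with \<theta>: it is the mean of
    \<open>w\<close> with weight \<theta> / J.\<close>
  define C where "C = (1 / J) *\<^sub>R (LINT t|lborel. \<theta> t *\<^sub>R w t)"
  have orth: "(LINT t|lborel. \<phi> t *\<^sub>R (w t - ?I t *\<^sub>R C)) = 0" if \<phi>: "test_function a b \<phi>" for \<phi>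
  proof -
    define I where "I = (LINT t|lborel. \<phi> t)"
    have t: "test_function a b (\<lambda>t. \<phi> t - (I / J) * \<theta> t)"
      using test_function_add_mult[OF \<phi> \<theta>, of "- (I / J)"] by simp
    have "(LINT t|lborel. \<phi> t - (I / J) * \<theta> t) = 0"
      using test_function_integrable[OF \<phi>] test_function_integrable[OF \<theta>] \<open>J > 0\<close>
      by (simp add: I_def J_def)
    from test_function_antiderivative[OF t \<open>a < b\<close> this] orth_deriv
    have "0 = (LINT t|lborel. (\<phi> t - (I / J) * \<theta> t) *\<^sub>R w t)" by metis
    also have "\<dots> = (LINT t|lborel. \<phi> t *\<^sub>R w t - (I / J) *\<^sub>R (\<theta> t *\<^sub>R w t))"
      by (simp add: algebra_simps)
    also have "\<dots> = (LINT t|lborel. \<phi> t *\<^sub>R w t) - I *\<^sub>R C"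
      unfolding Bochner_Integration.integral_diff[OF int_test[OF \<phi> w] integrable_scaleR_right[OF int_test[OF \<theta> w]]]
        integral_scaleR_right C_def by simp
    also have "I *\<^sub>R C = (LINT t|lborel. \<phi> t *\<^sub>R ?I t *\<^sub>R C)"
    proof -
      have "(LINT t|lborel. \<phi> t *\<^sub>R ?I t *\<^sub>R C) = (LINT t|lborel. \<phi> t *\<^sub>R C)"
        by (intro Bochner_Integration.integral_cong)
          (use test_function_eq_0[OF \<phi>] in \<open>force simp: indicator_def\<close>)+
      also have "\<dots> = I *\<^sub>R C"
        using test_function_integrable[OF \<phi>] by (simp add: I_def)
      finally show ?thesis ..
    qed
    also have "(LINT t|lborel. \<phi> t *\<^sub>R w t) - (LINT t|lborel. \<phi> t *\<^sub>R ?I t *\<^sub>R C) =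
        (LINT t|lborel. \<phi> t *\<^sub>R (w t - ?I t *\<^sub>R C))"
      unfolding scaleR_diff_right
      by (intro Bochner_Integration.integral_diff[symmetric] int_test[OF \<phi>] w integrable_scaleR_left)
        (use \<open>a < b\<close> in \<open>simp add: integrable_indicator_iff\<close>)
    finally show ?thesis by simp
  qed
  have "integrable lborel (\<lambda>t. w t - ?I t *\<^sub>R C)"
    by (intro Bochner_Integration.integrable_diff w integrable_scaleR_left) (use \<open>a < b\<close> in \<open>simp add: integrable_indicator_iff\<close>)
  from fundamental_lemma[OF this orth]
  have "AE t in lborel. t \<in> {a<..<b} \<longrightarrow> u t = C + prim v t"
    by (rule eventually_mono) (auto simp: w_def algebra_simps)
  then show ?thesis by blast
qed

section \<open>Pairing square integrable functions with continuous functions\<close>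

lemma ae_eq_refl: "f \<in> borel_measurable borel \<Longrightarrow> ae_eq f f"
  by (simp add: ae_eq_def)

lemma ae_class_eq_iff:
  "f \<in> borel_measurable borel \<Longrightarrow> g \<in> borel_measurable borel \<Longrightarrow>
    ae_class f = ae_class g \<longleftrightarrow> (AE x in lborel. f x = g x)"
  using Quotient_rel[OF Quotient_ae_fun, of f g] by (simp add: ae_eq_def)

lemmas ae_class_abs_eq = zero_ae_fun.abs_eq
  plus_ae_fun.abs_eq[OF ae_eq_refl ae_eq_refl] minus_ae_fun.abs_eq[OF ae_eq_refl ae_eq_refl]
  uminus_ae_fun.abs_eq[OF ae_eq_refl] ae_smult.abs_eq[OF ae_eq_refl]
  translate.abs_eq[OF ae_eq_refl] restr.abs_eq[OF ae_eq_refl]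

text \<open>The representative vanishes at every point outside the interval, not just almost
  everywhere, so that supports can be handled pointwise.\<close>

definition L2_rep :: "real \<Rightarrow> real \<Rightarrow> (real \<Rightarrow> 'a) \<Rightarrow> 'a::{real_normed_field, euclidean_space} ae_fun \<Rightarrow> bool" where
  "L2_rep a b f u \<longleftrightarrow> f \<in> borel_measurable borel \<and> (\<forall>t. t \<notin> {a<..<b} \<longrightarrow> f t = 0) \<and>
     integrable lborel (\<lambda>t. (norm (f t))\<^sup>2) \<and> u = ae_class f"

lemma L2_rep_ex: "u \<in> L2 a b \<longleftrightarrow> (\<exists>f. L2_rep a b f u)"
proof
  assume u: "u \<in> L2 a b"
  obtain f where f[measurable]: "f \<in> borel_measurable borel" and uf: "u = ae_class f"
    using ae_fun.abs_induct[of "\<lambda>u. \<exists>f. f \<in> borel_measurable borel \<and> u = ae_class f" u]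
    by (auto simp: ae_eq_def)
  define g where "g t = (if t \<in> {a<..<b} then f t else 0)" for t
  have [measurable]: "g \<in> borel_measurable borel" unfolding g_def by measurable
  have "integrable lborel (\<lambda>t. (norm (f t))\<^sup>2)"
    using u uf by (simp add: L2_def square_integrable.abs_eq[OF ae_eq_refl])
  then have "integrable lborel (\<lambda>t. (norm (g t))\<^sup>2)"
    by (rule Bochner_Integration.integrable_bound) (auto simp: g_def)
  moreover have "u = ae_class g"
    using u uf unfolding g_def by (simp add: L2_def ae_class_abs_eq)
  ultimately show "\<exists>f. L2_rep a b f u"
    by (intro exI[of _ g]) (simp add: L2_rep_def, simp add: g_def)
next
  assume "\<exists>f. L2_rep a b f u"
  then obtain f where f: "f \<in> borel_measurable borel" "\<And>t. t \<notin> {a<..<b} \<Longrightarrow> f t = 0"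
    "integrable lborel (\<lambda>t. (norm (f t))\<^sup>2)" "u = ae_class f"
    by (auto simp: L2_rep_def)
  then have "(\<lambda>t. if t \<in> {a<..<b} then f t else 0) = f"
    by (auto simp: fun_eq_iff)
  with f show "u \<in> L2 a b"
    by (simp add: L2_def square_integrable.abs_eq ae_eq_refl ae_class_abs_eq)
qed

lemma L2_repD:
  assumes "L2_rep a b f u"
  shows "f \<in> borel_measurable borel" "f \<in> borel_measurable lborel" "\<And>t. t \<notin> {a<..<b} \<Longrightarrow> f t = 0"
    "integrable lborel (\<lambda>t. (norm (f t))\<^sup>2)" "u = ae_class f"
  using assms by (auto simp: L2_rep_def)

lemma L2_obtain:
  assumes "u \<in> L2 a b" obtains f where "L2_rep a b f u"
  using assms L2_rep_ex by blast

text \<open>On a bounded interval the bound x \<le> 1 + x^2 for x = norm (f t) puts L_2 inside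
  L_1.\<close>

lemma L2_rep_integrable:
  assumes f: "L2_rep a b f u"
  shows "integrable lborel f"
proof (rule Bochner_Integration.integrable_bound)
  show "integrable lborel (\<lambda>t. indicator {a..b} t + (norm (f t))\<^sup>2)"
    by (intro Bochner_Integration.integrable_add L2_repD(4)[OF f]) (simp add: emeasure_lborel_Icc_eq)
  have "norm (f t) \<le> indicator {a..b} t + (norm (f t))\<^sup>2" for t
  proof (cases "t \<in> {a<..<b}")
    case True
    have "norm (f t) \<le> 1 + (norm (f t))\<^sup>2"
      using zero_le_power2[of "norm (f t) - 1 / 2"] by (simp add: power2_diff power_divide)
    with True show ?thesis by simp
  qed (use L2_repD(3)[OF f] in auto)
  then show "AE t in lborel. norm (f t) \<le> norm (indicator {a..b} t + (norm (f t))\<^sup>2)"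
    by (intro AE_I2) (simp add: abs_of_nonneg)
qed (rule L2_repD[OF f])

lemma L2_rep_add:
  assumes f: "L2_rep a b f u" and g: "L2_rep a b g v"
  shows "L2_rep a b (\<lambda>t. f t + g t) (u + v)"
proof -
  note [measurable] = L2_repD(1)[OF f] L2_repD(1)[OF g]
  have "integrable lborel (\<lambda>t. (norm (f t + g t))\<^sup>2)"
  proof (rule Bochner_Integration.integrable_bound)
    show "integrable lborel (\<lambda>t. 2 * (norm (f t))\<^sup>2 + 2 * (norm (g t))\<^sup>2)"
      using L2_repD(4)[OF f] L2_repD(4)[OF g] by simp
    have "(norm (f t + g t))\<^sup>2 \<le> 2 * (norm (f t))\<^sup>2 + 2 * (norm (g t))\<^sup>2" for t
    proof -
      have "(norm (f t + g t))\<^sup>2 \<le> (norm (f t) + norm (g t))\<^sup>2"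
        by (intro power_mono norm_triangle_ineq) simp
      also have "\<dots> \<le> 2 * (norm (f t))\<^sup>2 + 2 * (norm (g t))\<^sup>2"
        using sum_squares_bound[of "norm (f t)" "norm (g t)"] by (simp add: power2_sum)
      finally show ?thesis .
    qed
    then show "AE t in lborel. norm ((norm (f t + g t))\<^sup>2) \<le> norm (2 * (norm (f t))\<^sup>2 + 2 * (norm (g t))\<^sup>2)"
      by (intro AE_I2) simp
  qed measurable
  with f g show ?thesis
    by (auto simp: L2_rep_def ae_class_abs_eq)
qed

lemma L2_rep_smult:
  assumes f: "L2_rep a b f u"
  shows "L2_rep a b (\<lambda>t. c * f t) (ae_smult c u)"
  using f by (auto simp: L2_rep_def ae_class_abs_eq norm_mult power_mult_distrib)

lemma L2_rep_zero: "L2_rep a b (\<lambda>_. 0) 0"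
  by (auto simp: L2_rep_def ae_class_abs_eq)

lemma ae_smult_minus_one: "ae_smult (- 1) u = - u"
  using ae.scale_minus_left[of 1 u] by simp

lemma L2_subspace: "ae.subspace (L2 a b)"
  unfolding ae.subspace_def by (metis L2_rep_ex L2_rep_add L2_rep_smult L2_rep_zero)

lemmas L2_zero = ae.subspace_0[OF L2_subspace]
  and L2_add = ae.subspace_add[OF L2_subspace]
  and L2_smult = ae.subspace_scale[OF L2_subspace]
  and L2_neg = ae.subspace_neg[OF L2_subspace]
  and L2_diff = ae.subspace_diff[OF L2_subspace]
  and L2_sum = ae.subspace_sum[OF L2_subspace]

lemma L2_rep_restr:
  assumes f: "L2_rep a b f u"
  shows "L2_rep a b (\<lambda>t. if t \<in> {c<..<d} then f t else 0) (restr c d u)"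
proof -
  note [measurable] = L2_repD(1)[OF f]
  have "integrable lborel (\<lambda>t. (norm (if t \<in> {c<..<d} then f t else 0))\<^sup>2)"
    by (rule Bochner_Integration.integrable_bound[OF L2_repD(4)[OF f]]) auto
  with f show ?thesis
    by (auto simp: L2_rep_def ae_class_abs_eq)
qed

lemma restr_L2: "u \<in> L2 a b \<Longrightarrow> restr c d u \<in> L2 a b"
  using L2_rep_restr L2_rep_ex by blast

lemma L2_rep_translate:
  assumes f: "L2_rep a b f u"
  shows "L2_rep (a - s) (b - s) (\<lambda>t. f (t + s)) (translate s u)"
proof -
  note [measurable] = L2_repD(1)[OF f]
  have "integrable lborel (\<lambda>t. (norm (f (s + 1 * t)))\<^sup>2)"
    by (rule lborel_integrable_real_affine[OF L2_repD(4)[OF f]]) simp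
  with f show ?thesis
    by (auto simp: L2_rep_def ae_class_abs_eq add.commute)
qed

text \<open>The action of a class as a distribution, extended from test functions to functions
  \<phi> that do not vanish at the ends, so that boundary terms stay visible. The value 0 for
  non-Borel \<phi> lets the lift respect almost everywhere equality.\<close>

lift_definition pairing :: "(real \<Rightarrow> real) \<Rightarrow> 'a::{real_normed_field, euclidean_space} ae_fun \<Rightarrow> 'a"
  is "\<lambda>\<phi> f. if \<phi> \<in> borel_measurable borel then LINT t|lborel. \<phi> t *\<^sub>R f t else 0"
  by (auto simp: ae_eq_def intro!: integral_cong_AE elim: eventually_mono)

lemma pairing_rep:
  assumes "L2_rep a b f u" "continuous_on UNIV \<phi>"
  shows "pairing \<phi> u = (LINT t|lborel. \<phi> t *\<^sub>R f t)"
  using L2_repD(1)[OF assms(1)] borel_measurable_continuous_onI[OF assms(2)]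
  by (simp add: L2_repD(5)[OF assms(1)] pairing.abs_eq[OF ae_eq_refl])

lemma bounded_near_interval:
  fixes \<phi> :: "real \<Rightarrow> real"
  assumes "continuous_on UNIV \<phi>"
  obtains C where "C \<ge> 0" "\<And>t. t \<in> {a<..<b} \<Longrightarrow> \<bar>\<phi> t\<bar> \<le> C"
proof -
  have "bounded (\<phi> ` {a..b})"
    by (intro compact_imp_bounded compact_continuous_image continuous_on_subset[OF assms]) auto
  then obtain C where "\<forall>t\<in>{a..b}. \<bar>\<phi> t\<bar> \<le> C" by (auto simp: bounded_real)
  then have "\<bar>\<phi> t\<bar> \<le> max C 0" if "t \<in> {a<..<b}" for t
    using that by (metis atLeastAtMost_iff greaterThanLessThan_iff less_imp_le max.coboundedI1)
  then show ?thesis by (intro that[of "max C 0"]) auto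
qed

lemma pairing_integrable:
  assumes f: "L2_rep a b f u" and cont: "continuous_on UNIV \<phi>"
  shows "integrable lborel (\<lambda>t. \<phi> t *\<^sub>R f t)"
proof -
  obtain C where C: "C \<ge> 0" "\<And>t. t \<in> {a<..<b} \<Longrightarrow> \<bar>\<phi> t\<bar> \<le> C"
    using bounded_near_interval[OF cont] by blast
  note [measurable] = L2_repD(1)[OF f] borel_measurable_continuous_onI[OF cont]
  have "\<bar>\<phi> t\<bar> * norm (f t) \<le> C * norm (f t)" for t
    using C L2_repD(3)[OF f, of t] by (cases "t \<in> {a<..<b}") (auto intro: mult_right_mono)
  then have bound: "AE t in lborel. norm (\<phi> t *\<^sub>R f t) \<le> norm (C * norm (f t))"
    using \<open>C \<ge> 0\<close> by (intro AE_I2) simp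
  show ?thesis
    by (rule Bochner_Integration.integrable_bound[OF _ _ bound])
      (simp_all add: L2_rep_integrable[OF f])
qed

lemma pairing_add:
  assumes "continuous_on UNIV \<phi>" "u \<in> L2 a b" "v \<in> L2 a b"
  shows "pairing \<phi> (u + v) = pairing \<phi> u + pairing \<phi> v"
proof -
  obtain f g where fg: "L2_rep a b f u" "L2_rep a b g v" using assms L2_obtain by metis
  show ?thesis
    using assms(1) by (simp add: pairing_rep[OF L2_rep_add[OF fg]] pairing_rep[OF fg(1)] pairing_rep[OF fg(2)]
        scaleR_add_right pairing_integrable[OF fg(1)] pairing_integrable[OF fg(2)])
qed

lemma pairing_smult:
  assumes "continuous_on UNIV \<phi>" "u \<in> L2 a b"
  shows "pairing \<phi> (ae_smult c u) = c * pairing \<phi> u"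
proof -
  obtain f where f: "L2_rep a b f u" using assms L2_obtain by metis
  have "(\<lambda>t. \<phi> t *\<^sub>R (c * f t)) = (\<lambda>t. c * (\<phi> t *\<^sub>R f t))" by simp
  then show ?thesis
    using assms(1) by (simp only: pairing_rep[OF L2_rep_smult[OF f]] pairing_rep[OF f] integral_mult_right_zero)
qed

lemma pairing_zero: "continuous_on UNIV \<phi> \<Longrightarrow> pairing \<phi> 0 = 0"
  by (simp add: pairing_rep[OF L2_rep_zero])

lemma pairing_minus:
  "continuous_on UNIV \<phi> \<Longrightarrow> u \<in> L2 a b \<Longrightarrow> pairing \<phi> (- u) = - pairing \<phi> u"
  using pairing_smult[of \<phi> u a b "- 1"] by (simp add: ae_smult_minus_one)

lemma pairing_diff:
  "continuous_on UNIV \<phi> \<Longrightarrow> u \<in> L2 a b \<Longrightarrow> v \<in> L2 a b \<Longrightarrow> pairing \<phi> (u - v) = pairing \<phi> u - pairing \<phi> v"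
  using pairing_add[of \<phi> u a b "- v"] by (simp add: pairing_minus L2_neg)

lemma pairing_sum:
  assumes "continuous_on UNIV \<phi>" "\<And>i. i \<in> I \<Longrightarrow> u i \<in> L2 a b"
  shows "pairing \<phi> (sum u I) = (\<Sum>i\<in>I. pairing \<phi> (u i))"
  using assms(2)
proof (induction I rule: infinite_finite_induct)
  case (insert i I)
  then show ?case by (simp add: pairing_add[OF assms(1), of _ a b] L2_sum)
qed (simp_all add: pairing_zero assms(1))

lemma pairing_translate:
  assumes "continuous_on UNIV \<phi>" "u \<in> L2 a b"
  shows "pairing \<phi> (translate s u) = pairing (\<lambda>t. \<phi> (t - s)) u"
proof -
  obtain f where f: "L2_rep a b f u" using assms L2_obtain by metis
  have "continuous_on UNIV (\<lambda>t. \<phi> (t - s))"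
    by (rule continuous_on_compose2[OF assms(1)]) (auto intro!: continuous_intros)
  then show ?thesis
    using lborel_integral_real_affine[of 1 "\<lambda>t. \<phi> (t - s) *\<^sub>R f t" s]
    by (simp add: pairing_rep[OF L2_rep_translate[OF f] assms(1)] pairing_rep[OF f] add.commute)
qed

lemma translate_restr: "restr c d (translate s u) = translate s (restr (c + s) (d + s) u)"
  by transfer (auto simp: ae_eq_def intro!: measurable_If)

lemma restr_restr: "restr c d (restr c' d' u) = restr (max c c') (min d d') u"
  by transfer (auto simp: ae_eq_def)

lemma L2_restr_eq: "u \<in> L2 a b \<Longrightarrow> restr a b u = u"
  by (simp add: L2_def)

section \<open>The norm of L_2 and continuity of the pairing\<close>

lemma L2_norm_rep:
  assumes f: "L2_rep a b f u"
  shows "(L2_norm u)\<^sup>2 = (LINT t|lborel. (norm (f t))\<^sup>2)"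
  by (simp add: L2_repD(5)[OF f] L2_norm.abs_eq[OF ae_eq_refl[OF L2_repD(1)[OF f]]])

lemma L2_norm_nonneg: "L2_norm u \<ge> 0"
  by transfer simp

lemma L2_norm_zero: "L2_norm 0 = 0"
  by transfer simp

lemma L2_norm_eq_0:
  assumes u: "u \<in> L2 a b" and z: "L2_norm u = 0"
  shows "u = 0"
proof -
  obtain f where f: "L2_rep a b f u" using u L2_obtain by blast
  have "AE t in lborel. (norm (f t))\<^sup>2 = 0"
    using L2_norm_rep[OF f] z integral_nonneg_eq_0_iff_AE[OF L2_repD(4)[OF f]] by simp
  then show ?thesis
    using L2_repD(1,5)[OF f] by (simp add: zero_ae_fun.abs_eq ae_class_eq_iff)
qed

lemma L2_norm_smult: 
  assumes u: "u \<in> L2 a b"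
  shows "L2_norm (ae_smult c u) = norm c * L2_norm u"
proof -
  obtain f where f: "L2_rep a b f u" using u L2_obtain by blast
  have "(L2_norm (ae_smult c u))\<^sup>2 = (norm c * L2_norm u)\<^sup>2"
    by (simp add: L2_norm_rep[OF L2_rep_smult[OF f]] L2_norm_rep[OF f] norm_mult power_mult_distrib)
  then show ?thesis
    by (simp add: L2_norm_nonneg power2_eq_iff_nonneg)
qed

text \<open>Minkowski's inequality, from \<open>(x + y)\<^sup>2 \<le> (1 + \<epsilon>) x\<^sup>2 + (1 + 1 / \<epsilon>) y\<^sup>2\<close> with \<open>\<epsilon>\<close> the ratio of the norms.\<close>
lemma L2_norm_triangle:
  assumes u: "u \<in> L2 a b" and v: "v \<in> L2 a b"
  shows "L2_norm (u + v) \<le> L2_norm u + L2_norm v"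
proof (cases "L2_norm u = 0 \<or> L2_norm v = 0")
  case True
  then show ?thesis using L2_norm_eq_0[OF u] L2_norm_eq_0[OF v] by (auto simp: L2_norm_zero)
next
  case False
  define \<alpha> \<beta> where "\<alpha> = L2_norm u" and "\<beta> = L2_norm v"
  have pos: "\<alpha> > 0" "\<beta> > 0" using False L2_norm_nonneg by (auto simp: \<alpha>_def \<beta>_def less_le)
  obtain f g where f: "L2_rep a b f u" and g: "L2_rep a b g v" using u v L2_obtain by metis
  have pt: "(norm (f t + g t))\<^sup>2 \<le> (1 + \<beta> / \<alpha>) * (norm (f t))\<^sup>2 + (1 + \<alpha> / \<beta>) * (norm (g t))\<^sup>2" for t
  proof -
    have "(norm (f t + g t))\<^sup>2 \<le> (norm (f t) + norm (g t))\<^sup>2"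
      by (intro power_mono norm_triangle_ineq) simp
    also have "\<dots> \<le> (1 + \<beta> / \<alpha>) * (norm (f t))\<^sup>2 + (1 + \<alpha> / \<beta>) * (norm (g t))\<^sup>2"
    proof -
      have "0 \<le> (\<beta> * norm (f t) - \<alpha> * norm (g t))\<^sup>2 / (\<alpha> * \<beta>)" using pos by simp
      also have "\<dots> = (1 + \<beta> / \<alpha>) * (norm (f t))\<^sup>2 + (1 + \<alpha> / \<beta>) * (norm (g t))\<^sup>2 - (norm (f t) + norm (g t))\<^sup>2"
        using pos by (simp add: field_simps power2_eq_square)
      finally show ?thesis by simp
    qed
    finally show ?thesis .
  qed
  note int = L2_repD(4)[OF f] L2_repD(4)[OF g]
  have "(L2_norm (u + v))\<^sup>2 \<le> (LINT t|lborel. (1 + \<beta> / \<alpha>) * (norm (f t))\<^sup>2 + (1 + \<alpha> / \<beta>) * (norm (g t))\<^sup>2)"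
    unfolding L2_norm_rep[OF L2_rep_add[OF f g]]
    by (intro integral_mono L2_repD(4)[OF L2_rep_add[OF f g]] pt) (use int in simp)
  also have "\<dots> = (1 + \<beta> / \<alpha>) * \<alpha>\<^sup>2 + (1 + \<alpha> / \<beta>) * \<beta>\<^sup>2"
    using int by (simp add: \<alpha>_def \<beta>_def L2_norm_rep[OF f] L2_norm_rep[OF g])
  also have "\<dots> = (\<alpha> + \<beta>)\<^sup>2"
    using pos by (simp add: field_simps power2_eq_square)
  finally show ?thesis
    using pos by (simp add: power2_le_iff_abs_le \<alpha>_def \<beta>_def L2_norm_nonneg)
qed

lemma L2_norm_minus: "u \<in> L2 a b \<Longrightarrow> L2_norm (- u) = L2_norm u"
  using L2_norm_smult[of u a b "- 1"] by (simp add: ae_smult_minus_one)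

lemma L2_norm_sum:
  assumes "finite I" "\<And>i. i \<in> I \<Longrightarrow> u i \<in> L2 a b"
  shows "L2_norm (sum u I) \<le> (\<Sum>i\<in>I. L2_norm (u i))"
  using assms
proof (induction I rule: finite_induct)
  case (insert i I)
  then have "L2_norm (u i + sum u I) \<le> L2_norm (u i) + L2_norm (sum u I)"
    by (intro L2_norm_triangle[of _ a b]) (auto intro: L2_sum)
  with insert show ?case by simp
qed (simp add: L2_norm_zero)

lemma L2_norm_restr: 
  assumes u: "u \<in> L2 a b" shows "L2_norm (restr c d u) \<le> L2_norm u"
proof -
  obtain f where f: "L2_rep a b f u" using u L2_obtain by blast
  have "(L2_norm (restr c d u))\<^sup>2 \<le> (L2_norm u)\<^sup>2"
    unfolding L2_norm_rep[OF f] L2_norm_rep[OF L2_rep_restr[OF f]]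
    by (intro integral_mono L2_repD(4)[OF f] L2_repD(4)[OF L2_rep_restr[OF f]]) auto
  then show ?thesis
    using L2_norm_nonneg power2_le_imp_le by blast
qed

lemma L2_norm_translate: 
  assumes u: "u \<in> L2 a b" shows "L2_norm (translate s u) = L2_norm u"
proof -
  obtain f where f: "L2_rep a b f u" using u L2_obtain by blast
  have "(L2_norm (translate s u))\<^sup>2 = (L2_norm u)\<^sup>2"
    unfolding L2_norm_rep[OF f] L2_norm_rep[OF L2_rep_translate[OF f]]
    using lborel_integral_real_affine[of 1 "\<lambda>t. (norm (f t))\<^sup>2" s] by (simp add: add.commute)
  then show ?thesis
    by (simp add: L2_norm_nonneg power2_eq_iff_nonneg)
qed

text \<open>A bound of Cauchy-Schwarz type from 2 \<alpha> x \<le> \<alpha>^2 + x^2 with \<alpha>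
  the norm of \<open>u\<close>. The constant M (m + 1) / 2 is not sharp; what matters is that it is
  the same for all \<open>u\<close>.\<close>

lemma pairing_bound:
  assumes cont: "continuous_on UNIV \<phi>"
  obtains C where "\<And>u. u \<in> L2 a b \<Longrightarrow> norm (pairing \<phi> u) \<le> C * L2_norm u"
proof -
  obtain M where M: "M \<ge> 0" "\<And>t. t \<in> {a<..<b} \<Longrightarrow> \<bar>\<phi> t\<bar> \<le> M"
    using bounded_near_interval[OF cont] by blast
  define m where "m = measure lborel {a..b}"
  have "norm (pairing \<phi> u) \<le> (M * (m + 1) / 2) * L2_norm u" if u: "u \<in> L2 a b" for u :: "'a ae_fun"
  proof (cases "L2_norm u = 0")
    case True
    then show ?thesis using L2_norm_eq_0[OF u] by (simp add: pairing_zero[OF cont])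
  next
    case False
    define \<alpha> where "\<alpha> = L2_norm u"
    have pos: "\<alpha> > 0" using False L2_norm_nonneg by (auto simp: \<alpha>_def less_le)
    obtain f where f: "L2_rep a b f u" using u L2_obtain by blast
    have pt: "norm (\<phi> t *\<^sub>R f t) \<le> M / 2 * (\<alpha> * indicator {a..b} t + (norm (f t))\<^sup>2 / \<alpha>)" for t
    proof (cases "t \<in> {a<..<b}")
      case True
      have "0 \<le> (\<alpha> - norm (f t))\<^sup>2 / \<alpha>" using pos by simp
      also have "\<dots> = \<alpha> + (norm (f t))\<^sup>2 / \<alpha> - 2 * norm (f t)"
        using pos by (simp add: field_simps power2_eq_square)
      finally have "norm (f t) \<le> (\<alpha> + (norm (f t))\<^sup>2 / \<alpha>) / 2" by simp
      then have "\<bar>\<phi> t\<bar> * norm (f t) \<le> M * ((\<alpha> + (norm (f t))\<^sup>2 / \<alpha>) / 2)"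
        using M True by (intro mult_mono) auto
      then show ?thesis using True by simp
    next
      case False
      then show ?thesis
        using L2_repD(3)[OF f] M pos by simp
    qed
    have int_ind: "integrable lborel (indicator {a..b} :: real \<Rightarrow> real)" 
      by (simp add: emeasure_lborel_Icc_eq)
    have "norm (pairing \<phi> u) \<le> (LINT t|lborel. norm (\<phi> t *\<^sub>R f t))"
      unfolding pairing_rep[OF f cont] by (rule integral_norm_bound)
    also have "\<dots> \<le> (LINT t|lborel. M / 2 * (\<alpha> * indicator {a..b} t + (norm (f t))\<^sup>2 / \<alpha>))"
      by (intro integral_mono pt integrable_norm pairing_integrable[OF f cont])
        (use int_ind L2_repD(4)[OF f] in simp)
    also have "\<dots> = M / 2 * (\<alpha> * m + \<alpha>\<^sup>2 / \<alpha>)"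
      using int_ind L2_repD(4)[OF f] L2_norm_rep[OF f] by (simp add: \<alpha>_def m_def)
    also have "\<dots> = (M * (m + 1) / 2) * \<alpha>"
      using pos by (simp add: field_simps power2_eq_square)
    finally show ?thesis by (simp add: \<alpha>_def)
  qed
  then show ?thesis by (rule that)
qed

lemma pairing_tendsto:
  assumes "continuous_on UNIV \<phi>" "\<And>n. U n \<in> L2 a b" "u \<in> L2 a b" "(\<lambda>n. L2_norm (U n - u)) \<longlonglongrightarrow> 0"
  shows "(\<lambda>n. pairing \<phi> (U n)) \<longlonglongrightarrow> pairing \<phi> u"
proof -
  obtain C where C: "\<And>u::'a ae_fun. u \<in> L2 a b \<Longrightarrow> norm (pairing \<phi> u) \<le> C * L2_norm u"
    using pairing_bound[OF assms(1)] by blast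
  have "(\<lambda>n. C * L2_norm (U n - u)) \<longlonglongrightarrow> 0"
    using tendsto_mult_right_zero[OF assms(4)] by simp
  then have "(\<lambda>n. pairing \<phi> (U n - u)) \<longlonglongrightarrow> 0"
    by (rule tendsto_0_le[of _ _ _ 1]) 
      (use C[OF L2_diff[OF assms(2,3)]] in \<open>auto intro!: always_eventually order_trans[OF _ abs_ge_self]\<close>)
  then have "(\<lambda>n. pairing \<phi> (U n) - pairing \<phi> u) \<longlonglongrightarrow> 0"
    by (simp add: pairing_diff[OF assms(1) assms(2) assms(3)])
  then show ?thesis by (simp add: LIM_zero_iff)
qed

lemma pairing_separates:
  assumes u: "u \<in> L2 a b" and z: "\<And>\<phi>. test_function a b \<phi> \<Longrightarrow> pairing \<phi> u = 0"
  shows "u = 0"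
proof -
  obtain f where f: "L2_rep a b f u" using u L2_obtain by blast
  have "AE t in lborel. t \<in> {a<..<b} \<longrightarrow> f t = 0"
    by (rule fundamental_lemma[OF L2_rep_integrable[OF f]])
      (use z pairing_rep[OF f test_function_continuous] in simp)
  then have "AE t in lborel. f t = 0"
    by eventually_elim (use L2_repD(3)[OF f] in auto)
  then show ?thesis
    using L2_repD(1,5)[OF f] by (simp add: zero_ae_fun.abs_eq ae_class_eq_iff)
qed

section \<open>Weak derivatives and traces\<close>

lemma has_weak_deriv_iff:
  assumes u: "u \<in> L2 a b" and v: "v \<in> L2 a b"
  shows "has_weak_deriv a b j u v \<longleftrightarrow>
    (\<forall>\<phi>. test_function a b \<phi> \<longrightarrow> pairing ((deriv ^^ j) \<phi>) u = (- 1) ^ j * pairing \<phi> v)"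
proof -
  obtain f g where f: "L2_rep a b f u" and g: "L2_rep a b g v" using u v L2_obtain by metis
  have "pairing ((deriv ^^ j) \<phi>) u = (LINT t|lborel. (deriv ^^ j) \<phi> t *\<^sub>R f t)"
    "pairing \<phi> v = (LINT t|lborel. \<phi> t *\<^sub>R g t)" if "test_function a b \<phi>" for \<phi>
    using L2_repD(1)[OF f] L2_repD(1)[OF g] test_function_measurable[OF that, of j] test_function_borel[OF that]
    by (simp_all add: L2_repD(5)[OF f] L2_repD(5)[OF g] pairing.abs_eq[OF ae_eq_refl])
  then show ?thesis
    using L2_repD(1)[OF f] L2_repD(1)[OF g]
    by (simp add: L2_repD(5)[OF f] L2_repD(5)[OF g] has_weak_deriv.abs_eq[OF ae_eq_refl ae_eq_refl])
qed

lemma test_function_continuous_derivs: "test_function a b \<phi> \<Longrightarrow> continuous_on S ((deriv ^^ j) \<phi>)"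
  unfolding test_function_def
  by (intro continuous_at_imp_continuous_on ballI field_differentiable_imp_continuous_at) blast

lemma has_weak_deriv_pairing:
  "has_weak_deriv a b j u v \<Longrightarrow> has_weak_deriv a b j u w \<Longrightarrow> test_function a b \<phi> \<Longrightarrow> pairing \<phi> v = pairing \<phi> w"
  by transfer (auto simp: test_function_borel)

lemma has_weak_deriv_unique:
  assumes "v \<in> L2 a b" "w \<in> L2 a b" "has_weak_deriv a b j u v" "has_weak_deriv a b j u w"
  shows "v = w"
proof -
  have "pairing \<phi> (v - w) = 0" if "test_function a b \<phi>" for \<phi>
    using has_weak_deriv_pairing[OF assms(3,4) that] pairing_diff[OF test_function_continuous[OF that] assms(1,2)] by simp
  then have "v - w = 0"
    by (rule pairing_separates[OF L2_diff[OF assms(1,2)]])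
  then show ?thesis by simp
qed

lemma weak_deriv_eqI:
  assumes "u \<in> L2 a b" "v \<in> L2 a b" "has_weak_deriv a b j u v"
  shows "weak_deriv a b j u = v"
  unfolding weak_deriv_def using assms has_weak_deriv_unique by (intro the_equality) blast+

text \<open>Each side of the defining identity is a pairing with a fixed continuous function, hence
  continuous in L_2. Closedness of graph and range both go back to this.\<close>

lemma has_weak_deriv_tendsto:
  assumes U: "\<And>n. U n \<in> L2 a b" "u \<in> L2 a b" "(\<lambda>n. L2_norm (U n - u)) \<longlonglongrightarrow> 0"
    and V: "\<And>n. V n \<in> L2 a b" "v \<in> L2 a b" "(\<lambda>n. L2_norm (V n - v)) \<longlonglongrightarrow> 0"
    and wd: "\<And>n. has_weak_deriv a b j (U n) (V n)"
  shows "has_weak_deriv a b j u v"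
  unfolding has_weak_deriv_iff[OF U(2) V(2)]
proof (intro allI impI)
  fix \<phi> assume \<phi>: "test_function a b \<phi>"
  have "(\<lambda>n. pairing ((deriv ^^ j) \<phi>) (U n)) \<longlonglongrightarrow> pairing ((deriv ^^ j) \<phi>) u"
    by (rule pairing_tendsto[OF test_function_continuous_derivs[OF \<phi>] U])
  moreover have "(\<lambda>n. (- 1) ^ j * pairing \<phi> (V n)) \<longlonglongrightarrow> (- 1) ^ j * pairing \<phi> v"
    by (intro tendsto_mult tendsto_const pairing_tendsto[OF test_function_continuous[OF \<phi>] V])
  moreover have "(\<lambda>n. pairing ((deriv ^^ j) \<phi>) (U n)) = (\<lambda>n. (- 1) ^ j * pairing \<phi> (V n))"
    using wd \<phi> by (simp add: has_weak_deriv_iff[OF U(1) V(1)])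
  ultimately show "pairing ((deriv ^^ j) \<phi>) u = (- 1) ^ j * pairing \<phi> v"
    using LIMSEQ_unique by metis
qed

text \<open>The single step from which Sobolev spaces are rebuilt as chains. Primitives, traces and
  jumps are treated one derivative at a time, while \<open>has_weak_deriv\<close> of order j refers
  back to the function itself.\<close>

definition D1 :: "real \<Rightarrow> real \<Rightarrow> 'a::{real_normed_field, euclidean_space} ae_fun \<Rightarrow> 'a ae_fun \<Rightarrow> bool" where
  "D1 a b u v \<longleftrightarrow> u \<in> L2 a b \<and> v \<in> L2 a b \<and>
     (\<forall>\<phi>. test_function a b \<phi> \<longrightarrow> pairing (deriv \<phi>) u = - pairing \<phi> v)"

lemma D1_iff: "D1 a b u v \<longleftrightarrow> u \<in> L2 a b \<and> v \<in> L2 a b \<and> has_weak_deriv a b 1 u v"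
  unfolding D1_def using has_weak_deriv_iff[of u a b v 1] by auto

lemma D1_unique: "D1 a b u v \<Longrightarrow> D1 a b u w \<Longrightarrow> v = w"
  using has_weak_deriv_unique D1_iff by blast

lemma D1_add:
  assumes "D1 a b u v" "D1 a b u' v'" shows "D1 a b (u + u') (v + v')"
  using assms unfolding D1_def
  by (auto simp: L2_add pairing_add[of _ _ a b] test_function_continuous
      test_function_continuous[OF test_function_deriv_test])

lemma D1_smult:
  assumes "D1 a b u v" shows "D1 a b (ae_smult c u) (ae_smult c v)"
  using assms unfolding D1_def
  by (auto simp: L2_smult pairing_smult[of _ _ a b] test_function_continuous
      test_function_continuous[OF test_function_deriv_test])

lemma D1_zero: "D1 a b 0 0"
  unfolding D1_def by (auto simp: L2_zero pairing_zero test_function_continuous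
      test_function_continuous[OF test_function_deriv_test])

lemma D1_minus: "D1 a b u v \<Longrightarrow> D1 a b (- u) (- v)"
  using D1_smult[of a b u v "- 1"] by (simp add: ae_smult_minus_one)

lemma D1_diff: "D1 a b u v \<Longrightarrow> D1 a b u' v' \<Longrightarrow> D1 a b (u - u') (v - v')"
  using D1_add[OF _ D1_minus, of a b u v u' v'] by simp

section \<open>Continuous representatives and traces\<close>

lemma continuous_AE_zero:
  fixes g :: "real \<Rightarrow> 'a::{real_normed_field, euclidean_space}"
  assumes "a < b" and cont: "continuous_on {a..b} g" and ae: "AE t in lborel. t \<in> {a<..<b} \<longrightarrow> g t = 0"
    and x: "x \<in> {a..b}"
  shows "g x = 0"
proof -
  have inner: "g t = 0" if "t \<in> {a<..<b}" for t
  proof (rule ccontr)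
    assume "g t \<noteq> 0"
    have "open ({a<..<b} \<inter> g -` (- {0}))"
      by (intro continuous_open_preimage continuous_on_subset[OF cont]) auto
    moreover have "t \<in> {a<..<b} \<inter> g -` (- {0})" using that \<open>g t \<noteq> 0\<close> by simp
    ultimately obtain e where e: "e > 0" "ball t e \<subseteq> {a<..<b} \<inter> g -` (- {0})"
      using open_contains_ball by metis
    have "AE s in lborel. s \<notin> {t - e<..<t + e}"
      using ae
    proof eventually_elim
      case (elim s)
      with e show ?case by (auto simp: ball_eq_greaterThanLessThan)
    qed
    then have "{t - e<..<t + e} \<in> null_sets lborel"
      by (subst AE_iff_null_sets) auto
    then have "emeasure lborel {t - e<..<t + e} = 0"
      by (rule null_setsD1)
    with e show False by simp
  qed
  have "closure {a<..<b} = {a..b}" using \<open>a < b\<close> by (rule closure_greaterThanLessThan)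
  then show ?thesis
    using continuous_constant_on_closure[of "{a<..<b}" g 0 x] cont inner x by simp
qed

text \<open>The trace at a point of the closed interval, ends included. For a < b any two continuous
  representatives give the same value, and one exists as soon as there is a weak derivative; for
  classes without one the value is unspecified.\<close>

definition ae_value :: "real \<Rightarrow> real \<Rightarrow> 'a::{real_normed_field, euclidean_space} ae_fun \<Rightarrow> real \<Rightarrow> 'a" where
  "ae_value a b u x = (THE y. \<exists>g. continuous_rep a b u g \<and> y = g x)"

lemma continuous_rep_class:
  "f \<in> borel_measurable borel \<Longrightarrow> continuous_rep a b (ae_class f) g \<longleftrightarrow>
     continuous_on {a..b} g \<and> (AE t in lborel. t \<in> {a<..<b} \<longrightarrow> f t = g t)"
  by (simp add: continuous_rep.abs_eq[OF ae_eq_refl])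

lemma ae_value_eq:
  assumes "a < b" and g: "continuous_rep a b u g" and x: "x \<in> {a..b}"
  shows "ae_value a b u x = g x"
  unfolding ae_value_def
proof (rule the_equality)
  show "\<exists>g'. continuous_rep a b u g' \<and> g x = g' x" using g by blast
  fix y assume "\<exists>h. continuous_rep a b u h \<and> y = h x"
  then obtain h where h: "continuous_rep a b u h" "y = h x" by blast
  have "continuous_on {a..b} (\<lambda>t. h t - g t)"
    using g h by (transfer; auto intro: continuous_intros)+
  moreover have "AE t in lborel. t \<in> {a<..<b} \<longrightarrow> h t - g t = 0"
    using g h(1) by transfer (auto elim: eventually_elim2)
  ultimately have "h x - g x = 0"
    using continuous_AE_zero[of a b "\<lambda>t. h t - g t" x] \<open>a < b\<close> x by blast
  with h show "y = g x" by simp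
qed

lemma continuous_rep_add:
  "continuous_rep a b u g \<Longrightarrow> continuous_rep a b v h \<Longrightarrow> continuous_rep a b (u + v) (\<lambda>t. g t + h t)"
  by transfer (auto intro: continuous_intros elim: eventually_elim2)

lemma continuous_rep_smult:
  "continuous_rep a b u g \<Longrightarrow> continuous_rep a b (ae_smult c u) (\<lambda>t. c * g t)"
  by transfer (auto intro: continuous_intros elim: eventually_mono)

text \<open>By du Bois-Reymond an element of W^1 is a constant plus a primitive. Traces and
  integration by parts are both read off this representative.\<close>

lemma D1_rep:
  assumes "a < b" and D: "D1 a b u v" and f: "L2_rep a b f v"
  obtains C where "continuous_rep a b u (\<lambda>t. C + prim f t)"
    "L2_rep a b (\<lambda>t. if t \<in> {a<..<b} then C + prim f t else 0) u"
proof -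
  have u: "u \<in> L2 a b" using D by (simp add: D1_def)
  obtain h where h: "L2_rep a b h u" using u L2_obtain by blast
  have "\<exists>C. AE t in lborel. t \<in> {a<..<b} \<longrightarrow> h t = C + prim f t"
  proof (rule du_bois_reymond[OF \<open>a < b\<close> L2_rep_integrable[OF h] L2_rep_integrable[OF f]])
    fix \<phi> assume \<phi>: "test_function a b \<phi>"
    then show "(LINT t|lborel. deriv \<phi> t *\<^sub>R h t) = - (LINT t|lborel. \<phi> t *\<^sub>R f t)"
      using D unfolding D1_def
      by (simp add: pairing_rep[OF h test_function_continuous[OF test_function_deriv_test[OF \<phi>]], symmetric]
          pairing_rep[OF f test_function_continuous[OF \<phi>], symmetric])
  qed
  then obtain C where C: "AE t in lborel. t \<in> {a<..<b} \<longrightarrow> h t = C + prim f t" by blast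
  have cont: "continuous_on S (\<lambda>t. C + prim f t)" for S
    by (intro continuous_intros prim_continuous L2_rep_integrable[OF f])
  let ?g = "\<lambda>t. if t \<in> {a<..<b} then C + prim f t else 0"
  have [measurable]: "prim f \<in> borel_measurable borel"
    by (intro borel_measurable_continuous_onI prim_continuous L2_rep_integrable[OF f])
  have g: "?g \<in> borel_measurable borel" by measurable
  note hb = L2_repD(1)[OF h]
  have ae: "AE t in lborel. h t = ?g t"
    using C by eventually_elim (use L2_repD(3)[OF h] in auto)
  have "integrable lborel (\<lambda>t. (norm (?g t))\<^sup>2)"
    using L2_repD(4)[OF h]
    by (rule integrable_cong_AE_imp) (use ae g in \<open>auto elim: eventually_mono\<close>)
  moreover have "u = ae_class ?g"
    using L2_repD(5)[OF h] ae_class_eq_iff[OF hb g] ae by simp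
  ultimately have "L2_rep a b ?g u"
    using g by (simp add: L2_rep_def)
  moreover have "continuous_rep a b u (\<lambda>t. C + prim f t)"
    using cont C by (simp add: L2_repD(5)[OF h] continuous_rep_class[OF hb])
  ultimately show ?thesis by (rule that[rotated])
qed

lemma D1_continuous_rep:
  assumes "a < b" "D1 a b u v" shows "\<exists>g. continuous_rep a b u g"
  using assms D1_rep L2_rep_ex D1_def by metis

lemma ae_value_add:
  assumes "a < b" "x \<in> {a..b}" "D1 a b u v" "D1 a b u' v'"
  shows "ae_value a b (u + u') x = ae_value a b u x + ae_value a b u' x"
proof -
  obtain g g' where "continuous_rep a b u g" "continuous_rep a b u' g'"
    using assms D1_continuous_rep by metis
  then show ?thesis
    using assms(1,2) by (simp add: ae_value_eq[OF _ continuous_rep_add] ae_value_eq)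
qed

lemma ae_value_smult:
  assumes "a < b" "x \<in> {a..b}" "D1 a b u v"
  shows "ae_value a b (ae_smult c u) x = c * ae_value a b u x"
proof -
  obtain g where "continuous_rep a b u g"
    using assms D1_continuous_rep by metis
  then show ?thesis
    using assms(1,2) by (simp add: ae_value_eq[OF _ continuous_rep_smult] ae_value_eq)
qed

lemma ae_value_zero: "a < b \<Longrightarrow> x \<in> {a..b} \<Longrightarrow> ae_value a b 0 x = 0"
  using ae_value_smult[OF _ _ D1_zero, of a b x 0] by simp

text \<open>Here \<phi> need not vanish at the ends and (c,d) may be any subinterval. Applied to
  unit intervals, these boundary terms become the point masses created by a block operator.\<close>

lemma D1_integration_by_parts:
  assumes "a < b" and D: "D1 a b u v" and cd: "a \<le> c" "c \<le> d" "d \<le> b"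
    and deriv: "\<And>x. (\<phi> has_field_derivative \<phi>' x) (at x)" and cont: "continuous_on UNIV \<phi>'"
  shows "pairing \<phi>' (restr c d u) =
    \<phi> d *\<^sub>R ae_value a b u d - \<phi> c *\<^sub>R ae_value a b u c - pairing \<phi> (restr c d v)"
proof -
  obtain f where f: "L2_rep a b f v" using D L2_rep_ex D1_def by blast
  obtain C where C: "continuous_rep a b u (\<lambda>t. C + prim f t)"
    "L2_rep a b (\<lambda>t. if t \<in> {a<..<b} then C + prim f t else 0) u"
    using D1_rep[OF \<open>a < b\<close> D f] by blast
  have cont\<phi>: "continuous_on UNIV \<phi>" by (rule DERIV_continuous_on[OF has_field_derivative_at_within[OF deriv]])
  have "pairing \<phi>' (restr c d u) = (LINT t:{c<..<d}|lborel. \<phi>' t *\<^sub>R (C + prim f t))"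
    unfolding pairing_rep[OF L2_rep_restr[OF C(2)] cont] set_lebesgue_integral_def
    using cd by (intro Bochner_Integration.integral_cong) (auto simp: indicator_def)
  also have "\<dots> = \<phi> d *\<^sub>R (C + prim f d) - \<phi> c *\<^sub>R (C + prim f c) - (LINT t:{c<..<d}|lborel. \<phi> t *\<^sub>R f t)"
    by (rule integration_by_parts_prim[OF L2_rep_integrable[OF f] deriv cont \<open>c \<le> d\<close>])
  also have "(LINT t:{c<..<d}|lborel. \<phi> t *\<^sub>R f t) = pairing \<phi> (restr c d v)"
    unfolding pairing_rep[OF L2_rep_restr[OF f] cont\<phi>] set_lebesgue_integral_def
    by (intro Bochner_Integration.integral_cong) (auto simp: indicator_def)
  finally show ?thesis
    using cd \<open>a < b\<close> by (simp add: ae_value_eq[OF _ C(1)])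
qed

lemma D1_increment:
  assumes "a < b" "D1 a b u v" "a \<le> c" "c \<le> d" "d \<le> b"
  shows "ae_value a b u d - ae_value a b u c = pairing (\<lambda>_. 1) (restr c d v)"
proof -
  obtain f where f: "L2_rep a b f (restr c d u)"
    using assms(2) restr_L2 L2_rep_ex D1_def by blast
  \<comment> \<open>Integration by parts with the constant function 1, whose derivative pairs to
    zero.\<close>
  have "pairing (\<lambda>_. 0) (restr c d u) = (0::'a)"
    by (simp add: pairing_rep[OF f])
  moreover have "pairing (\<lambda>_. 0) (restr c d u) =
      1 *\<^sub>R ae_value a b u d - 1 *\<^sub>R ae_value a b u c - pairing (\<lambda>_. 1) (restr c d v)"
    by (rule D1_integration_by_parts[OF assms]) auto
  ultimately show ?thesis by simp
qed

lemma D1_ex: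
  assumes "a < b" and v: "v \<in> L2 a b"
  obtains u where "D1 a b u v" "ae_value a b u a = C"
proof -
  obtain f where f: "L2_rep a b f v" using v L2_obtain by blast
  have cont: "continuous_on S (\<lambda>t. C + prim f t)" for S
    by (intro continuous_intros prim_continuous L2_rep_integrable[OF f])
  have [measurable]: "prim f \<in> borel_measurable borel"
    by (intro borel_measurable_continuous_onI prim_continuous L2_rep_integrable[OF f])
  let ?g = "\<lambda>t. if t \<in> {a<..<b} then C + prim f t else 0"
  have g: "?g \<in> borel_measurable borel" by measurable
  have "integrable lborel (\<lambda>t. indicator {a..b} t *\<^sub>R (norm (C + prim f t))\<^sup>2)"
    by (rule borel_integrable_compact) (auto intro!: continuous_intros prim_continuous L2_rep_integrable[OF f])
  then have "integrable lborel (\<lambda>t. (norm (?g t))\<^sup>2)"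
    by (rule Bochner_Integration.integrable_bound) auto
  with g have rep: "L2_rep a b ?g (ae_class ?g)" by (simp add: L2_rep_def)
  have "D1 a b (ae_class ?g) v"
    unfolding D1_def
  proof (intro conjI allI impI)
    show "ae_class ?g \<in> L2 a b" using rep L2_rep_ex by blast
    fix \<phi> assume \<phi>: "test_function a b \<phi>"
    note \<phi>' = test_function_deriv_test[OF \<phi>]
    have "pairing (deriv \<phi>) (ae_class ?g) = (LINT t:{a<..<b}|lborel. deriv \<phi> t *\<^sub>R (C + prim f t))"
      unfolding pairing_rep[OF rep test_function_continuous[OF \<phi>']] set_lebesgue_integral_def
      by (intro Bochner_Integration.integral_cong) (auto simp: indicator_def)
    also have "\<dots> = - (LINT t:{a<..<b}|lborel. \<phi> t *\<^sub>R f t)"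
      using integration_by_parts_prim[OF L2_rep_integrable[OF f] test_function_deriv[OF \<phi>]
          test_function_continuous[OF \<phi>'], of a b C] \<open>a < b\<close>
        test_function_eq_0[OF \<phi>, of a] test_function_eq_0[OF \<phi>, of b] by simp
    also have "(LINT t:{a<..<b}|lborel. \<phi> t *\<^sub>R f t) = pairing \<phi> v"
      unfolding pairing_rep[OF f test_function_continuous[OF \<phi>]] set_lebesgue_integral_def
      by (intro Bochner_Integration.integral_cong) (use L2_repD(3)[OF f] in \<open>force simp: indicator_def\<close>)+
    finally show "pairing (deriv \<phi>) (ae_class ?g) = - pairing \<phi> v" .
  qed (rule v)
  moreover have "ae_value a b (ae_class ?g) a = C"
  proof -
    have "continuous_rep a b (ae_class ?g) (\<lambda>t. C + prim f t)"
      unfolding continuous_rep_class[OF g] by (intro conjI cont AE_I2) simp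
    from ae_value_eq[OF \<open>a < b\<close> this, of a] show ?thesis
      using \<open>a < b\<close> prim_eq_0[of a b f a] L2_repD(3)[OF f] by simp
  qed
  ultimately show ?thesis by (rule that)
qed

lemma D1_zero_value_zero:
  assumes "a < b" "D1 a b u 0" "ae_value a b u a = 0"
  shows "u = 0"
proof -
  obtain C where C: "continuous_rep a b u (\<lambda>t. C + prim (\<lambda>_. 0) t)"
    "L2_rep a b (\<lambda>t. if t \<in> {a<..<b} then C + prim (\<lambda>_. 0) t else 0) u"
    using D1_rep[OF assms(1,2) L2_rep_zero] by blast
  have [simp]: "prim (\<lambda>_. 0) t = (0::'a)" for t
    by (simp add: prim_def set_lebesgue_integral_def)
  have "C = 0" using ae_value_eq[OF \<open>a < b\<close> C(1), of a] assms by simp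
  then have "(\<lambda>t. if t \<in> {a<..<b} then C + prim (\<lambda>_. 0) t else 0) = (\<lambda>_. 0)"
    by (simp add: fun_eq_iff)
  with L2_repD(5)[OF C(2)] show ?thesis
    by (simp only: zero_ae_fun.abs_eq)
qed

lemma D1_eqI:
  assumes "a < b" "D1 a b u v" "D1 a b u' v" "ae_value a b u a = ae_value a b u' a"
  shows "u = u'"
proof -
  have "u - u' = u + ae_smult (- 1) u'"
    by (simp add: ae_smult_minus_one)
  then have "ae_value a b (u - u') a = ae_value a b u a + (- 1) * ae_value a b u' a"
    using \<open>a < b\<close> by (simp only: ae_value_add[OF _ _ assms(2) D1_smult[OF assms(3)]] ae_value_smult[OF _ _ assms(3)]
        atLeastAtMost_iff order_refl less_imp_le)
  then have "ae_value a b (u - u') a = 0"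
    using assms(4) by simp
  then have "u - u' = 0"
    using D1_zero_value_zero[OF \<open>a < b\<close>, of "u - u'"] D1_diff[OF assms(2,3)] by simp
  then show ?thesis by simp
qed

text \<open>The test functions \<open>1\<close> and \<open>t\<close> determine both boundary values.\<close>
lemma ae_value_eqI:
  assumes "a < b" and D: "D1 a b u v"
    and ibp: "\<And>\<phi> \<phi>'. (\<And>x. (\<phi> has_field_derivative \<phi>' x) (at x)) \<Longrightarrow> continuous_on UNIV \<phi>' \<Longrightarrow>
      pairing \<phi>' u = \<phi> b *\<^sub>R B - \<phi> a *\<^sub>R A - pairing \<phi> v"
  shows "ae_value a b u a = A" "ae_value a b u b = B"
proof -
  have restr: "restr a b u = u" "restr a b v = v" using D by (auto simp: D1_def L2_def)
  have eq: "\<phi> b *\<^sub>R (ae_value a b u b - B) = \<phi> a *\<^sub>R (ae_value a b u a - A)"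
    if "\<And>x. (\<phi> has_field_derivative \<phi>' x) (at x)" "continuous_on UNIV \<phi>'" for \<phi> \<phi>'
    using D1_integration_by_parts[OF \<open>a < b\<close> D _ _ _ that, of a b] ibp[OF that] \<open>a < b\<close>
    by (simp add: restr algebra_simps)
  have 1: "ae_value a b u b - B = ae_value a b u a - A"
    using eq[of "\<lambda>_. 1" "\<lambda>_. 0"] by simp
  have "b *\<^sub>R (ae_value a b u b - B) = a *\<^sub>R (ae_value a b u a - A)"
    using eq[of "\<lambda>t. t" "\<lambda>_. 1"] by simp
  with 1 have "(b - a) *\<^sub>R (ae_value a b u a - A) = 0"
    by (simp add: scaleR_left_diff_distrib)
  with 1 \<open>a < b\<close> show "ae_value a b u a = A" "ae_value a b u b = B" by auto
qed

section \<open>Sobolev spaces as chains of derivatives\<close>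

lemma chain_has_weak_deriv:
  assumes "\<And>j. j < m \<Longrightarrow> D1 a b (U j) (U (Suc j))" "U 0 \<in> L2 a b" "j \<le> m"
  shows "U j \<in> L2 a b \<and> has_weak_deriv a b j (U 0) (U j)"
  using assms(3)
proof (induction j)
  case 0
  then show ?case using assms(2) by (simp add: has_weak_deriv_iff)
next
  case (Suc j)
  then have IH: "U j \<in> L2 a b" "has_weak_deriv a b j (U 0) (U j)" and D: "D1 a b (U j) (U (Suc j))"
    using assms(1) by auto
  have U: "U (Suc j) \<in> L2 a b" using D by (simp add: D1_def)
  moreover have "has_weak_deriv a b (Suc j) (U 0) (U (Suc j))"
    unfolding has_weak_deriv_iff[OF assms(2) U]
  proof (intro allI impI)
    fix \<phi> assume \<phi>: "test_function a b \<phi>"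
    have "pairing ((deriv ^^ Suc j) \<phi>) (U 0) = pairing ((deriv ^^ j) (deriv \<phi>)) (U 0)"
      by (simp only: funpow_Suc_right o_apply)
    also have "\<dots> = (- 1) ^ j * pairing (deriv \<phi>) (U j)"
      using IH test_function_deriv_test[OF \<phi>] by (simp add: has_weak_deriv_iff[OF assms(2)])
    finally show "pairing ((deriv ^^ Suc j) \<phi>) (U 0) = (- 1) ^ Suc j * pairing \<phi> (U (Suc j))"
      using D \<phi> by (simp add: D1_def)
  qed
  ultimately show ?case by blast
qed

text \<open>Membership is shown by exhibiting the derivatives: by uniqueness, a chain of
  \<open>D1\<close> steps can only consist of the weak derivatives of its first element.\<close>

lemma sobolev_chainI:
  assumes "\<And>j. j < m \<Longrightarrow> D1 a b (U j) (U (Suc j))" "U 0 \<in> L2 a b"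
  shows "U 0 \<in> sobolev a b m" "\<And>j. j \<le> m \<Longrightarrow> weak_deriv a b j (U 0) = U j"
proof -
  show "U 0 \<in> sobolev a b m"
    unfolding sobolev_def using assms(2) chain_has_weak_deriv[of m a b U] assms by blast
  show "weak_deriv a b j (U 0) = U j" if "j \<le> m" for j
    using chain_has_weak_deriv[of m a b U j] assms that by (intro weak_deriv_eqI) auto
qed

lemma sobolev_weak_deriv:
  assumes u: "u \<in> sobolev a b m" and "j \<le> m"
  shows "weak_deriv a b j u \<in> L2 a b" "has_weak_deriv a b j u (weak_deriv a b j u)"
proof -
  obtain w where "w \<in> L2 a b" "has_weak_deriv a b j u w"
    using assms by (auto simp: sobolev_def)
  moreover from this have "weak_deriv a b j u = w"
    using u by (intro weak_deriv_eqI) (auto simp: sobolev_def)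
  ultimately show "weak_deriv a b j u \<in> L2 a b" "has_weak_deriv a b j u (weak_deriv a b j u)"
    by simp_all
qed

lemma sobolev_L2: "u \<in> sobolev a b m \<Longrightarrow> u \<in> L2 a b"
  by (simp add: sobolev_def)

lemma sobolev_mono: "u \<in> sobolev a b m \<Longrightarrow> m' \<le> m \<Longrightarrow> u \<in> sobolev a b m'"
  by (auto simp: sobolev_def)

lemma weak_deriv_0: "u \<in> L2 a b \<Longrightarrow> weak_deriv a b 0 u = u"
  by (intro weak_deriv_eqI) (auto simp: has_weak_deriv_iff)

lemma sobolev_0: "sobolev a b 0 = L2 a b"
  by (auto simp: sobolev_def has_weak_deriv_iff)

text \<open>\<open>sobolev\<close> supplies a derivative of each order separately. Testing with
  \<open>deriv \<phi>\<close> in place of \<phi> shows that consecutive ones are derivatives of each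
  other.\<close>

lemma sobolev_D1:
  assumes u: "u \<in> sobolev a b m" and "j < m"
  shows "D1 a b (weak_deriv a b j u) (weak_deriv a b (Suc j) u)"
proof -
  have uL: "u \<in> L2 a b" using u by (rule sobolev_L2)
  note w = sobolev_weak_deriv[OF u less_imp_le[OF \<open>j < m\<close>]] sobolev_weak_deriv[OF u Suc_leI[OF \<open>j < m\<close>]]
  show ?thesis
    unfolding D1_def
  proof (intro conjI allI impI w)
    fix \<phi> assume \<phi>: "test_function a b \<phi>"
    have "(- 1) ^ j * pairing (deriv \<phi>) (weak_deriv a b j u) = pairing ((deriv ^^ j) (deriv \<phi>)) u"
      using w(2) test_function_deriv_test[OF \<phi>] by (simp add: has_weak_deriv_iff[OF uL w(1)])
    also have "\<dots> = pairing ((deriv ^^ Suc j) \<phi>) u"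
      by (simp only: funpow_Suc_right o_apply)
    also have "\<dots> = (- 1) ^ j * (- pairing \<phi> (weak_deriv a b (Suc j) u))"
      using w(4) \<phi> has_weak_deriv_iff[OF uL w(3), of "Suc j"] by simp
    finally show "pairing (deriv \<phi>) (weak_deriv a b j u) = - pairing \<phi> (weak_deriv a b (Suc j) u)"
      by (subst (asm) mult_cancel_left) auto
  qed
qed

lemma sobolev_Suc_iff:
  "u \<in> sobolev a b (Suc m) \<longleftrightarrow> (\<exists>v. D1 a b u v \<and> v \<in> sobolev a b m)"
proof
  assume u: "u \<in> sobolev a b (Suc m)"
  have "D1 a b u (weak_deriv a b 1 u)"
    using sobolev_D1[OF u, of 0] weak_deriv_0[OF sobolev_L2[OF u]] by simp
  moreover have "weak_deriv a b 1 u \<in> sobolev a b m"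
    using sobolev_chainI(1)[of m a b "\<lambda>j. weak_deriv a b (Suc j) u"] sobolev_D1[OF u] sobolev_weak_deriv[OF u]
    by simp
  ultimately show "\<exists>v. D1 a b u v \<and> v \<in> sobolev a b m" by blast
next
  assume "\<exists>v. D1 a b u v \<and> v \<in> sobolev a b m"
  then obtain v where v: "D1 a b u v" "v \<in> sobolev a b m" by blast
  let ?U = "\<lambda>j. case j of 0 \<Rightarrow> u | Suc i \<Rightarrow> weak_deriv a b i v"
  have "D1 a b (?U j) (?U (Suc j))" if "j < Suc m" for j
    using v sobolev_D1[OF v(2)] weak_deriv_0[OF sobolev_L2[OF v(2)]] that by (cases j) auto
  from sobolev_chainI(1)[of "Suc m" a b ?U, OF this] v show "u \<in> sobolev a b (Suc m)"
    by (simp add: D1_def)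
qed

lemma weak_deriv_Suc:
  assumes "D1 a b u v" "v \<in> sobolev a b m" "j \<le> m"
  shows "weak_deriv a b (Suc j) u = weak_deriv a b j v"
proof -
  let ?U = "\<lambda>j. case j of 0 \<Rightarrow> u | Suc i \<Rightarrow> weak_deriv a b i v"
  have "D1 a b (?U j) (?U (Suc j))" if "j < Suc m" for j
    using assms sobolev_D1[OF assms(2)] weak_deriv_0[OF sobolev_L2[OF assms(2)]] that by (cases j) auto
  from sobolev_chainI(2)[of "Suc m" a b ?U "Suc j", OF this] assms show ?thesis
    by (simp add: D1_def)
qed

lemma sobolev_add:
  assumes "u \<in> sobolev a b m" "v \<in> sobolev a b m"
  shows "u + v \<in> sobolev a b m" "\<And>j. j \<le> m \<Longrightarrow> weak_deriv a b j (u + v) = weak_deriv a b j u + weak_deriv a b j v"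
proof -
  have D: "D1 a b (weak_deriv a b j u + weak_deriv a b j v) (weak_deriv a b (Suc j) u + weak_deriv a b (Suc j) v)"
    if "j < m" for j
    using assms that by (intro D1_add sobolev_D1)
  have 0: "weak_deriv a b 0 u + weak_deriv a b 0 v = u + v" "u + v \<in> L2 a b"
    using assms by (auto simp: weak_deriv_0[of _ a b] sobolev_L2 intro: L2_add)
  show "u + v \<in> sobolev a b m" "\<And>j. j \<le> m \<Longrightarrow> weak_deriv a b j (u + v) = weak_deriv a b j u + weak_deriv a b j v"
    using sobolev_chainI[of m a b "\<lambda>j. weak_deriv a b j u + weak_deriv a b j v"] D 0 by auto
qed

lemma sobolev_smult:
  assumes "u \<in> sobolev a b m"
  shows "ae_smult c u \<in> sobolev a b m" "\<And>j. j \<le> m \<Longrightarrow> weak_deriv a b j (ae_smult c u) = ae_smult c (weak_deriv a b j u)"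
proof -
  have D: "D1 a b (ae_smult c (weak_deriv a b j u)) (ae_smult c (weak_deriv a b (Suc j) u))"
    if "j < m" for j
    using assms that by (intro D1_smult sobolev_D1)
  have 0: "ae_smult c (weak_deriv a b 0 u) = ae_smult c u" "ae_smult c u \<in> L2 a b"
    using assms by (auto simp: weak_deriv_0[of _ a b] sobolev_L2 intro: L2_smult)
  show "ae_smult c u \<in> sobolev a b m"
    "\<And>j. j \<le> m \<Longrightarrow> weak_deriv a b j (ae_smult c u) = ae_smult c (weak_deriv a b j u)"
    using sobolev_chainI[of m a b "\<lambda>j. ae_smult c (weak_deriv a b j u)"] D 0 by auto
qed

lemma sobolev_zero: "0 \<in> sobolev a b m"
  using sobolev_chainI(1)[of m a b "\<lambda>_. 0"] D1_zero L2_zero by blast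

lemma sobolev_subspace: "ae.subspace (sobolev a b m)"
  unfolding ae.subspace_def by (auto intro: sobolev_add(1) sobolev_smult(1) sobolev_zero)

lemma weak_deriv_diff:
  assumes "u \<in> sobolev a b m" "v \<in> sobolev a b m" "j \<le> m"
  shows "weak_deriv a b j (u - v) = weak_deriv a b j u - weak_deriv a b j v"
  using sobolev_add(2)[OF assms(1) sobolev_smult(1)[OF assms(2), of "- 1"]] sobolev_smult(2)[OF assms(2), of j "- 1"] assms(3)
  by (simp add: ae_smult_minus_one)

section \<open>Block operators on unit intervals\<close>

lemma restr_add: "restr c d (u + v) = restr c d u + restr c d v"
  by transfer (auto simp: ae_eq_def)

lemma restr_smult: "restr c d (ae_smult \<alpha> u) = ae_smult \<alpha> (restr c d u)"
  by transfer (auto simp: ae_eq_def)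

lemma restr_zero: "restr c d 0 = 0"
  by transfer (auto simp: ae_eq_def)

lemma restr_sum: "restr c d (sum u I) = (\<Sum>i\<in>I. restr c d (u i))"
  by (induction I rule: infinite_finite_induct) (auto simp: restr_add restr_zero)

lemma translate_add: "translate s (u + v) = translate s u + translate s v"
  by transfer (auto simp: ae_eq_def)

lemma translate_smult: "translate s (ae_smult \<alpha> u) = ae_smult \<alpha> (translate s u)"
  by transfer (auto simp: ae_eq_def)

lemma translate_zero: "translate s 0 = 0"
  by transfer (auto simp: ae_eq_def)

lemma translate_sum: "translate s (sum u I) = (\<Sum>i\<in>I. translate s (u i))"
  by (induction I rule: infinite_finite_induct) (auto simp: translate_add translate_zero)

lemma translate_translate: "translate s (translate r u) = translate (s + r) u"
  by transfer (auto simp: ae_eq_def add_ac)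

lemma translate_by_0: "translate 0 u = u"
proof -
  obtain f where "f \<in> borel_measurable borel" "u = ae_class f"
    using ae_fun.abs_induct[of "\<lambda>u. \<exists>f. f \<in> borel_measurable borel \<and> u = ae_class f" u]
    by (auto simp: ae_eq_def)
  then show ?thesis by (simp add: ae_class_abs_eq)
qed

lemma restr_empty: "d \<le> c \<Longrightarrow> restr c d u = 0"
proof -
  assume "d \<le> c"
  then have "(if t \<in> {c<..<d} then f t else 0) = (0::'a)" for t and f :: "real \<Rightarrow> 'a" by auto
  then show ?thesis by transfer (auto simp: ae_eq_def)
qed

lemma restr_split: "restr 0 (real N + 1) u = (\<Sum>i\<le>N. restr (real i) (real i + 1) u)"
proof (induction N)
  case 0
  then show ?case by simp
next
  case (Suc N)
  have "restr 0 (c + 1) u = restr 0 c u + restr c (c + 1) u" if "c > 0" for c :: real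
  proof -
    obtain f where f: "f \<in> borel_measurable borel" "u = ae_class f"
      using ae_fun.abs_induct[of "\<lambda>u. \<exists>f. f \<in> borel_measurable borel \<and> u = ae_class f" u]
      by (auto simp: ae_eq_def)
    note [measurable] = f(1)
    show ?thesis
      unfolding f(2) restr.abs_eq[OF ae_eq_refl[OF f(1)]]
    proof (subst plus_ae_fun.abs_eq[OF ae_eq_refl ae_eq_refl])
      show "ae_class (\<lambda>t. if t \<in> {0<..<c + 1} then f t else 0) =
          ae_class (\<lambda>t. (if t \<in> {0<..<c} then f t else 0) + (if t \<in> {c<..<c + 1} then f t else 0))"
      proof (subst ae_class_eq_iff)
        show "AE t in lborel. (if t \<in> {0<..<c + 1} then f t else 0) =
            (if t \<in> {0<..<c} then f t else 0) + (if t \<in> {c<..<c + 1} then f t else 0)"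
          \<comment> \<open>The two open pieces miss the cut point c, a null set.\<close>
          using AE_lborel_singleton[of c] by eventually_elim (use that in auto)
      qed measurable
    qed measurable
  qed
  from this[of "real N + 1"] Suc show ?case by (simp add: add_ac)
qed

text \<open>The matrix unit with entry 1 at (i,k), acting on the vector of pieces of a function over
  the unit intervals.\<close>

definition block_piece :: "nat \<Rightarrow> nat \<Rightarrow> 'a::{real_normed_field, euclidean_space} ae_fun \<Rightarrow> 'a ae_fun" where
  "block_piece i k u = translate (real k - real i) (restr (real k) (real k + 1) u)"

text \<open>A function on (0,N+1) is viewed as the vector of its N+1 pieces, each moved to a common
  interval; this is the matrix \<open>B\<close> applied to that vector.\<close>

definition block_op ::
  "nat \<Rightarrow> (nat \<Rightarrow> nat \<Rightarrow> real) \<Rightarrow> 'a::{real_normed_field, euclidean_space} ae_fun \<Rightarrow> 'a ae_fun" where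
  "block_op N B u = (\<Sum>i\<le>N. \<Sum>k\<le>N. ae_smult (of_real (B i k)) (block_piece i k u))"

definition block_row :: "nat \<Rightarrow> (nat \<Rightarrow> nat \<Rightarrow> real) \<Rightarrow> (nat \<Rightarrow> 'a::real_normed_field) \<Rightarrow> nat \<Rightarrow> 'a" where
  "block_row N B x i = (\<Sum>k\<le>N. of_real (B i k) * x k)"

text \<open>Let \<open>x\<close> list the values of a function at 0,...,N+1. At the point i+1 the
  i-th piece of its image ends with row i applied to the right end values
  \<open>x \<circ> Suc\<close>, and the next piece begins with row i+1 applied to the left end
  values \<open>x\<close>. The jump is left limit minus right limit.\<close>

definition block_jump :: "nat \<Rightarrow> (nat \<Rightarrow> nat \<Rightarrow> real) \<Rightarrow> (nat \<Rightarrow> 'a::real_normed_field) \<Rightarrow> nat \<Rightarrow> 'a" where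
  "block_jump N B x i = block_row N B (x \<circ> Suc) i - block_row N B x (Suc i)"

lemma block_piece_linear:
  "block_piece i k (u + v) = block_piece i k u + block_piece i k v"
  "block_piece i k (ae_smult c u) = ae_smult c (block_piece i k u)"
  by (simp_all add: block_piece_def restr_add translate_add restr_smult translate_smult)

lemma block_op_linear:
  "block_op N B (u + v) = block_op N B u + block_op N B v"
  "block_op N B (ae_smult c u) = ae_smult c (block_op N B u)"
  by (simp_all add: block_op_def block_piece_linear ae.scale_right_distrib sum.distrib ae.scale_sum_right
      mult.commute)

lemma block_op_minus: "block_op N B (- u) = - block_op N B u"
  using block_op_linear(2)[of N B "- 1" u] by (simp add: ae_smult_minus_one)

lemma block_op_diff: "block_op N B (u - v) = block_op N B u - block_op N B v"
  using block_op_linear(1)[of N B u "- v"] by (simp add: block_op_minus)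

lemma restr_block_piece:
  "j \<noteq> i \<Longrightarrow> restr (real j) (real j + 1) (block_piece i k u) = 0"
  "restr (real i) (real i + 1) (block_piece i k u) = block_piece i k u"
proof -
  have "real j + 1 \<le> real i \<or> real i + 1 \<le> real j" if "j \<noteq> i"
    using that by linarith
  then show "restr (real j) (real j + 1) (block_piece i k u) = 0" if "j \<noteq> i"
    using that by (auto simp: block_piece_def translate_restr restr_restr restr_empty translate_zero)
  show "restr (real i) (real i + 1) (block_piece i k u) = block_piece i k u"
    by (simp add: block_piece_def translate_restr restr_restr add.commute)
qed

text \<open>The product rule of matrix units. It makes \<open>block_op\<close> multiplicative in the
  matrix, so inverse matrices give inverse operators.\<close>

lemma block_piece_comp:
  "block_piece i k (block_piece j l u) = (if k = j then block_piece i l u else 0)"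
proof (cases "k = j")
  case True
  then have "block_piece i k (block_piece j l u) = translate (real j - real i) (block_piece j l u)"
    using restr_block_piece(2)[of j l u] by (simp add: block_piece_def[of i])
  with True show ?thesis
    by (simp add: block_piece_def translate_translate)
next
  case False
  then show ?thesis
    using restr_block_piece(1)[of k j l u] by (simp add: block_piece_def[of i] translate_zero)
qed

lemma block_piece_sum: "block_piece i k (sum u I) = (\<Sum>j\<in>I. block_piece i k (u j))"
  by (simp add: block_piece_def restr_sum translate_sum)

lemma block_op_comp:
  "block_op N B (block_op N C u) = block_op N (\<lambda>i j. \<Sum>k\<le>N. B i k * C k j) u"
proof -
  have "block_piece i k (block_op N C u) = (\<Sum>l\<le>N. ae_smult (of_real (C k l)) (block_piece i l u))"
    if "k \<le> N" for i k
  proof -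
    have "block_piece i k (block_op N C u) =
        (\<Sum>j\<le>N. \<Sum>l\<le>N. ae_smult (of_real (C j l)) (if k = j then block_piece i l u else 0))"
      by (simp add: block_op_def block_piece_sum block_piece_linear block_piece_comp)
    also have "\<dots> = (\<Sum>j\<le>N. if k = j then \<Sum>l\<le>N. ae_smult (of_real (C j l)) (block_piece i l u) else 0)"
      by (intro sum.cong) auto
    finally show ?thesis using that by simp
  qed
  then have "block_op N B (block_op N C u) =
      (\<Sum>i\<le>N. \<Sum>k\<le>N. \<Sum>l\<le>N. ae_smult (of_real (B i k * C k l)) (block_piece i l u))"
    by (simp add: block_op_def[of N B] ae.scale_sum_right)
  also have "\<dots> = (\<Sum>i\<le>N. \<Sum>l\<le>N. \<Sum>k\<le>N. ae_smult (of_real (B i k * C k l)) (block_piece i l u))"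
    by (intro sum.cong[OF refl] sum.swap)
  finally show ?thesis
    by (simp add: block_op_def ae.scale_sum_left)
qed

lemma block_op_cong:
  "(\<And>i k. i \<le> N \<Longrightarrow> k \<le> N \<Longrightarrow> B i k = C i k) \<Longrightarrow> block_op N B u = block_op N C u"
  unfolding block_op_def by (intro sum.cong) auto

lemma block_op_id:
  assumes "u \<in> L2 0 (real N + 1)"
  shows "block_op N (\<lambda>i k. if i = k then 1 else 0) u = u"
proof -
  have "block_op N (\<lambda>i k. if i = k then 1 else 0) u =
      (\<Sum>i\<le>N. \<Sum>k\<le>N. if i = k then block_piece i k u else 0)"
    unfolding block_op_def by (intro sum.cong) auto
  also have "\<dots> = (\<Sum>i\<le>N. restr (real i) (real i + 1) u)"
    by (simp add: block_piece_def translate_by_0)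
  also have "\<dots> = u"
    using assms restr_split[of N u] by (simp add: L2_def)
  finally show ?thesis .
qed

section \<open>Boundedness, weak derivatives and jumps of block operators\<close>

lemma restr_L2_inner: "u \<in> L2 a b \<Longrightarrow> restr c d u \<in> L2 c d"
proof -
  assume "u \<in> L2 a b"
  then obtain f where f: "L2_rep a b f u" by (rule L2_obtain)
  from L2_rep_restr[OF f, of c d] have "L2_rep c d (\<lambda>t. if t \<in> {c<..<d} then f t else 0) (restr c d u)"
    by (auto simp: L2_rep_def)
  then show ?thesis using L2_rep_ex by blast
qed

lemma L2_mono: "a' \<le> a \<Longrightarrow> b \<le> b' \<Longrightarrow> u \<in> L2 a b \<Longrightarrow> u \<in> L2 a' b'"
proof -
  assume "a' \<le> a" "b \<le> b'" "u \<in> L2 a b"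
  then obtain f where f: "L2_rep a b f u" by (auto elim: L2_obtain)
  with \<open>a' \<le> a\<close> \<open>b \<le> b'\<close> have "L2_rep a' b' f u" unfolding L2_rep_def by auto
  then show ?thesis using L2_rep_ex by blast
qed

lemma translate_L2: "u \<in> L2 a b \<Longrightarrow> translate s u \<in> L2 (a - s) (b - s)"
  using L2_rep_translate L2_rep_ex by blast

lemma block_piece_L2:
  assumes "u \<in> L2 a b" "i \<le> N" shows "block_piece i k u \<in> L2 0 (real N + 1)"
proof -
  have "block_piece i k u \<in> L2 (real i) (real i + 1)"
    using translate_L2[OF restr_L2_inner[OF assms(1), of "real k" "real k + 1"], of "real k - real i"]
    by (simp add: block_piece_def add.commute)
  then show ?thesis
    by (rule L2_mono[rotated 2]) (use assms in auto)
qed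

lemma block_op_L2: "u \<in> L2 a b \<Longrightarrow> block_op N B u \<in> L2 0 (real N + 1)"
  unfolding block_op_def by (intro L2_sum L2_smult block_piece_L2[of _ a b]) auto

lemma L2_norm_block_op:
  assumes u: "u \<in> L2 a b"
  shows "L2_norm (block_op N B u) \<le> (\<Sum>i\<le>N. \<Sum>k\<le>N. \<bar>B i k\<bar>) * L2_norm u"
proof -
  note L = block_piece_L2[OF u]
  have "L2_norm (block_op N B u) \<le> (\<Sum>i\<le>N. L2_norm (\<Sum>k\<le>N. ae_smult (of_real (B i k)) (block_piece i k u)))"
    unfolding block_op_def by (intro L2_norm_sum[of _ _ 0 "real N + 1"] L2_sum L2_smult L) auto
  also have "\<dots> \<le> (\<Sum>i\<le>N. \<Sum>k\<le>N. L2_norm (ae_smult (of_real (B i k)) (block_piece i k u)))"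
    by (intro sum_mono L2_norm_sum[of _ _ 0 "real N + 1"] L2_smult L) auto
  also have "\<dots> \<le> (\<Sum>i\<le>N. \<Sum>k\<le>N. \<bar>B i k\<bar> * L2_norm u)"
  proof (intro sum_mono)
    fix i k assume ik: "i \<in> {..N}" "k \<in> {..N}"
    have "L2_norm (block_piece i k u) \<le> L2_norm u"
      unfolding block_piece_def
      by (subst L2_norm_translate[OF restr_L2[OF u]]) (rule L2_norm_restr[OF u])
    with ik show "L2_norm (ae_smult (of_real (B i k)) (block_piece i k u)) \<le> \<bar>B i k\<bar> * L2_norm u"
      by (subst L2_norm_smult[OF L]) (auto intro: mult_left_mono)
  qed
  finally show ?thesis by (simp add: sum_distrib_right)
qed

text \<open>Integration by parts on every piece, with boundary terms collected by integer points. An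
  inner point i+1 is the right end of piece i and the left end of piece i+1; the two terms share the
  factor \<phi>(i+1) and form a jump. So the derivative of \<open>block_op N B u\<close> is
  \<open>block_op N B v\<close> up to point masses.\<close>

lemma block_op_integration_by_parts:
  fixes u v :: "'a::{real_normed_field, euclidean_space} ae_fun"
  assumes D: "D1 0 (real N + 1) u v"
    and deriv: "\<And>x. (\<phi> has_field_derivative \<phi>' x) (at x)" and cont: "continuous_on UNIV \<phi>'"
  defines "x \<equiv> \<lambda>k. ae_value 0 (real N + 1) u (real k)"
  shows "pairing \<phi>' (block_op N B u) =
    \<phi> (real N + 1) *\<^sub>R block_row N B (x \<circ> Suc) N - \<phi> 0 *\<^sub>R block_row N B x 0
    + (\<Sum>i<N. \<phi> (real (Suc i)) *\<^sub>R block_jump N B x i) - pairing \<phi> (block_op N B v)"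
proof -
  have u: "u \<in> L2 0 (real N + 1)" and v: "v \<in> L2 0 (real N + 1)" using D by (auto simp: D1_def)
  have cont\<phi>: "continuous_on UNIV \<phi>" by (rule DERIV_continuous_on[OF has_field_derivative_at_within[OF deriv]])
  have piece: "pairing \<phi>' (block_piece i k u) =
      \<phi> (real i + 1) *\<^sub>R x (Suc k) - \<phi> (real i) *\<^sub>R x k - pairing \<phi> (block_piece i k v)"
    if "k \<le> N" for i k
  proof -
    let ?s = "real k - real i"
    have d: "((\<lambda>t. \<phi> (t - ?s)) has_field_derivative \<phi>' (y - ?s)) (at y)" for y
    proof -
      have "((\<lambda>t. t - ?s) has_field_derivative 1) (at y)" by (auto intro!: derivative_eq_intros)
      from DERIV_chain2[where f = \<phi>, OF deriv this] show ?thesis by simp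
    qed
    have c: "continuous_on UNIV (\<lambda>t. \<phi>' (t - ?s))"
      by (rule continuous_on_compose2[OF cont]) (auto intro!: continuous_intros)
    have "pairing (\<lambda>t. \<phi>' (t - ?s)) (restr (real k) (real k + 1) u) =
        \<phi> (real k + 1 - ?s) *\<^sub>R ae_value 0 (real N + 1) u (real k + 1) - \<phi> (real k - ?s) *\<^sub>R ae_value 0 (real N + 1) u (real k)
        - pairing (\<lambda>t. \<phi> (t - ?s)) (restr (real k) (real k + 1) v)"
      by (rule D1_integration_by_parts[OF _ D _ _ _ d c]) (use that in auto)
    then show ?thesis
      by (simp add: block_piece_def pairing_translate[OF cont restr_L2[OF u]]
          pairing_translate[OF cont\<phi> restr_L2[OF v]] x_def algebra_simps)
  qed
  have lin: "pairing \<psi> (block_op N B w) = (\<Sum>i\<le>N. \<Sum>k\<le>N. of_real (B i k) * pairing \<psi> (block_piece i k w))"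
    if "continuous_on UNIV \<psi>" "w \<in> L2 0 (real N + 1)" for \<psi> and w :: "'a ae_fun"
  proof -
    note L = block_piece_L2[OF that(2), where N = N]
    have "pairing \<psi> (block_op N B w) =
        (\<Sum>i\<le>N. pairing \<psi> (\<Sum>k\<le>N. ae_smult (of_real (B i k)) (block_piece i k w)))"
      unfolding block_op_def
      by (rule pairing_sum[OF that(1), of _ _ 0 "real N + 1"]) (auto intro!: L2_sum L2_smult L)
    also have "\<dots> = (\<Sum>i\<le>N. \<Sum>k\<le>N. pairing \<psi> (ae_smult (of_real (B i k)) (block_piece i k w)))"
      by (intro sum.cong[OF refl] pairing_sum[OF that(1), of _ _ 0 "real N + 1"]) (auto intro!: L2_smult L)
    also have "\<dots> = (\<Sum>i\<le>N. \<Sum>k\<le>N. of_real (B i k) * pairing \<psi> (block_piece i k w))"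
      by (intro sum.cong[OF refl] pairing_smult[OF that(1), of _ 0 "real N + 1"] L) auto
    finally show ?thesis .
  qed
  have "pairing \<phi>' (block_op N B u) = (\<Sum>i\<le>N. \<Sum>k\<le>N. of_real (B i k) *
      (\<phi> (real i + 1) *\<^sub>R x (Suc k) - \<phi> (real i) *\<^sub>R x k - pairing \<phi> (block_piece i k v)))"
    using piece by (simp add: lin[OF cont u])
  also have "\<dots> = (\<Sum>i\<le>N. \<phi> (real i + 1) *\<^sub>R block_row N B (x \<circ> Suc) i - \<phi> (real i) *\<^sub>R block_row N B x i)
      - pairing \<phi> (block_op N B v)"
    by (simp add: lin[OF cont\<phi> v] block_row_def right_diff_distrib sum_subtractf scaleR_sum_right)
  also have "(\<Sum>i\<le>N. \<phi> (real i + 1) *\<^sub>R block_row N B (x \<circ> Suc) i - \<phi> (real i) *\<^sub>R block_row N B x i) =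
      \<phi> (real N + 1) *\<^sub>R block_row N B (x \<circ> Suc) N - \<phi> 0 *\<^sub>R block_row N B x 0
      + (\<Sum>i<N. \<phi> (real (Suc i)) *\<^sub>R block_jump N B x i)"
  proof -
    have "(\<Sum>i\<le>N. \<phi> (real i + 1) *\<^sub>R block_row N B (x \<circ> Suc) i) =
        (\<Sum>i<N. \<phi> (real (Suc i)) *\<^sub>R block_row N B (x \<circ> Suc) i) + \<phi> (real N + 1) *\<^sub>R block_row N B (x \<circ> Suc) N"
      by (simp add: lessThan_Suc_atMost[symmetric] add_ac)
    moreover have "(\<Sum>i\<le>N. \<phi> (real i) *\<^sub>R block_row N B x i) =
        \<phi> 0 *\<^sub>R block_row N B x 0 + (\<Sum>i<N. \<phi> (real (Suc i)) *\<^sub>R block_row N B x (Suc i))"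
      by (simp add: sum.atMost_shift)
    ultimately show ?thesis
      by (simp add: sum_subtractf block_jump_def scaleR_diff_right)
  qed
  finally show ?thesis .
qed

text \<open>Without jumps only the two end terms remain in the integration by parts formula, and
  \<open>ae_value_eqI\<close> identifies them as the traces.\<close>

lemma block_op_D1:
  assumes D: "D1 0 (real N + 1) u v"
  defines "x \<equiv> \<lambda>k. ae_value 0 (real N + 1) u (real k)"
  assumes jump: "\<And>i. i < N \<Longrightarrow> block_jump N B x i = 0"
  shows "D1 0 (real N + 1) (block_op N B u) (block_op N B v)"
    "ae_value 0 (real N + 1) (block_op N B u) 0 = block_row N B x 0"
    "ae_value 0 (real N + 1) (block_op N B u) (real N + 1) = block_row N B (x \<circ> Suc) N"
proof -
  note ibp = block_op_integration_by_parts[OF D, of _ _ B, folded x_def]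
  show D': "D1 0 (real N + 1) (block_op N B u) (block_op N B v)"
    unfolding D1_def
  proof (intro conjI allI impI)
    show "block_op N B u \<in> L2 0 (real N + 1)" "block_op N B v \<in> L2 0 (real N + 1)"
      using D by (auto simp: D1_def intro: block_op_L2)
    fix \<phi> assume \<phi>: "test_function 0 (real N + 1) \<phi>"
    have "\<phi> 0 = 0" "\<phi> (real N + 1) = 0" using test_function_eq_0[OF \<phi>] by auto
    then show "pairing (deriv \<phi>) (block_op N B u) = - pairing \<phi> (block_op N B v)"
      using ibp[OF test_function_deriv[OF \<phi>] test_function_continuous[OF test_function_deriv_test[OF \<phi>]]] jump
      by simp
  qed
  have *: "pairing \<phi>' (block_op N B u) = \<phi> (real N + 1) *\<^sub>R block_row N B (x \<circ> Suc) N
      - \<phi> 0 *\<^sub>R block_row N B x 0 - pairing \<phi> (block_op N B v)"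
    if "\<And>x. (\<phi> has_field_derivative \<phi>' x) (at x)" "continuous_on UNIV \<phi>'" for \<phi> \<phi>'
    using ibp[OF that] jump by simp
  show "ae_value 0 (real N + 1) (block_op N B u) 0 = block_row N B x 0"
    by (rule ae_value_eqI(1)[OF _ D' *]) simp_all
  show "ae_value 0 (real N + 1) (block_op N B u) (real N + 1) = block_row N B (x \<circ> Suc) N"
    by (rule ae_value_eqI(2)[OF _ D' *]) simp_all
qed

text \<open>An L_2 function carries no point mass: the bumps are bounded by 1 and shrink to
  \<open>x\<close>, so dominated convergence applies off the null set \<open>{x}\<close>.\<close>

lemma pairing_bump_tendsto_0:
  assumes q: "q \<in> L2 a b"
  shows "(\<lambda>n. pairing (bump (x - 1 / real (Suc n)) (x + 1 / real (Suc n)) (real (Suc n))) q) \<longlonglongrightarrow> 0"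
proof -
  let ?\<phi> = "\<lambda>n. bump (x - 1 / real (Suc n)) (x + 1 / real (Suc n)) (real (Suc n))"
  obtain f where f: "L2_rep a b f q" using q L2_obtain by blast
  note [measurable] = L2_repD(1)[OF f]
  have test: "test_function (x - 2) (x + 2) (?\<phi> n)" for n
    by (rule test_function_bump) (auto simp: field_simps)
  have "(\<lambda>n. LINT t|lborel. ?\<phi> n t *\<^sub>R f t) \<longlonglongrightarrow> integral\<^sup>L lborel (\<lambda>t :: real. 0)"
  proof (rule integral_dominated_convergence[where w = "\<lambda>t. norm (f t)" and f = "\<lambda>_. 0"
        and s = "\<lambda>n t. ?\<phi> n t *\<^sub>R f t"])
    show "(\<lambda>t. ?\<phi> n t *\<^sub>R f t) \<in> borel_measurable lborel" for n
      using test_function_borel[OF test[of n]] by (intro borel_measurable_scaleR) auto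
    show "AE t in lborel. (\<lambda>n. ?\<phi> n t *\<^sub>R f t) \<longlonglongrightarrow> 0"
      using AE_lborel_singleton[of x]
    proof eventually_elim
      case (elim t)
      then have "\<bar>t - x\<bar> > 0" by simp
      then have "eventually (\<lambda>n. 1 / real (Suc n) < \<bar>t - x\<bar>) sequentially"
        using order_tendstoD(2)[OF LIMSEQ_inverse_real_of_nat] unfolding inverse_eq_divide by blast
      then have "eventually (\<lambda>n. ?\<phi> n t *\<^sub>R f t = 0) sequentially"
      proof eventually_elim
        case (elim n)
        then have "t \<notin> {x - 1 / real (Suc n)..x + 1 / real (Suc n)}" by auto
        then show ?case by (simp add: bump_eq_0 del: of_nat_Suc)
      qed
      then show ?case by (rule tendsto_eventually)
    qed
    show "AE t in lborel. norm (?\<phi> n t *\<^sub>R f t) \<le> norm (f t)" for n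
      using bump_bounds by (intro AE_I2) (simp add: mult_left_le_one_le)
  qed (use L2_rep_integrable[OF f] in auto)
  then show ?thesis
    by (simp add: pairing_rep[OF f test_function_continuous[OF test]] del: of_nat_Suc)
qed

text \<open>If the derivative is an L_2 function \<open>y\<close>, then
  \<open>block_op N B v - y\<close> acts like the point masses. Bumps around i+1 isolate one mass
  with a factor independent of n, yet the pairings tend to zero.\<close>

lemma block_op_D1_jump:
  assumes D: "D1 0 (real N + 1) u v" and D': "D1 0 (real N + 1) (block_op N B u) y" and "i < N"
  shows "block_jump N B (\<lambda>k. ae_value 0 (real N + 1) u (real k)) i = 0"
proof -
  let ?x = "\<lambda>k. ae_value 0 (real N + 1) u (real k)"
  let ?\<phi> = "\<lambda>n. bump (real (Suc i) - 1 / real (Suc n)) (real (Suc i) + 1 / real (Suc n)) (real (Suc n))"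
  note ibp = block_op_integration_by_parts[OF D, of _ _ B]
  define q where "q = block_op N B v - y"
  have L: "block_op N B v \<in> L2 0 (real N + 1)" "y \<in> L2 0 (real N + 1)"
    using D D' by (auto simp: D1_def intro: block_op_L2)
  have q: "q \<in> L2 0 (real N + 1)" unfolding q_def by (intro L2_diff L)
  \<comment> \<open>For n \<ge> 1 the half width 1/(n+1) is below 1, so the bump vanishes at all
    other integers. Half width times steepness is 1, whence the height
    \<open>flat 1 1 * flat 1 1\<close> at the centre.\<close>
  have "pairing (?\<phi> n) q = (flat 1 1 * flat 1 1) *\<^sub>R block_jump N B ?x i" if n: "n \<ge> 1" for n
  proof -
    have n1: "1 / real (Suc n) < 1" "0 < 1 / real (Suc n)" using n by auto
    have \<phi>: "test_function 0 (real N + 1) (?\<phi> n)"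
    proof (rule test_function_bump)
      have "1 \<le> real (Suc i)" "real (Suc i) \<le> real N" using \<open>i < N\<close> by auto
      with n1 show "0 < real (Suc i) - 1 / real (Suc n)" "real (Suc i) + 1 / real (Suc n) < real N + 1"
        by linarith+
    qed simp
    have at: "?\<phi> n (real (Suc i)) = flat 1 1 * flat 1 1"
      by (simp add: bump_def)
    have off: "?\<phi> n (real (Suc j)) = 0" if "j \<noteq> i" for j
    proof (rule bump_eq_0)
      have "real j + 1 \<le> real i \<or> real i + 1 \<le> real j" using that by linarith
      with n1 show "real (Suc j) \<notin> {real (Suc i) - 1 / real (Suc n)..real (Suc i) + 1 / real (Suc n)}"
        unfolding of_nat_Suc atLeastAtMost_iff by linarith
    qed simp
    have "?\<phi> n 0 = 0" "?\<phi> n (real N + 1) = 0" using test_function_eq_0[OF \<phi>] by auto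
    moreover have "(\<Sum>j<N. ?\<phi> n (real (Suc j)) *\<^sub>R block_jump N B ?x j) =
        (\<Sum>j<N. if j = i then (flat 1 1 * flat 1 1) *\<^sub>R block_jump N B ?x i else 0)"
      by (intro sum.cong) (use at off in \<open>auto simp del: of_nat_Suc\<close>)
    ultimately have "pairing (deriv (?\<phi> n)) (block_op N B u) =
        (flat 1 1 * flat 1 1) *\<^sub>R block_jump N B ?x i - pairing (?\<phi> n) (block_op N B v)"
      using ibp[OF test_function_deriv[OF \<phi>] test_function_continuous[OF test_function_deriv_test[OF \<phi>]]] \<open>i < N\<close>
      by simp
    moreover have "pairing (deriv (?\<phi> n)) (block_op N B u) = - pairing (?\<phi> n) y"
      using D' \<phi> by (simp add: D1_def)
    ultimately show ?thesis
      unfolding q_def pairing_diff[OF test_function_continuous[OF \<phi>] L] by (simp add: algebra_simps)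
  qed
  then have "(\<lambda>n. pairing (?\<phi> n) q) \<longlonglongrightarrow> (flat 1 1 * flat 1 1) *\<^sub>R block_jump N B ?x i"
    by (intro tendsto_eventually) (auto simp: eventually_sequentially)
  with pairing_bump_tendsto_0[OF q, of "real (Suc i)"]
  have "(flat 1 1 * flat 1 1) *\<^sub>R block_jump N B ?x i = 0"
    using LIMSEQ_unique by blast
  then show ?thesis by (simp add: flat_def)
qed

text \<open>Traces are available for derivatives of order below m, hence the strict bound. Both
  claims go through one induction: if order 0 has no jumps, the derivative passes through
  \<open>B\<close> and the hypothesis applies to the derivative of \<open>u\<close>.\<close>

lemma block_op_sobolev:
  assumes "u \<in> sobolev 0 (real N + 1) m"
  shows "block_op N B u \<in> sobolev 0 (real N + 1) m \<longleftrightarrow>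
      (\<forall>\<mu><m. \<forall>i<N. block_jump N B (\<lambda>k. ae_value 0 (real N + 1) (weak_deriv 0 (real N + 1) \<mu> u) (real k)) i = 0)"
    (is "_ \<longleftrightarrow> ?J m u")
    and "block_op N B u \<in> sobolev 0 (real N + 1) m \<Longrightarrow> \<mu> \<le> m \<Longrightarrow>
      weak_deriv 0 (real N + 1) \<mu> (block_op N B u) = block_op N B (weak_deriv 0 (real N + 1) \<mu> u)"
proof -
  have "(block_op N B u \<in> sobolev 0 (real N + 1) m \<longleftrightarrow> ?J m u) \<and>
      (block_op N B u \<in> sobolev 0 (real N + 1) m \<longrightarrow> (\<forall>\<mu>\<le>m.
        weak_deriv 0 (real N + 1) \<mu> (block_op N B u) = block_op N B (weak_deriv 0 (real N + 1) \<mu> u)))"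
    using assms
  proof (induction m arbitrary: u)
    case 0
    then show ?case by (simp add: sobolev_0 block_op_L2 weak_deriv_0[of _ 0 "real N + 1"])
  next
    case (Suc m)
    then obtain v where v: "D1 0 (real N + 1) u v" "v \<in> sobolev 0 (real N + 1) m"
      using sobolev_Suc_iff by blast
    have u0: "weak_deriv 0 (real N + 1) 0 u = u" using v by (simp add: D1_def weak_deriv_0)
    have J: "?J (Suc m) u \<longleftrightarrow>
        (\<forall>i<N. block_jump N B (\<lambda>k. ae_value 0 (real N + 1) u (real k)) i = 0) \<and> ?J m v"
      unfolding All_less_Suc2 using weak_deriv_Suc[OF v] by (simp add: u0)
    have eq: "block_op N B u \<in> sobolev 0 (real N + 1) (Suc m) \<longleftrightarrow> ?J (Suc m) u"
    proof
      assume "block_op N B u \<in> sobolev 0 (real N + 1) (Suc m)"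
      then obtain y where y: "D1 0 (real N + 1) (block_op N B u) y" "y \<in> sobolev 0 (real N + 1) m"
        using sobolev_Suc_iff by blast
      have jump: "\<forall>i<N. block_jump N B (\<lambda>k. ae_value 0 (real N + 1) u (real k)) i = 0"
        using block_op_D1_jump[OF v(1) y(1)] by blast
      then have "y = block_op N B v"
        using block_op_D1(1)[OF v(1)] D1_unique[OF y(1)] by blast
      with y(2) have "?J m v" using Suc.IH[OF v(2)] by simp
      with jump J show "?J (Suc m) u" by blast
    next
      assume "?J (Suc m) u"
      with J have jump: "\<forall>i<N. block_jump N B (\<lambda>k. ae_value 0 (real N + 1) u (real k)) i = 0" and "?J m v"
        by blast+
      then have "D1 0 (real N + 1) (block_op N B u) (block_op N B v)" "block_op N B v \<in> sobolev 0 (real N + 1) m"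
        using block_op_D1(1)[OF v(1)] Suc.IH[OF v(2)] by blast+
      then show "block_op N B u \<in> sobolev 0 (real N + 1) (Suc m)"
        using sobolev_Suc_iff by blast
    qed
    moreover have "weak_deriv 0 (real N + 1) \<mu> (block_op N B u) = block_op N B (weak_deriv 0 (real N + 1) \<mu> u)"
      if B: "block_op N B u \<in> sobolev 0 (real N + 1) (Suc m)" and "\<mu> \<le> Suc m" for \<mu>
    proof (cases \<mu>)
      case 0
      then show ?thesis using B u0 weak_deriv_0[OF sobolev_L2[OF B]] by simp
    next
      case (Suc \<nu>)
      from B eq J have jump: "\<forall>i<N. block_jump N B (\<lambda>k. ae_value 0 (real N + 1) u (real k)) i = 0" and "?J m v"
        by blast+
      then have D: "D1 0 (real N + 1) (block_op N B u) (block_op N B v)" "block_op N B v \<in> sobolev 0 (real N + 1) m"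
        using block_op_D1(1)[OF v(1)] Suc.IH[OF v(2)] by blast+
      then show ?thesis
        using weak_deriv_Suc[OF v, of \<nu>] weak_deriv_Suc[OF D, of \<nu>] Suc.IH[OF v(2)] that Suc by simp
    qed
    ultimately show ?case by blast
  qed
  then show "block_op N B u \<in> sobolev 0 (real N + 1) m \<longleftrightarrow> ?J m u"
    "block_op N B u \<in> sobolev 0 (real N + 1) m \<Longrightarrow> \<mu> \<le> m \<Longrightarrow>
      weak_deriv 0 (real N + 1) \<mu> (block_op N B u) = block_op N B (weak_deriv 0 (real N + 1) \<mu> u)"
    by blast+
qed

text \<open>Over the i-th unit interval a shift by j reads the piece with number k = i + j, so the
  coefficient of that shift becomes the entry at (i,k). Shifts that leave (0,N+1) read the zero
  extension.\<close>

lemma diff_op_Q_eq_block_op: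
  assumes u: "u \<in> L2 0 (real N + 1)"
  shows "diff_op_Q N b u = block_op N (\<lambda>i k. b (int k - int i)) u"
proof -
  let ?t = "\<lambda>i j. restr (real i) (real i + 1) (translate (of_int j) u)"
  have "diff_op_Q N b u = (\<Sum>i\<le>N. \<Sum>j\<in>{- int N..int N}. ae_smult (of_real (b j)) (?t i j))"
    unfolding diff_op_Q_def diff_op_def restr_sum restr_smult restr_split ae.scale_sum_right
    by (rule sum.swap)
  also have "\<dots> = (\<Sum>i\<le>N. \<Sum>k\<le>N. ae_smult (of_real (b (int k - int i))) (block_piece i k u))"
  proof (rule sum.cong[OF refl])
    fix i assume "i \<in> {..N}"
    have vanish: "?t i j = 0" if "j \<notin> (\<lambda>k. int k - int i) ` {..N}" for j
    proof -
      have "i + j < 0 \<or> i + j > int N"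
      proof (rule ccontr)
        assume "\<not> ?thesis"
        then have "j = int (nat (i + j)) - int i" "nat (i + j) \<le> N" by auto
        with that show False by (metis atMost_iff image_eqI)
      qed
      then have "real i + j + 1 \<le> 0 \<or> real i + of_int j \<ge> real N + 1" by linarith
      then have "restr (real i + of_int j) (real i + 1 + of_int j) (restr 0 (real N + 1) u) = 0"
        unfolding restr_restr by (intro restr_empty) auto
      then show ?thesis using u by (simp add: translate_restr L2_def translate_zero)
    qed
    have "(\<Sum>j\<in>{- int N..int N}. ae_smult (of_real (b j)) (?t i j)) =
        (\<Sum>j\<in>(\<lambda>k. int k - int i) ` {..N}. ae_smult (of_real (b j)) (?t i j))"
      using \<open>i \<in> {..N}\<close> by (intro sum.mono_neutral_right) (auto simp: vanish)
    also have "\<dots> = (\<Sum>k\<le>N. ae_smult (of_real (b (int k - int i))) (?t i (int k - int i)))"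
      by (subst sum.reindex) (auto simp: inj_on_def)
    also have "\<dots> = (\<Sum>k\<le>N. ae_smult (of_real (b (int k - int i))) (block_piece i k u))"
      by (simp add: block_piece_def translate_restr algebra_simps)
    finally show "(\<Sum>j\<in>{- int N..int N}. ae_smult (of_real (b j)) (?t i j)) =
      (\<Sum>k\<le>N. ae_smult (of_real (b (int k - int i))) (block_piece i k u))" .
  qed
  finally show ?thesis by (simp add: block_op_def)
qed

section \<open>Codimension\<close>

context linear_space
begin

lemma linear_operator_on_image:
  assumes "linear_operator_on D T" shows "subspace (T ` D)"
proof -
  have D: "subspace D" and add: "\<And>u v. u \<in> D \<Longrightarrow> v \<in> D \<Longrightarrow> T (u + v) = T u + T v"
    and scale: "\<And>c u. u \<in> D \<Longrightarrow> T (c *s u) = c *s T u"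
    using assms by (auto simp: linear_operator_on_def)
  have "T 0 = 0" using scale[OF subspace_0[OF D], of 0] by simp
  then have "0 \<in> T ` D" using imageI[OF subspace_0[OF D], of T] by simp
  moreover have "x + y \<in> T ` D" if "x \<in> T ` D" "y \<in> T ` D" for x y
    using that subspace_add[OF D] by (auto simp: add[symmetric])
  moreover have "c *s x \<in> T ` D" if "x \<in> T ` D" for c x
    using that subspace_scale[OF D] by (auto simp: scale[symmetric])
  ultimately show ?thesis
    unfolding subspace_def by blast
qed

lemma quotient_basisD:
  assumes "quotient_basis V S B" "v \<in> V"
  obtains c where "\<And>b. b \<notin> B \<Longrightarrow> c b = 0" "v - (\<Sum>b\<in>B. c b *s b) \<in> S"
  using assms unfolding quotient_basis_def by blast

lemma quotient_basis_indep:
  assumes B: "quotient_basis V S B" and "subspace V" "subspace S" and c: "(\<Sum>b\<in>B. c b *s b) \<in> S" and "b \<in> B"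
  shows "c b = 0"
proof -
  let ?c = "\<lambda>b. if b \<in> B then c b else 0"
  \<comment> \<open>Uniqueness of coordinates is applied to the vector 0, which is represented
    modulo \<open>S\<close> both by \<open>c\<close> and by the zero family.\<close>
  have "\<exists>!c. (\<forall>b. b \<notin> B \<longrightarrow> c b = 0) \<and> 0 - (\<Sum>b\<in>B. c b *s b) \<in> S"
    using B subspace_0[OF \<open>subspace V\<close>] unfolding quotient_basis_def by blast
  moreover have "(\<Sum>b\<in>B. ?c b *s b) = (\<Sum>b\<in>B. c b *s b)"
    by (intro sum.cong) auto
  then have "0 - (\<Sum>b\<in>B. ?c b *s b) \<in> S"
    using subspace_neg[OF \<open>subspace S\<close> c] by simp
  moreover have "0 - (\<Sum>b\<in>B. 0 *s b) \<in> S"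
    using subspace_0[OF \<open>subspace S\<close>] by simp
  ultimately have "?c = (\<lambda>_. 0)"
    by (auto simp del: if_weak_cong)
  then show ?thesis using \<open>b \<in> B\<close> by (metis (full_types))
qed

lemma quotient_basisI:
  assumes "finite B" "B \<subseteq> V" "subspace S"
    and gen: "\<And>v. v \<in> V \<Longrightarrow> \<exists>c. v - (\<Sum>b\<in>B. c b *s b) \<in> S"
    and indep: "\<And>c b. (\<Sum>b\<in>B. c b *s b) \<in> S \<Longrightarrow> b \<in> B \<Longrightarrow> c b = 0"
  shows "quotient_basis V S B"
  unfolding quotient_basis_def
proof (intro conjI ballI assms(1,2))
  fix v assume "v \<in> V"
  then obtain c where c: "v - (\<Sum>b\<in>B. c b *s b) \<in> S" using gen by blast
  let ?c = "\<lambda>b. if b \<in> B then c b else 0"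
  have eq: "(\<Sum>b\<in>B. ?c b *s b) = (\<Sum>b\<in>B. c b *s b)"
    by (intro sum.cong) auto
  show "\<exists>!c. (\<forall>b. b \<notin> B \<longrightarrow> c b = 0) \<and> v - (\<Sum>b\<in>B. c b *s b) \<in> S"
  proof (rule ex1I[of _ ?c])
    show "(\<forall>b. b \<notin> B \<longrightarrow> ?c b = 0) \<and> v - (\<Sum>b\<in>B. ?c b *s b) \<in> S"
      using c eq by simp
  next
    fix c' assume c': "(\<forall>b. b \<notin> B \<longrightarrow> c' b = 0) \<and> v - (\<Sum>b\<in>B. c' b *s b) \<in> S"
    have "(v - (\<Sum>b\<in>B. c b *s b)) - (v - (\<Sum>b\<in>B. c' b *s b)) \<in> S"
      using c c' subspace_diff[OF \<open>subspace S\<close>] by blast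
    then have "(\<Sum>b\<in>B. (c' b - c b) *s b) \<in> S"
      by (simp add: scale_left_diff_distrib sum_subtractf)
    then have "c' b = c b" if "b \<in> B" for b
      using indep[of "\<lambda>b. c' b - c b"] that by auto
    with c' show "c' = ?c" by (auto simp: fun_eq_iff)
  qed
qed

text \<open>Expand B' in terms of B modulo \<open>S\<close>. The expansions \<open>p b'\<close> are
  true vectors of \<open>span B\<close>, and a relation among them is a relation among the b' modulo
  \<open>S\<close>; hence they are independent and no more numerous than B.\<close>

lemma quotient_basis_card_le:
  assumes B: "quotient_basis V S B" and B': "quotient_basis V S B'" and V: "subspace V" and S: "subspace S"
  shows "card B' \<le> card B"
proof -
  have fin: "finite B" "finite B'" "B' \<subseteq> V" using B B' by (auto simp: quotient_basis_def)
  have "\<forall>b'\<in>B'. \<exists>c. b' - (\<Sum>b\<in>B. c b *s b) \<in> S"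
    using fin(3) quotient_basisD[OF B] by (metis subsetD)
  then obtain c where c: "\<And>b'. b' \<in> B' \<Longrightarrow> b' - (\<Sum>b\<in>B. c b' b *s b) \<in> S"
    by metis
  define p where "p b' = (\<Sum>b\<in>B. c b' b *s b)" for b'
  have indep: "a b = 0" if "(\<Sum>b'\<in>B'. a b' *s p b') = 0" "b \<in> B'" for a b
  proof -
    have "(\<Sum>b'\<in>B'. a b' *s (b' - p b')) \<in> S"
      using c p_def by (intro subspace_sum[OF S] subspace_scale[OF S]) auto
    then have "(\<Sum>b'\<in>B'. a b' *s b') \<in> S"
      using that(1) by (simp add: scale_right_diff_distrib sum_subtractf)
    then show ?thesis using quotient_basis_indep[OF B' V S] that(2) by blast
  qed
  have inj: "inj_on p B'"
  proof (rule inj_onI, rule ccontr)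
    fix x y assume xy: "x \<in> B'" "y \<in> B'" "p x = p y" "x \<noteq> y"
    let ?a = "\<lambda>b. if b = x then 1 else if b = y then - 1 else 0"
    have "(\<Sum>b'\<in>B'. ?a b' *s p b') = (\<Sum>b'\<in>{x, y}. ?a b' *s p b')"
      using xy fin by (intro sum.mono_neutral_right) auto
    also have "\<dots> = 0" using xy by simp
    finally show False using indep[of ?a x] xy by simp
  qed
  have "independent (p ` B')"
  proof (rule independent_if_scalars_zero)
    show "finite (p ` B')" using fin by simp
    fix f x assume "(\<Sum>x\<in>p ` B'. f x *s x) = 0" "x \<in> p ` B'"
    then show "f x = 0"
      using indep[of "f \<circ> p"] by (auto simp: sum.reindex[OF inj])
  qed
  moreover have "p ` B' \<subseteq> span B"
    unfolding p_def by (intro image_subsetI span_sum span_scale span_base)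
  ultimately have "card (p ` B') \<le> card B"
    using independent_span_bound[OF fin(1)] by blast
  then show ?thesis by (simp add: card_image[OF inj])
qed

lemma codim_eq:
  assumes "quotient_basis V S B" "subspace V" "subspace S"
  shows "codim V S = card B"
  unfolding codim_def
  using assms quotient_basis_card_le by (intro the_equality) (blast intro: le_antisym)+

text \<open>The dual family certifies that the functionals are independent and is itself the
  quotient basis: v minus the sum of all (h i v) e i lies in the common kernel.\<close>

lemma quotient_basis_kernel:
  assumes V: "subspace V" and "finite I"
    and add: "\<And>i u v. i \<in> I \<Longrightarrow> u \<in> V \<Longrightarrow> v \<in> V \<Longrightarrow> h i (u + v) = h i u + h i v"
    and scale: "\<And>i c u. i \<in> I \<Longrightarrow> u \<in> V \<Longrightarrow> h i (c *s u) = c * h i u"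
    and dual: "\<And>i. i \<in> I \<Longrightarrow> e i \<in> V" "\<And>i j. i \<in> I \<Longrightarrow> j \<in> I \<Longrightarrow> h i (e j) = (if i = j then 1 else 0)"
    and S: "S = {v \<in> V. \<forall>i\<in>I. h i v = 0}"
  shows "\<exists>B. quotient_basis V S B \<and> card B = card I"
proof -
  have zero: "h i 0 = 0" if "i \<in> I" for i
    using scale[OF that subspace_0[OF V], of 0] by simp
  have subS: "subspace S"
    unfolding S subspace_def using add scale zero V by (auto simp: subspace_def)
  have sum: "h i (\<Sum>j\<in>J. c j *s e j) = (\<Sum>j\<in>J. c j * h i (e j))" if "i \<in> I" "J \<subseteq> I" for i J c
    using finite_subset[OF that(2) \<open>finite I\<close>] that(2)
  proof (induction J rule: finite_induct)
    case (insert j J)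
    then show ?case
      using that(1) by (simp add: add scale dual(1) subspace_scale[OF V] subspace_sum[OF V] subset_iff)
  qed (simp add: zero that)
  have inj: "inj_on e I"
    using dual(2) by (auto intro!: inj_onI) (metis one_neq_zero)
  have coord: "h i (\<Sum>b\<in>e ` I. c b *s b) = c (e i)" if "i \<in> I" for i c
    using that \<open>finite I\<close> by (simp add: sum.reindex[OF inj] sum dual(2) if_distrib[of "(*) _"] cong: if_cong)
  have sumV: "(\<Sum>b\<in>e ` I. c b *s b) \<in> V" for c
    using dual(1) by (intro subspace_sum[OF V] subspace_scale[OF V]) auto
  have "quotient_basis V S (e ` I)"
  proof (rule quotient_basisI[OF _ _ subS])
    show "finite (e ` I)" "e ` I \<subseteq> V" using \<open>finite I\<close> dual(1) by auto
    fix v assume v: "v \<in> V"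
    define c where "c b = h (the_inv_into I e b) v" for b
    have "h i (v - (\<Sum>b\<in>e ` I. c b *s b)) = 0" if "i \<in> I" for i
    proof -
      let ?s = "\<Sum>b\<in>e ` I. c b *s b"
      have "h i (v + (- 1) *s ?s) = h i v + (- 1) * h i ?s"
        using v sumV[of c] that subspace_scale[OF V] by (simp only: add scale)
      then show ?thesis
        using coord[OF that, of c] that by (simp add: c_def the_inv_into_f_f[OF inj])
    qed
    then show "\<exists>c. v - (\<Sum>b\<in>e ` I. c b *s b) \<in> S"
      using v sumV subspace_diff[OF V] unfolding S by blast
  next
    fix c b assume "(\<Sum>b\<in>e ` I. c b *s b) \<in> S" "b \<in> e ` I"
    then show "c b = 0" using coord unfolding S by auto
  qed
  then show ?thesis using card_image[OF inj] by blast
qed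

text \<open>Steinitz exchange modulo \<open>S\<close>. Only finitely many sets lie between P and P
  \<union> B, so there is a maximal one that is independent modulo \<open>S\<close>, and maximality
  makes it generate.\<close>

lemma quotient_basis_extend:
  assumes B: "quotient_basis V S B" and V: "subspace V" and S: "subspace S" "S \<subseteq> V"
    and P: "finite P" "P \<subseteq> V" and indep: "\<And>c b. (\<Sum>b\<in>P. c b *s b) \<in> S \<Longrightarrow> b \<in> P \<Longrightarrow> c b = 0"
  obtains B' where "P \<subseteq> B'" "quotient_basis V S B'"
proof -
  have "finite B" "B \<subseteq> V" using B by (auto simp: quotient_basis_def)
  define \<A> where "\<A> = {A. P \<subseteq> A \<and> A \<subseteq> P \<union> B \<and> (\<forall>c. (\<Sum>b\<in>A. c b *s b) \<in> S \<longrightarrow> (\<forall>b\<in>A. c b = 0))}"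
  have finA: "finite \<A>"
    by (rule finite_subset[of _ "Pow (P \<union> B)"]) (use P \<open>finite B\<close> in \<open>auto simp: \<A>_def\<close>)
  have "P \<in> \<A>" using indep by (auto simp: \<A>_def)
  with finA obtain A where A: "A \<in> \<A>" and max: "\<And>A'. A' \<in> \<A> \<Longrightarrow> A \<subseteq> A' \<Longrightarrow> A' = A"
    using finite_has_maximal[of \<A>] by blast
  have "finite A" "A \<subseteq> V" "P \<subseteq> A"
    using A P \<open>finite B\<close> \<open>B \<subseteq> V\<close> by (auto simp: \<A>_def intro: finite_subset)
  have Aindep: "c b = 0" if "(\<Sum>b\<in>A. c b *s b) \<in> S" "b \<in> A" for c b
    using A that by (auto simp: \<A>_def)
  define W where "W = {v. \<exists>c. v - (\<Sum>b\<in>A. c b *s b) \<in> S}"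
  have subW: "subspace W"
    unfolding subspace_def
  proof (intro conjI ballI allI)
    show "0 \<in> W" unfolding W_def using subspace_0[OF S(1)] by (auto intro: exI[of _ "\<lambda>_. 0"])
  next
    fix x y assume "x \<in> W" "y \<in> W"
    then obtain c d where "x - (\<Sum>b\<in>A. c b *s b) \<in> S" "y - (\<Sum>b\<in>A. d b *s b) \<in> S"
      by (auto simp: W_def)
    from subspace_add[OF S(1) this] show "x + y \<in> W"
      unfolding W_def by (auto intro!: exI[of _ "\<lambda>b. c b + d b"] simp: scale_left_distrib sum.distrib algebra_simps)
  next
    fix r x assume "x \<in> W"
    then obtain c where "x - (\<Sum>b\<in>A. c b *s b) \<in> S" by (auto simp: W_def)
    from subspace_scale[OF S(1) this, of r] show "r *s x \<in> W"
      unfolding W_def by (auto intro!: exI[of _ "\<lambda>b. r * c b"] simp: scale_right_diff_distrib scale_sum_right)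
  qed
  \<comment> \<open>Otherwise x could be added to \<open>A\<close>: a relation with nonzero
    coefficient at x could be divided by it and would place x in \<open>W\<close>.\<close>
  have BW: "x \<in> W" if "x \<in> B" for x
  proof (rule ccontr)
    assume "x \<notin> W"
    have "x \<in> W" if "x \<in> A"
    proof -
      have "(\<Sum>b\<in>A. (if b = x then 1 else 0) *s b) = (\<Sum>b\<in>A. if b = x then b else 0)"
        by (intro sum.cong) auto
      then have "x - (\<Sum>b\<in>A. (if b = x then 1 else 0) *s b) \<in> S"
        using that \<open>finite A\<close> subspace_0[OF S(1)] by simp
      then show ?thesis
        unfolding W_def by (intro CollectI exI[of _ "\<lambda>b. if b = x then 1 else 0"])
    qed
    with \<open>x \<notin> W\<close> have "x \<notin> A" by blast
    have "insert x A \<in> \<A>"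
    proof -
      have "\<forall>b\<in>insert x A. c b = 0" if c: "(\<Sum>b\<in>insert x A. c b *s b) \<in> S" for c
      proof -
        have s: "c x *s x + (\<Sum>b\<in>A. c b *s b) \<in> S"
          using c \<open>x \<notin> A\<close> \<open>finite A\<close> by simp
        have "c x = 0"
        proof (rule ccontr)
          assume "c x \<noteq> 0"
          have "inverse (c x) *s (c x *s x + (\<Sum>b\<in>A. c b *s b)) \<in> S"
            by (rule subspace_scale[OF S(1) s])
          then have "x - (\<Sum>b\<in>A. (- inverse (c x) * c b) *s b) \<in> S"
            using \<open>c x \<noteq> 0\<close> by (simp add: scale_right_distrib scale_sum_right sum_negf)
          then have "x \<in> W" unfolding W_def by (auto intro!: exI[of _ "\<lambda>b. - inverse (c x) * c b"])
          with \<open>x \<notin> W\<close> show False by blast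
        qed
        with s Aindep[of c] show ?thesis by auto
      qed
      with A \<open>x \<in> B\<close> show ?thesis by (auto simp: \<A>_def)
    qed
    from max[OF this] \<open>x \<notin> A\<close> show False by blast
  qed
  have SW: "S \<subseteq> W" unfolding W_def by (auto intro!: exI[of _ "\<lambda>_. 0"])
  have "V \<subseteq> W"
  proof
    fix v assume "v \<in> V"
    then obtain c where c: "v - (\<Sum>b\<in>B. c b *s b) \<in> S" using quotient_basisD[OF B] by metis
    have "(\<Sum>b\<in>B. c b *s b) \<in> W" using BW by (intro subspace_sum[OF subW] subspace_scale[OF subW])
    from subspace_add[OF subW this] c SW have "(\<Sum>b\<in>B. c b *s b) + (v - (\<Sum>b\<in>B. c b *s b)) \<in> W" by blast
    then show "v \<in> W" by simp
  qed
  then have "quotient_basis V S A"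
    using Aindep by (intro quotient_basisI \<open>finite A\<close> \<open>A \<subseteq> V\<close> S(1)) (auto simp: W_def)
  with \<open>P \<subseteq> A\<close> show ?thesis by (rule that)
qed

text \<open>P spans the kernel of \<open>T\<close> and stays independent modulo \<open>S\<close>, so
  it can be completed to a quotient basis. \<open>T\<close> kills P and carries the other elements
  to a quotient basis of the images; the codimension drops by the dimension of the kernel.\<close>

lemma quotient_basis_image:
  assumes B: "quotient_basis V S B" and V: "subspace V" and S: "subspace S" "S \<subseteq> V"
    and add: "\<And>u v. u \<in> V \<Longrightarrow> v \<in> V \<Longrightarrow> T (u + v) = T u + T v"
    and scale: "\<And>c u. u \<in> V \<Longrightarrow> T (c *s u) = c *s T u"
    and P: "finite P" "P \<subseteq> V"
    and indep: "\<And>c b. (\<Sum>b\<in>P. c b *s b) \<in> S \<Longrightarrow> b \<in> P \<Longrightarrow> c b = 0"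
    and ker: "\<And>p. p \<in> P \<Longrightarrow> T p = 0" "\<And>v. v \<in> V \<Longrightarrow> T v = 0 \<Longrightarrow> \<exists>c. v = (\<Sum>b\<in>P. c b *s b)"
  shows "\<exists>B'. quotient_basis (T ` V) (T ` S) B' \<and> card B' = card B - card P"
proof -
  obtain A where A: "P \<subseteq> A" "quotient_basis V S A"
  proof (rule quotient_basis_extend[OF B V S P])
    show "c b = 0" if "(\<Sum>b\<in>P. c b *s b) \<in> S" "b \<in> P" for c b
      using indep[OF that] .
  qed (rule that)
  have finA: "finite A" "A \<subseteq> V" using A(2) by (auto simp: quotient_basis_def)
  have card: "card A = card B"
    using quotient_basis_card_le[OF A(2) B V S(1)] quotient_basis_card_le[OF B A(2) V S(1)] by simp
  have diff: "T (u - v) = T u - T v" if "u \<in> V" "v \<in> V" for u v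
    using add[of u "(- 1) *s v"] scale[of v "- 1"] that subspace_neg[OF V] by simp
  have zero: "T 0 = 0" using scale[OF subspace_0[OF V], of 0] by simp
  have sum: "T (\<Sum>b\<in>J. c b *s b) = (\<Sum>b\<in>J. c b *s T b)" if "J \<subseteq> A" for J c
    using finite_subset[OF that finA(1)] that
  proof (induction J rule: finite_induct)
    case (insert j J)
    with finA have "c j *s j \<in> V" "(\<Sum>b\<in>J. c b *s b) \<in> V" "j \<in> V"
      by (auto intro!: subspace_scale[OF V] subspace_sum[OF V])
    with insert show ?case by (simp add: add scale)
  qed (simp add: zero)
  let ?D = "A - P"
  have sumD: "T (\<Sum>b\<in>A. c b *s b) = (\<Sum>b\<in>?D. c b *s T b)" for c
    unfolding sum[OF subset_refl]
    using finA(1) ker(1) by (intro sum.mono_neutral_right) auto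
  have indepD: "c b = 0" if c: "(\<Sum>b\<in>?D. c b *s T b) \<in> T ` S" and b: "b \<in> ?D" for c b
  proof -
    obtain s where s: "s \<in> S" "(\<Sum>b\<in>?D. c b *s T b) = T s" using c by blast
    let ?v = "(\<Sum>b\<in>?D. c b *s b)"
    have "?v \<in> V" using finA by (auto intro!: subspace_scale[OF V] subspace_sum[OF V])
    with s S(2) have "T (?v - s) = 0"
      by (subst diff) (auto simp: sum)
    then obtain d where d: "?v - s = (\<Sum>b\<in>P. d b *s b)"
      using ker(2)[OF subspace_diff[OF V \<open>?v \<in> V\<close>]] s S(2) by blast
    \<comment> \<open>Correcting by the kernel part turns a relation between the images into one
      modulo \<open>S\<close> over the whole quotient basis \<open>A\<close>, where coefficients
      must vanish.\<close>
    let ?c = "\<lambda>b. if b \<in> P then - d b else c b"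
    have "(\<Sum>b\<in>A. ?c b *s b) = (\<Sum>b\<in>P. ?c b *s b) + (\<Sum>b\<in>?D. ?c b *s b)"
      by (rule trans[OF sum.subset_diff[OF A(1) finA(1)] add.commute])
    also have "(\<Sum>b\<in>P. ?c b *s b) = - (\<Sum>b\<in>P. d b *s b)"
      by (simp add: sum_negf)
    also have "(\<Sum>b\<in>?D. ?c b *s b) = ?v"
      by (intro sum.cong) auto
    also have "- (\<Sum>b\<in>P. d b *s b) + ?v = s"
      unfolding d[symmetric] by simp
    finally have "(\<Sum>b\<in>A. ?c b *s b) \<in> S"
      using s(1) by simp
    from quotient_basis_indep[OF A(2) V S(1) this, of b] b show ?thesis by auto
  qed
  have subTS: "subspace (T ` S)"
    by (rule linear_operator_on_image) (use S add scale in \<open>auto simp: linear_operator_on_def subset_iff\<close>)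
  have inj: "inj_on T ?D"
  proof (rule inj_onI, rule ccontr)
    fix x y assume xy: "x \<in> ?D" "y \<in> ?D" "T x = T y" "x \<noteq> y"
    let ?a = "\<lambda>b. if b = x then 1 else if b = y then - 1 else 0"
    have "(\<Sum>b\<in>?D. ?a b *s T b) = (\<Sum>b\<in>{x, y}. ?a b *s T b)"
      using xy finA by (intro sum.mono_neutral_right) auto
    also have "\<dots> = 0" using xy by simp
    finally have "(\<Sum>b\<in>?D. ?a b *s T b) \<in> T ` S" using subspace_0[OF subTS] by simp
    from indepD[OF this xy(1)] xy show False by simp
  qed
  have "quotient_basis (T ` V) (T ` S) (T ` ?D)"
  proof (rule quotient_basisI[OF _ _ subTS])
    show "finite (T ` ?D)" "T ` ?D \<subseteq> T ` V" using finA by auto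
    fix w assume "w \<in> T ` V"
    then obtain v where v: "v \<in> V" "w = T v" by blast
    obtain c where c: "v - (\<Sum>b\<in>A. c b *s b) \<in> S" using quotient_basisD[OF A(2) v(1)] by metis
    have "(\<Sum>b\<in>A. c b *s b) \<in> V" using finA by (auto intro!: subspace_scale[OF V] subspace_sum[OF V])
    then have "T (v - (\<Sum>b\<in>A. c b *s b)) = w - (\<Sum>b\<in>?D. c b *s T b)"
      using v by (simp add: diff sumD)
    also have "(\<Sum>b\<in>?D. c b *s T b) = (\<Sum>b\<in>T ` ?D. c (the_inv_into ?D T b) *s b)"
      by (simp add: sum.reindex[OF inj] the_inv_into_f_f[OF inj])
    finally have "w - (\<Sum>b\<in>T ` ?D. c (the_inv_into ?D T b) *s b) \<in> T ` S"
      using imageI[OF c, of T] by simp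
    then show "\<exists>c. w - (\<Sum>b\<in>T ` ?D. c b *s b) \<in> T ` S"
      by (rule exI[of _ "\<lambda>b. c (the_inv_into ?D T b)"])
  next
    fix c b assume "(\<Sum>b\<in>T ` ?D. c b *s b) \<in> T ` S" "b \<in> T ` ?D"
    then show "c b = 0" using indepD[of "c \<circ> T"] by (auto simp: sum.reindex[OF inj])
  qed
  moreover have "card (T ` ?D) = card B - card P"
    using card A(1) P(1) by (simp add: card_image[OF inj] card_Diff_subset)
  ultimately show ?thesis by blast
qed

end

section \<open>Toeplitz matrices with singular corner minors\<close>

lemma block_row_add: "block_row N B (\<lambda>k. x k + y k) i = block_row N B x i + block_row N B y i"
  by (simp add: block_row_def distrib_left sum.distrib)

lemma block_row_scale: "block_row N B (\<lambda>k. c * x k) i = c * block_row N B x i"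
  by (simp add: block_row_def sum_distrib_left mult_ac)

lemma block_jump_add: "block_jump N B (\<lambda>k. x k + y k) i = block_jump N B x i + block_jump N B y i"
  by (simp add: block_jump_def block_row_add o_def)

lemma block_jump_scale: "block_jump N B (\<lambda>k. c * x k) i = c * block_jump N B x i"
  by (simp add: block_jump_def block_row_scale o_def right_diff_distrib)

lemma block_row_cong: "(\<And>k. k \<le> N \<Longrightarrow> x k = y k) \<Longrightarrow> block_row N B x i = block_row N B y i"
  unfolding block_row_def by (intro sum.cong) auto

lemma block_jump_cong: "(\<And>k. k \<le> Suc N \<Longrightarrow> x k = y k) \<Longrightarrow> block_jump N B x i = block_jump N B y i"
  unfolding block_jump_def using block_row_cong[of N x y B "Suc i"] block_row_cong[of N "x \<circ> Suc" "y \<circ> Suc" B i]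
  by simp

text \<open>\<open>S\<close> is the inverse of R_1. Its corner entries are, up to the factor 1 / det
  R_1, the minors obtained by deleting the first or the last row and column; as R_1 is Toeplitz,
  both minors are det R_2 = 0.\<close>

locale singular_corner_toeplitz =
  fixes N :: nat and b :: "int \<Rightarrow> real" and S :: "nat \<Rightarrow> nat \<Rightarrow> real"
  assumes right_inverse: "\<And>i j. i \<le> N \<Longrightarrow> j \<le> N \<Longrightarrow> (\<Sum>k\<le>N. b (int k - int i) * S k j) = (if i = j then 1 else 0)"
    and left_inverse: "\<And>i j. i \<le> N \<Longrightarrow> j \<le> N \<Longrightarrow> (\<Sum>k\<le>N. S i k * b (int j - int k)) = (if i = j then 1 else 0)"
    and corner_0: "S 0 0 = 0" and corner_N: "S N N = 0"
begin

abbreviation "R \<equiv> \<lambda>i k. b (int k - int i)"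

text \<open>For the values \<open>x\<close> of w at 0,...,N+1 this is the limit of S w at 0, and
  \<open>right_end\<close> that at N+1. The former reads the coordinates 0,...,N, the latter
  1,...,N+1.\<close>

definition left_end :: "(nat \<Rightarrow> 'a::real_normed_field) \<Rightarrow> 'a" where
  "left_end x = block_row N S x 0"

definition right_end :: "(nat \<Rightarrow> 'a::real_normed_field) \<Rightarrow> 'a" where
  "right_end x = block_row N S (x \<circ> Suc) N"

lemma R_S_row:
  assumes "l \<le> N"
  shows "(\<Sum>k\<le>N. of_real (R l k) * block_row N S x k) = x l"
proof -
  have "(\<Sum>k\<le>N. of_real (R l k) * block_row N S x k) = (\<Sum>k\<le>N. \<Sum>j\<le>N. of_real (R l k * S k j) * x j)"
    by (simp add: block_row_def sum_distrib_left mult.assoc)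
  also have "\<dots> = (\<Sum>j\<le>N. \<Sum>k\<le>N. of_real (R l k * S k j) * x j)"
    by (rule sum.swap)
  also have "\<dots> = (\<Sum>j\<le>N. of_real (\<Sum>k\<le>N. R l k * S k j) * x j)"
    by (simp only: of_real_sum sum_distrib_right)
  also have "\<dots> = (\<Sum>j\<le>N. if l = j then x j else 0)"
    using assms by (intro sum.cong refl) (simp add: right_inverse)
  finally show ?thesis using assms by simp
qed

text \<open>The matrix \<open>R\<close> without last row and column, applied to the jumps of \<open>S x\<close>, sees only the end values
  of \<open>S x\<close>, because \<open>R\<close> is constant along diagonals.\<close>
lemma toeplitz_jump:
  assumes "l < N"
  shows "(\<Sum>k<N. of_real (R l k) * block_jump N S x k) =
    of_real (R (Suc l) 0) * left_end x - of_real (R l N) * right_end x"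
proof -
  have "(\<Sum>k<N. of_real (R l k) * block_row N S (x \<circ> Suc) k) = x (Suc l) - of_real (R l N) * right_end x"
    using R_S_row[of l "x \<circ> Suc"] assms by (simp add: lessThan_Suc_atMost[symmetric] right_end_def eq_diff_eq)
  \<comment> \<open>Row l+1 with its first term split off; constancy along diagonals turns its
    remaining entries into those of row l.\<close>
  moreover have "(\<Sum>k<N. of_real (R l k) * block_row N S x (Suc k)) = x (Suc l) - of_real (R (Suc l) 0) * left_end x"
    using R_S_row[of "Suc l" x] assms by (simp add: sum.atMost_shift left_end_def eq_diff_eq add.commute)
  moreover have "(\<Sum>k<N. of_real (R l k) * block_jump N S x k) =
      (\<Sum>k<N. of_real (R l k) * block_row N S (x \<circ> Suc) k) - (\<Sum>k<N. of_real (R l k) * block_row N S x (Suc k))"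
    by (simp add: block_jump_def right_diff_distrib sum_subtractf)
  ultimately show ?thesis by simp
qed

text \<open>Because \<open>S N N = 0\<close>, the last row of \<open>S\<close> without that entry is
  a left null vector of R_2. Its product with the column G^2_{N+1} is 1.\<close>

lemma left_null:
  assumes "k \<le> N"
  shows "(\<Sum>l<N. S N l * R l k) = (if k = N then 1 else 0)"
  using left_inverse[of N k] assms by (simp add: lessThan_Suc_atMost[symmetric] corner_N)

text \<open>The product of the left null vector with the column G^1_1.\<close>

definition end_ratio :: real where
  "end_ratio = (\<Sum>l<N. S N l * R (Suc l) 0)"

text \<open>The null vector annihilates the left side of \<open>toeplitz_jump\<close>; on the right
  it turns the two columns into \<open>end_ratio\<close> and 1.\<close>

lemma right_end_eq: "right_end x = of_real end_ratio * left_end x"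
proof -
  have "(\<Sum>l<N. of_real (S N l) * (\<Sum>k<N. of_real (R l k) * block_jump N S x k)) =
      (\<Sum>l<N. \<Sum>k<N. of_real (S N l * R l k) * block_jump N S x k)"
    by (simp add: sum_distrib_left mult.assoc)
  also have "\<dots> = (\<Sum>k<N. \<Sum>l<N. of_real (S N l * R l k) * block_jump N S x k)"
    by (rule sum.swap)
  also have "\<dots> = (\<Sum>k<N. of_real (\<Sum>l<N. S N l * R l k) * block_jump N S x k)"
    by (simp only: of_real_sum sum_distrib_right)
  also have "\<dots> = 0"
    by (intro sum.neutral) (simp add: left_null)
  finally have "0 = (\<Sum>l<N. of_real (S N l) * (of_real (R (Suc l) 0) * left_end x - of_real (R l N) * right_end x))"
    by (simp add: toeplitz_jump)
  also have "\<dots> = (\<Sum>l<N. of_real (S N l * R (Suc l) 0) * left_end x) - (\<Sum>l<N. of_real (S N l * R l N) * right_end x)"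
    by (simp add: right_diff_distrib sum_subtractf mult.assoc)
  also have "\<dots> = of_real end_ratio * left_end x - of_real (\<Sum>l<N. S N l * R l N) * right_end x"
    by (simp only: end_ratio_def of_real_sum sum_distrib_right)
  finally show ?thesis by (simp add: left_null)
qed

text \<open>A coordinate at which the kernel vector of R_2 is nonzero. It exists because the last
  column of \<open>S\<close> is nonzero while its corner entry is zero.\<close>

definition pivot :: nat where
  "pivot = (SOME i. i < N \<and> S i N \<noteq> 0)"

lemma pivot: "pivot < N" "S pivot N \<noteq> 0"
proof -
  have "(\<Sum>k\<le>N. R N k * S k N) \<noteq> 0" using right_inverse[of N N] by simp
  then obtain k where "k \<le> N" "R N k * S k N \<noteq> 0"
    by (meson atMost_iff sum.not_neutral_contains_not_neutral)
  then have "k < N \<and> S k N \<noteq> 0" using corner_N by (cases "k = N") auto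
  from someI[of "\<lambda>i. i < N \<and> S i N \<noteq> 0", OF this] show "pivot < N" "S pivot N \<noteq> 0"
    by (auto simp: pivot_def)
qed

text \<open>The kernel of the corner matrix is spanned by the last column of \<open>S\<close>, hence one coordinate decides.\<close>
lemma jumps_vanish:
  assumes d: "\<And>l. l < N \<Longrightarrow> (\<Sum>k<N. of_real (R l k) * d k) = 0" and piv: "d pivot = (0::'a::real_normed_field)" and "j < N"
  shows "d j = 0"
proof -
  define c where "c = (\<Sum>k<N. of_real (R N k) * d k)"
  have eq: "d j = of_real (S j N) * c" if "j < N" for j
  proof -
    have "d j = (\<Sum>k<N. of_real (\<Sum>i\<le>N. S j i * R i k) * d k)"
    proof -
      have "(\<Sum>k<N. of_real (\<Sum>i\<le>N. S j i * R i k) * d k) = (\<Sum>k<N. if j = k then d k else 0)"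
        using that by (intro sum.cong refl) (simp add: left_inverse)
      then show ?thesis using that by simp
    qed
    also have "\<dots> = (\<Sum>k<N. \<Sum>i\<le>N. of_real (S j i * R i k) * d k)"
      by (simp only: of_real_sum sum_distrib_right)
    also have "\<dots> = (\<Sum>i\<le>N. \<Sum>k<N. of_real (S j i * R i k) * d k)"
      by (rule sum.swap)
    also have "\<dots> = (\<Sum>i\<le>N. of_real (S j i) * (\<Sum>k<N. of_real (R i k) * d k))"
      by (simp add: sum_distrib_left mult.assoc)
    also have "\<dots> = (\<Sum>i<N. of_real (S j i) * (\<Sum>k<N. of_real (R i k) * d k)) + of_real (S j N) * c"
      by (simp add: lessThan_Suc_atMost[symmetric] c_def)
    also have "(\<Sum>i<N. of_real (S j i) * (\<Sum>k<N. of_real (R i k) * d k)) = 0"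
      using d by simp
    finally show ?thesis by simp
  qed
  from eq[OF pivot(1)] piv pivot(2) have "c = 0" by simp
  with eq[OF \<open>j < N\<close>] show ?thesis by simp
qed

definition ends_independent :: bool where
  "ends_independent \<longleftrightarrow> (\<forall>p q. (\<forall>l<N. p * R (Suc l) 0 + q * R l N = 0) \<longrightarrow> p = 0 \<and> q = 0)"

text \<open>Multiplying a nontrivial relation between the columns by the null vector gives q = - p
  \<open>end_ratio\<close>, so p is nonzero. Thus the same factor relates the columns and the end
  values.\<close>

lemma dependent_ends:
  assumes "\<not> ends_independent" "l < N"
  shows "R (Suc l) 0 = end_ratio * R l N"
proof -
  obtain p q where pq: "\<And>l. l < N \<Longrightarrow> p * R (Suc l) 0 + q * R l N = 0" "p \<noteq> 0 \<or> q \<noteq> 0"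
    using assms(1) by (auto simp: ends_independent_def)
  have "0 = (\<Sum>l<N. S N l * (p * R (Suc l) 0 + q * R l N))"
    using pq(1) by simp
  also have "\<dots> = p * end_ratio + q * (\<Sum>l<N. S N l * R l N)"
    by (simp add: end_ratio_def distrib_left sum.distrib sum_distrib_left mult_ac)
  finally have q: "q = - p * end_ratio" by (simp add: left_null)
  with pq(2) have "p \<noteq> 0" by auto
  moreover have "p * R (Suc l) 0 = p * (end_ratio * R l N)"
    using pq(1)[OF \<open>l < N\<close>] q by (simp add: algebra_simps)
  ultimately show ?thesis by simp
qed

text \<open>By \<open>toeplitz_jump\<close> and \<open>right_end_eq\<close>, R_2 maps the jumps to
  \<open>left_end x\<close> times the vector G^1_1 - \<open>end_ratio\<close> G^2_{N+1}. This vector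
  is zero in the dependent case. In the independent case it is nonzero, and the jumps cannot all
  vanish unless \<open>left_end x\<close> does. What remains is decided in the one-dimensional
  kernel of R_2.\<close>

lemma all_jumps_vanish_iff:
  fixes x :: "nat \<Rightarrow> 'a::real_normed_field"
  shows "(\<forall>i<N. block_jump N S x i = 0) \<longleftrightarrow>
    block_jump N S x pivot = 0 \<and> (ends_independent \<longrightarrow> left_end x = 0)"
proof
  assume J: "\<forall>i<N. block_jump N S x i = 0"
  have "left_end x = 0" if "ends_independent"
  proof (rule ccontr)
    assume "left_end x \<noteq> 0"
    have "1 * R (Suc l) 0 + (- end_ratio) * R l N = 0" if "l < N" for l
    proof -
      have "of_real (R (Suc l) 0 - R l N * end_ratio) * left_end x = 0"
        using toeplitz_jump[OF that, of x] J by (auto simp: right_end_eq algebra_simps)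
      with \<open>left_end x \<noteq> 0\<close> have "R (Suc l) 0 - R l N * end_ratio = 0" 
        by (simp only: mult_eq_0_iff of_real_eq_0_iff) simp
      then show ?thesis by simp
    qed
    with that have "(1::real) = 0" unfolding ends_independent_def by blast
    then show False by simp
  qed
  with J pivot show "block_jump N S x pivot = 0 \<and> (ends_independent \<longrightarrow> left_end x = 0)"
    by blast
next
  assume A: "block_jump N S x pivot = 0 \<and> (ends_independent \<longrightarrow> left_end x = 0)"
  have "(\<Sum>k<N. of_real (R l k) * block_jump N S x k) = 0" if "l < N" for l
  proof (cases ends_independent)
    case True
    then show ?thesis using A that by (simp add: toeplitz_jump right_end_eq)
  next
    case False
    then show ?thesis using that dependent_ends[OF False that]
      by (simp add: toeplitz_jump right_end_eq)
  qed
  with A show "\<forall>i<N. block_jump N S x i = 0"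
    using jumps_vanish[of "block_jump N S x"] by blast
qed

lemma dual_vectors:
  obtains p q :: "nat \<Rightarrow> 'a::real_normed_field"
  where "block_jump N S p pivot = 1" "left_end p = 0" "block_jump N S q pivot = 0" "left_end q = 1"
proof -
  \<comment> \<open>The coordinate N+1 enters only through \<open>x \<circ> Suc\<close>, so it
    affects neither \<open>left_end\<close> nor the right limit in a jump.\<close>
  define p where "p k = (if k = Suc N then 1 / of_real (S pivot N) else 0 :: 'a)" for k
  have "block_row N S p i = 0" for i
    by (simp add: block_row_def p_def)
  moreover have "block_row N S (p \<circ> Suc) pivot = 1"
  proof -
    have "block_row N S (p \<circ> Suc) pivot = (\<Sum>k\<le>N. if k = N then 1 else 0)"
      unfolding block_row_def by (intro sum.cong) (auto simp: p_def pivot)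
    then show ?thesis by simp
  qed
  ultimately have p: "block_jump N S p pivot = 1" "left_end p = 0"
    by (simp_all add: block_jump_def left_end_def)
  have "(\<Sum>k\<le>N. S 0 k * R k 0) \<noteq> 0" using left_inverse[of 0 0] by simp
  then obtain j where j: "j \<le> N" "S 0 j \<noteq> 0"
    by (metis (no_types, lifting) atMost_iff mult_zero_left sum.not_neutral_contains_not_neutral)
  define r where "r k = (if k = j then 1 / of_real (S 0 j) else 0 :: 'a)" for k
  have "left_end r = (\<Sum>k\<le>N. if k = j then 1 else 0)"
    unfolding left_end_def block_row_def by (intro sum.cong) (auto simp: r_def j)
  then have r: "left_end r = 1" using j by simp
  \<comment> \<open>Subtracting a multiple of \<open>p\<close> clears the pivot jump and leaves
    \<open>left_end\<close> unchanged.\<close>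
  define q where "q k = r k + (- block_jump N S r pivot) * p k" for k
  have "block_jump N S q pivot = 0" "left_end q = 1"
    unfolding q_def left_end_def block_jump_add block_jump_scale block_row_add block_row_scale
    using p r by (simp_all add: left_end_def)
  with p show ?thesis by (rule that)
qed

end

lemma lin_indep_pair_ends:
  "lin_indep_pair (vec_G1 N b) (vec_G2 N b) \<longleftrightarrow>
     (\<forall>p q. (\<forall>l<N. p * b (int 0 - int (Suc l)) + q * b (int N - int l) = 0) \<longrightarrow> p = 0 \<and> q = 0)"
proof -
  have dim: "dim_vec (vec_G1 N b) = N" "dim_vec (vec_G2 N b) = N"
    by (simp_all add: vec_G1_def vec_G2_def delete_row_def mat_R1_def)
  have G1: "Matrix.vec_index (vec_G1 N b) l = b (int 0 - int (Suc l))"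
    and G2: "Matrix.vec_index (vec_G2 N b) l = b (int N - int l)" if "l < N" for l
    using that by (simp_all add: vec_G1_def vec_G2_def delete_row_def mat_R1_def)
  have "p \<cdot>\<^sub>v vec_G1 N b + q \<cdot>\<^sub>v vec_G2 N b = 0\<^sub>v (dim_vec (vec_G1 N b)) \<longleftrightarrow>
      (\<forall>l<N. p * b (int 0 - int (Suc l)) + q * b (int N - int l) = 0)" for p q
    using dim G1 G2 by (simp add: Matrix.vec_eq_iff)
  then show ?thesis unfolding lin_indep_pair_def by simp
qed

text \<open>The inverse is taken as adjugate over determinant, so that its corner entries are
  visibly cofactors of R_1.\<close>

lemma singular_corner_toeplitz_ex:
  assumes det1: "Determinant.det (mat_R1 N b) \<noteq> 0" and det2: "Determinant.det (mat_R2 N b) = 0"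
  obtains S where "singular_corner_toeplitz N b S"
proof -
  let ?A = "mat_R1 N b"
  have A: "?A \<in> carrier_mat (N + 1) (N + 1)" by (simp add: mat_R1_def)
  have entry: "?A $$ (i, k) = b (int k - int i)" if "i \<le> N" "k \<le> N" for i k
    using that by (simp add: mat_R1_def)
  define S where "S i j = cofactor ?A j i / Determinant.det ?A" for i j
  note adj = adj_mat[OF A]
  have prod: "(\<Sum>k\<le>N. X $$ (i, k) * Y $$ (k, j)) = (X * Y) $$ (i, j)"
    if "X \<in> carrier_mat (N + 1) (N + 1)" "Y \<in> carrier_mat (N + 1) (N + 1)" "i \<le> N" "j \<le> N"
    for X Y :: "real Matrix.mat" and i j
    using that by (simp add: scalar_prod_def atLeast0LessThan lessThan_Suc_atMost)
  have adj_entry: "adj_mat ?A $$ (i, j) = S i j * Determinant.det ?A" if "i \<le> N" "j \<le> N" for i j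
    using that A det1 by (simp add: adj_mat_def S_def)
  have right: "(\<Sum>k\<le>N. b (int k - int i) * S k j) = (if i = j then 1 else 0)" if "i \<le> N" "j \<le> N" for i j
  proof -
    have "(\<Sum>k\<le>N. b (int k - int i) * S k j) * Determinant.det ?A = (?A * adj_mat ?A) $$ (i, j)"
      unfolding prod[OF A adj(1) that, symmetric] using that
      by (simp add: sum_distrib_right entry adj_entry mult.assoc)
    also have "\<dots> = (if i = j then 1 else 0) * Determinant.det ?A"
      using that by (simp add: adj(2))
    finally show ?thesis using det1 by simp
  qed
  have left: "(\<Sum>k\<le>N. S i k * b (int j - int k)) = (if i = j then 1 else 0)" if "i \<le> N" "j \<le> N" for i j
  proof -
    have "(\<Sum>k\<le>N. S i k * b (int j - int k)) * Determinant.det ?A = (adj_mat ?A * ?A) $$ (i, j)"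
      unfolding prod[OF adj(1) A that, symmetric] using that
      by (simp add: sum_distrib_left sum_distrib_right entry adj_entry mult_ac)
    also have "\<dots> = (if i = j then 1 else 0) * Determinant.det ?A"
      using that by (simp add: adj(3))
    finally show ?thesis using det1 by simp
  qed
  have "mat_delete ?A 0 0 = mat_delete ?A N N"
    by (rule Matrix.eq_matI) (auto simp: mat_delete_def mat_R1_def)
  then have "S 0 0 = 0" "S N N = 0"
    using det2 by (simp_all add: S_def cofactor_def mat_R2_def)
  with right left have "singular_corner_toeplitz N b S"
    by unfold_locales
  then show ?thesis by (rule that)
qed

section \<open>Interpolation of traces\<close>

lemma weak_deriv_zero: "weak_deriv a b j 0 = 0"
  by (rule weak_deriv_eqI[OF L2_zero L2_zero])
    (simp add: has_weak_deriv_iff[OF L2_zero L2_zero] pairing_zero test_function_continuous test_function_continuous_derivs)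

text \<open>Embeds real test functions into the classes over the scalar field \<open>'a\<close>,
  where they provide smooth elements with known traces.\<close>

definition test_class :: "(real \<Rightarrow> real) \<Rightarrow> 'a::{real_normed_field, euclidean_space} ae_fun" where
  "test_class \<phi> = ae_class (\<lambda>t. \<phi> t *\<^sub>R 1)"

lemma L2_rep_test_class:
  assumes \<phi>: "test_function a b \<phi>"
  shows "L2_rep a b (\<lambda>t. \<phi> t *\<^sub>R 1) (test_class \<phi> :: 'a::{real_normed_field, euclidean_space} ae_fun)"
proof -
  note [measurable] = test_function_borel[OF \<phi>]
  obtain C where C: "\<And>x. \<bar>\<phi> x\<bar> \<le> C" using test_function_bounded[OF \<phi>] by blast
  have "\<bar>\<phi> t * \<phi> t\<bar> \<le> C * \<bar>\<phi> t\<bar>" for t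
    unfolding abs_mult by (intro mult_right_mono C) simp
  then have "integrable lborel (\<lambda>t. (\<phi> t)\<^sup>2)"
    by (intro Bochner_Integration.integrable_bound[OF integrable_mult_right[OF integrable_abs[OF test_function_integrable[OF \<phi>]], of C]])
      (auto simp: power2_eq_square intro: order_trans[OF _ abs_ge_self])
  then show ?thesis
    using test_function_eq_0[OF \<phi>] by (auto simp: L2_rep_def test_class_def)
qed

lemma D1_test_class:
  assumes \<phi>: "test_function a b \<phi>" and "a < b"
  shows "D1 a b (test_class \<phi> :: 'a::{real_normed_field, euclidean_space} ae_fun) (test_class (deriv \<phi>))"
  unfolding D1_def
proof (intro conjI allI impI)
  note \<phi>' = test_function_deriv_test[OF \<phi>]
  show "test_class \<phi> \<in> L2 a b" "test_class (deriv \<phi>) \<in> L2 a b"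
    using L2_rep_test_class[OF \<phi>] L2_rep_test_class[OF \<phi>'] L2_rep_ex by blast+
  fix \<psi> assume \<psi>: "test_function a b \<psi>"
  note \<psi>' = test_function_deriv_test[OF \<psi>]
  let ?F = "\<lambda>t. \<psi> t * \<phi> t" and ?f = "\<lambda>t. deriv \<psi> t * \<phi> t + \<psi> t * deriv \<phi> t"
  have int: "integrable lborel (\<lambda>t. (\<psi> t * \<phi> t) *\<^sub>R (1::'a))" if "test_function a b \<psi>" "test_function a b \<phi>" for \<psi> \<phi>
    using pairing_integrable[OF L2_rep_test_class[OF that(2)] test_function_continuous[OF that(1)]] by simp
  have "(LINT t|lborel. (indicator {a..b} t * ?f t) *\<^sub>R (1::'a)) = (?F b - ?F a) *\<^sub>R 1"
  proof (rule integral_interval_scaleR)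
    show "(?F has_real_derivative ?f x) (at x)" for x
      using test_function_deriv[OF \<psi>] test_function_deriv[OF \<phi>]
      by (auto intro!: derivative_eq_intros)
    show "continuous_on UNIV ?f"
      by (intro continuous_intros test_function_continuous[OF \<psi>] test_function_continuous[OF \<phi>]
          test_function_continuous[OF \<psi>'] test_function_continuous[OF \<phi>'])
  qed (use \<open>a < b\<close> in simp)
  also have "(\<lambda>t. (indicator {a..b} t * ?f t) *\<^sub>R (1::'a)) = (\<lambda>t. (deriv \<psi> t * \<phi> t) *\<^sub>R 1 + (\<psi> t * deriv \<phi> t) *\<^sub>R 1)"
  proof
    fix t
    show "(indicator {a..b} t * ?f t) *\<^sub>R (1::'a) = (deriv \<psi> t * \<phi> t) *\<^sub>R 1 + (\<psi> t * deriv \<phi> t) *\<^sub>R 1"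
      using test_function_eq_0[OF \<phi>, of t] test_function_eq_0[OF \<psi>, of t]
      by (cases "t \<in> {a<..<b}") (auto simp: scaleR_add_left)
  qed
  finally have "(LINT t|lborel. (deriv \<psi> t * \<phi> t) *\<^sub>R (1::'a)) + (LINT t|lborel. (\<psi> t * deriv \<phi> t) *\<^sub>R 1) = 0"
    using test_function_eq_0[OF \<phi>, of a] test_function_eq_0[OF \<phi>, of b]
    by (simp add: Bochner_Integration.integral_add[OF int[OF \<psi>' \<phi>] int[OF \<psi> \<phi>']])
  then show "pairing (deriv \<psi>) (test_class \<phi> :: 'a ae_fun) = - pairing \<psi> (test_class (deriv \<phi>))"
    unfolding pairing_rep[OF L2_rep_test_class[OF \<phi>] test_function_continuous[OF \<psi>']]
      pairing_rep[OF L2_rep_test_class[OF \<phi>'] test_function_continuous[OF \<psi>]]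
    by (simp add: eq_neg_iff_add_eq_0)
qed

lemma ae_value_test_class:
  assumes "test_function a b \<phi>" "a < b" "x \<in> {a..b}"
  shows "ae_value a b (test_class \<phi> :: 'a::{real_normed_field, euclidean_space} ae_fun) x = \<phi> x *\<^sub>R 1"
proof (rule ae_value_eq[OF \<open>a < b\<close> _ \<open>x \<in> {a..b}\<close>])
  show "continuous_rep a b (test_class \<phi> :: 'a ae_fun) (\<lambda>x. \<phi> x *\<^sub>R 1)"
    using test_function_borel[OF assms(1)] test_function_continuous[OF assms(1)]
    by (auto simp: test_class_def continuous_rep_class intro: continuous_intros)
qed

lemma test_function_derivs: "test_function a b \<phi> \<Longrightarrow> test_function a b ((deriv ^^ n) \<phi>)"
  by (induction n) (auto intro: test_function_deriv_test)

lemma sobolev_test_class: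
  assumes \<phi>: "test_function a b \<phi>" and "a < b"
  shows "(test_class \<phi> :: 'a::{real_normed_field, euclidean_space} ae_fun) \<in> sobolev a b m"
    "j \<le> m \<Longrightarrow> weak_deriv a b j (test_class \<phi> :: 'a ae_fun) = test_class ((deriv ^^ j) \<phi>)"
proof -
  let ?U = "\<lambda>j. test_class ((deriv ^^ j) \<phi>) :: 'a ae_fun"
  have D: "D1 a b (?U j) (?U (Suc j))" for j
    using D1_test_class[OF test_function_derivs[OF \<phi>] \<open>a < b\<close>] by simp
  have "?U 0 \<in> L2 a b" using D[of 0] by (simp add: D1_def)
  from sobolev_chainI[of m a b ?U, OF D this]
  show "(test_class \<phi> :: 'a ae_fun) \<in> sobolev a b m"
    "j \<le> m \<Longrightarrow> weak_deriv a b j (test_class \<phi> :: 'a ae_fun) = test_class ((deriv ^^ j) \<phi>)"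
    by simp_all
qed

text \<open>Adding a multiple of \<eta> to a derivative changes the increment of its primitive over
  one unit interval and leaves all traces of that derivative and of the higher ones as they
  are.\<close>

lemma interval_bump_ex:
  assumes "i \<le> N"
  obtains \<eta> :: "'a::{real_normed_field, euclidean_space} ae_fun" where
    "\<And>m. \<eta> \<in> sobolev 0 (real N + 1) m"
    "\<And>\<mu> k. k \<le> Suc N \<Longrightarrow> ae_value 0 (real N + 1) (weak_deriv 0 (real N + 1) \<mu> \<eta>) (real k) = 0"
    "\<And>j. pairing (\<lambda>_. 1) (restr (real j) (real j + 1) \<eta>) = (if i = j then 1 else 0)"
proof -
  \<comment> \<open>The support has to stay away from the integers.\<close>
  let ?c = "real i + 1 / 4" and ?d = "real i + 3 / 4"
  define \<phi> where "\<phi> = bump ?c ?d 1"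
  define J where "J = (LINT t|lborel. \<phi> t)"
  have "J > 0" unfolding J_def \<phi>_def by (rule bump_integral_pos) simp
  have loc: "test_function (real i) (real i + 1) \<phi>"
    unfolding \<phi>_def by (rule test_function_bump) auto
  have test: "test_function 0 (real N + 1) \<phi>"
    by (rule test_function_mono[OF loc]) (use assms in auto)
  note sob = sobolev_test_class[OF test, where 'a = 'a]
  let ?\<eta> = "ae_smult (of_real (1 / J)) (test_class \<phi>) :: 'a ae_fun"
  have eta: "?\<eta> \<in> sobolev 0 (real N + 1) m" for m
    by (intro sobolev_smult sob) simp
  have "ae_value 0 (real N + 1) (weak_deriv 0 (real N + 1) \<mu> ?\<eta>) (real k) = 0" if "k \<le> Suc N" for \<mu> k
  proof -
    have "real k \<notin> {real i<..<real i + 1}"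
      by (cases "k \<le> i") auto
    then have z: "(deriv ^^ \<mu>) \<phi> (real k) = 0"
      by (rule test_function_eq_0[OF test_function_derivs[OF loc]])
    have k: "real k \<in> {0..real N + 1}" using that by auto
    have "weak_deriv 0 (real N + 1) \<mu> ?\<eta> = ae_smult (of_real (1 / J)) (test_class ((deriv ^^ \<mu>) \<phi>))"
      using sobolev_smult(2)[OF sob(1), of \<mu> \<mu> "of_real (1 / J)"] sob(2)[of \<mu> \<mu>] by simp
    then show ?thesis
      using ae_value_smult[OF _ k D1_test_class[OF test_function_derivs[OF test], where 'a = 'a], of "of_real (1 / J)" \<mu>]
        ae_value_test_class[OF test_function_derivs[OF test] _ k, of \<mu>, where 'a = 'a] z by simp
  qed
  moreover have "pairing (\<lambda>_. 1) (restr (real j) (real j + 1) ?\<eta>) = (if i = j then 1 else 0)" for j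
  proof -
    note rep = L2_rep_test_class[OF test, where 'a = 'a]
    have L: "restr (real j) (real j + 1) (test_class \<phi> :: 'a ae_fun) \<in> L2 0 (real N + 1)"
      using L2_rep_restr[OF rep] L2_rep_ex by blast
    have "pairing (\<lambda>_. 1) (restr (real j) (real j + 1) (test_class \<phi> :: 'a ae_fun)) =
        (LINT t|lborel. (if t \<in> {real j<..<real j + 1} then \<phi> t *\<^sub>R 1 else 0))"
      by (subst pairing_rep[OF L2_rep_restr[OF rep]]) auto
    also have "(\<lambda>t. if t \<in> {real j<..<real j + 1} then \<phi> t *\<^sub>R (1::'a) else 0) = (\<lambda>t. (if i = j then \<phi> t else 0) *\<^sub>R 1)"
    proof
      fix t
      have "t \<notin> {real i<..<real i + 1}" if "t \<in> {real j<..<real j + 1}" "i \<noteq> j"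
        using that by (cases "i \<le> j") auto
      then show "(if t \<in> {real j<..<real j + 1} then \<phi> t *\<^sub>R (1::'a) else 0) = (if i = j then \<phi> t else 0) *\<^sub>R 1"
        using test_function_eq_0[OF loc, of t] by auto
    qed
    also have "(LINT t|lborel. (if i = j then \<phi> t else 0) *\<^sub>R (1::'a)) = (if i = j then J else 0) *\<^sub>R 1"
      using test_function_integrable[OF test] by (simp add: J_def)
    finally show ?thesis
      using \<open>J > 0\<close> L by (simp add: restr_smult pairing_smult[of _ _ 0 "real N + 1"] of_real_def)
  qed
  ultimately show ?thesis using eta by (intro that[of ?\<eta>]) auto
qed

lemma ae_value_sum:
  assumes "a < b" "x \<in> {a..b}" "\<And>i. i \<in> I \<Longrightarrow> D1 a b (u i) (v i)"
  shows "ae_value a b (\<Sum>i\<in>I. u i) x = (\<Sum>i\<in>I. ae_value a b (u i) x) \<and> D1 a b (\<Sum>i\<in>I. u i) (\<Sum>i\<in>I. v i)"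
  using assms(3)
proof (induction I rule: infinite_finite_induct)
  case (insert i I)
  then show ?case using assms(1,2) by (auto simp: ae_value_add[of a b x _ "v i" _ "sum v I"] intro: D1_add)
qed (use assms(1,2) in \<open>simp_all add: ae_value_zero D1_zero\<close>)

text \<open>Induction that lowers the order by integration: take a function with the prescribed
  higher traces, correct its integrals over the unit intervals to the increments of the values of
  order 0, and pass to the primitive.\<close>

lemma trace_interpolation:
  fixes c :: "nat \<Rightarrow> nat \<Rightarrow> 'a::{real_normed_field, euclidean_space}"
  obtains w where "w \<in> sobolev 0 (real N + 1) m"
    "\<And>\<mu> k. \<mu> < m \<Longrightarrow> k \<le> Suc N \<Longrightarrow> ae_value 0 (real N + 1) (weak_deriv 0 (real N + 1) \<mu> w) (real k) = c \<mu> k"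
proof -
  let ?L = "real N + 1"
  have "\<exists>w\<in>sobolev 0 ?L m. \<forall>\<mu><m. \<forall>k\<le>Suc N. ae_value 0 ?L (weak_deriv 0 ?L \<mu> w) (real k) = c \<mu> k"
  proof (induction m arbitrary: c)
    case 0
    then show ?case using sobolev_zero by blast
  next
    case (Suc m)
    from Suc[of "\<lambda>\<mu>. c (Suc \<mu>)"] obtain w where w: "w \<in> sobolev 0 ?L m"
      "\<And>\<mu> k. \<mu> < m \<Longrightarrow> k \<le> Suc N \<Longrightarrow> ae_value 0 ?L (weak_deriv 0 ?L \<mu> w) (real k) = c (Suc \<mu>) k"
      by blast
    have "\<forall>i\<in>{..N}. \<exists>\<eta>::'a ae_fun. (\<forall>m. \<eta> \<in> sobolev 0 ?L m) \<and>
        (\<forall>\<mu>. \<forall>k\<le>Suc N. ae_value 0 ?L (weak_deriv 0 ?L \<mu> \<eta>) (real k) = 0) \<and>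
        (\<forall>j. pairing (\<lambda>_. 1) (restr (real j) (real j + 1) \<eta>) = (if i = j then 1 else 0))"
      using interval_bump_ex[where 'a = 'a] by (metis atMost_iff)
    then obtain \<eta> :: "nat \<Rightarrow> 'a ae_fun" where \<eta>: "\<And>i m. i \<le> N \<Longrightarrow> \<eta> i \<in> sobolev 0 ?L m"
        "\<And>i \<mu> k. i \<le> N \<Longrightarrow> k \<le> Suc N \<Longrightarrow> ae_value 0 ?L (weak_deriv 0 ?L \<mu> (\<eta> i)) (real k) = 0"
        "\<And>i j. i \<le> N \<Longrightarrow> pairing (\<lambda>_. 1) (restr (real j) (real j + 1) (\<eta> i)) = (if i = j then 1 else 0)"
      by (metis atMost_iff)
    \<comment> \<open>The required increment over the i-th unit interval less the integral that
      \<open>w\<close> already has there.\<close>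
    define \<alpha> where "\<alpha> i = c 0 (Suc i) - c 0 i - pairing (\<lambda>_. 1) (restr (real i) (real i + 1) w)" for i
    define z where "z = (\<Sum>i\<le>N. ae_smult (\<alpha> i) (\<eta> i))"
    have wL: "w \<in> L2 0 ?L" using w(1) by (rule sobolev_L2)
    have \<eta>L: "\<eta> i \<in> L2 0 ?L" if "i \<le> N" for i using \<eta>(1)[OF that] sobolev_L2 by blast
    have z: "z \<in> sobolev 0 ?L j" for j
      unfolding z_def by (intro ae.subspace_sum[OF sobolev_subspace] sobolev_smult(1)) (use \<eta>(1) in auto)
    have zd: "weak_deriv 0 ?L \<mu> z = (\<Sum>i\<le>N. ae_smult (\<alpha> i) (weak_deriv 0 ?L \<mu> (\<eta> i)))" for \<mu>
    proof -
      have "weak_deriv 0 ?L \<mu> (\<Sum>i\<in>I. ae_smult (\<alpha> i) (\<eta> i)) = (\<Sum>i\<in>I. ae_smult (\<alpha> i) (weak_deriv 0 ?L \<mu> (\<eta> i)))"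
        if "finite I" "I \<subseteq> {..N}" for I
        using that
      proof (induction I rule: finite_induct)
        case empty
        show ?case by (simp add: weak_deriv_zero)
      next
        case (insert i I)
        have "ae_smult (\<alpha> i) (\<eta> i) \<in> sobolev 0 ?L \<mu>" "(\<Sum>i\<in>I. ae_smult (\<alpha> i) (\<eta> i)) \<in> sobolev 0 ?L \<mu>"
          using insert \<eta>(1) by (auto intro!: ae.subspace_sum[OF sobolev_subspace] sobolev_smult(1))
        then show ?case
          using insert \<eta>(1)[of i \<mu>] by (simp add: sobolev_add(2) sobolev_smult(2))
      qed
      then show ?thesis by (simp add: z_def)
    qed
    have ztr: "ae_value 0 ?L (weak_deriv 0 ?L \<mu> z) (real k) = 0" if "k \<le> Suc N" for \<mu> k
    proof -
      have k: "real k \<in> {0..?L}" using that by auto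
      have D: "D1 0 ?L (weak_deriv 0 ?L \<mu> (\<eta> i)) (weak_deriv 0 ?L (Suc \<mu>) (\<eta> i))" if "i \<le> N" for i
        using sobolev_D1[OF \<eta>(1)[OF that, of "Suc \<mu>"]] by simp
      have "ae_value 0 ?L (weak_deriv 0 ?L \<mu> z) (real k) =
          (\<Sum>i\<le>N. ae_value 0 ?L (ae_smult (\<alpha> i) (weak_deriv 0 ?L \<mu> (\<eta> i))) (real k))"
        unfolding zd
        by (intro ae_value_sum[where v = "\<lambda>i. ae_smult (\<alpha> i) (weak_deriv 0 ?L (Suc \<mu>) (\<eta> i))", THEN conjunct1]
            k D1_smult D) auto
      also have "\<dots> = 0"
        by (intro sum.neutral ballI) (simp add: ae_value_smult[OF _ k D] \<eta>(2) that)
      finally show ?thesis .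
    qed
    define v where "v = w + z"
    have v: "v \<in> sobolev 0 ?L m" unfolding v_def by (intro sobolev_add(1) w(1) z)
    have vtr: "ae_value 0 ?L (weak_deriv 0 ?L \<mu> v) (real k) = c (Suc \<mu>) k" if "\<mu> < m" "k \<le> Suc N" for \<mu> k
    proof -
      have k: "real k \<in> {0..?L}" using that by auto
      have "weak_deriv 0 ?L \<mu> v = weak_deriv 0 ?L \<mu> w + weak_deriv 0 ?L \<mu> z"
        unfolding v_def using that by (intro sobolev_add(2)[OF w(1) z]) simp
      then show ?thesis
        using ae_value_add[OF _ k sobolev_D1[OF w(1) that(1)] sobolev_D1[OF z[of m] that(1)]] w(2)[OF that] ztr[OF that(2)] by simp
    qed
    have vint: "pairing (\<lambda>_. 1) (restr (real j) (real j + 1) v) = c 0 (Suc j) - c 0 j" if "j \<le> N" for j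
    proof -
      have "pairing (\<lambda>_. 1) (restr (real j) (real j + 1) z) =
          (\<Sum>i\<le>N. pairing (\<lambda>_. 1) (ae_smult (\<alpha> i) (restr (real j) (real j + 1) (\<eta> i))))"
        unfolding z_def restr_sum restr_smult
        by (rule pairing_sum[of _ _ _ 0 ?L]) (auto intro!: L2_smult restr_L2 \<eta>L)
      also have "\<dots> = (\<Sum>i\<le>N. \<alpha> i * (if i = j then 1 else 0))"
        by (intro sum.cong refl) (simp add: pairing_smult[of _ _ 0 ?L] restr_L2 \<eta>L \<eta>(3))
      also have "\<dots> = \<alpha> j"
        using that by (simp add: if_distrib[of "(*) _"] cong: if_cong)
      finally show ?thesis
        unfolding v_def restr_add
        by (subst pairing_add[of _ _ 0 ?L]) (auto simp: \<alpha>_def intro: restr_L2 wL sobolev_L2[OF z])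
    qed
    obtain u where u: "D1 0 ?L u v" "ae_value 0 ?L u 0 = c 0 0"
      using D1_ex[of 0 ?L v "c 0 0"] sobolev_L2[OF v] by auto
    have utr: "ae_value 0 ?L u (real k) = c 0 k" if "k \<le> Suc N" for k
      using that
    proof (induction k)
      case 0
      then show ?case using u(2) by simp
    next
      case (Suc k)
      then have "ae_value 0 ?L u (real k + 1) - ae_value 0 ?L u (real k) = c 0 (Suc k) - c 0 k"
        using D1_increment[OF _ u(1), of "real k" "real k + 1"] vint[of k] by simp
      with Suc show ?case by (simp add: add.commute)
    qed
    have "u \<in> sobolev 0 ?L (Suc m)" using u(1) v sobolev_Suc_iff by blast
    moreover have "ae_value 0 ?L (weak_deriv 0 ?L \<mu> u) (real k) = c \<mu> k" if "\<mu> < Suc m" "k \<le> Suc N" for \<mu> k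
    proof (cases \<mu>)
      case 0
      then show ?thesis using utr[OF that(2)] u(1) by (simp add: D1_def weak_deriv_0[of _ 0 ?L])
    next
      case (Suc \<nu>)
      then show ?thesis using weak_deriv_Suc[OF u(1) v, of \<nu>] vtr[of \<nu> k] that by simp
    qed
    ultimately show ?case by blast
  qed
  then show ?thesis using that by blast
qed

section \<open>The index computation\<close>

text \<open>The functions 1 and t - a, obtained as iterated primitives of 0; their derivatives and
  end values are all that is needed about them.\<close>

lemma affine_functions:
  assumes "a < b"
  obtains e l :: "'a::{real_normed_field, euclidean_space} ae_fun"
  where "D1 a b e 0" "D1 a b l e" "ae_value a b e a = 1" "ae_value a b e b = 1"
    "ae_value a b l a = 0" "ae_value a b l b = of_real (b - a)"
proof -
  obtain e :: "'a ae_fun" where e: "D1 a b e 0" "ae_value a b e a = 1"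
    by (rule D1_ex[OF assms L2_zero])
  then have "e \<in> L2 a b" by (simp add: D1_def)
  then obtain l where l: "D1 a b l e" "ae_value a b l a = 0"
    by (rule D1_ex[OF assms])
  have eb: "ae_value a b e b = 1"
    using D1_increment[OF assms e(1), of a b] assms e(2) by (simp add: restr_zero pairing_zero)
  have "pairing (\<lambda>_. 1) (restr a b e) = b *\<^sub>R ae_value a b e b - a *\<^sub>R ae_value a b e a - pairing (\<lambda>t. t) (restr a b 0)"
    by (rule D1_integration_by_parts[OF assms e(1)]) (use assms in auto)
  then have "pairing (\<lambda>_. 1) (restr a b e) = of_real (b - a)"
    by (simp add: e eb restr_zero pairing_zero of_real_def scaleR_left_diff_distrib)
  then have "ae_value a b l b = of_real (b - a)"
    using D1_increment[OF assms l(1), of a b] assms l(2) by simp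
  with e l eb show ?thesis by (intro that) auto
qed

text \<open>\<open>D1_eqI\<close> is applied twice: the slope at \<open>a\<close> determines the
  derivative, then the value at \<open>a\<close> determines the function.\<close>

lemma affine_span:
  assumes "a < b" and e: "D1 a b e 0" "ae_value a b e a = 1" and l: "D1 a b l e" "ae_value a b l a = 0"
    and v: "v \<in> sobolev a b (k + 2)" and "weak_deriv a b 2 v = 0"
  shows "v = ae_smult (ae_value a b v a) e + ae_smult (ae_value a b (weak_deriv a b 1 v) a) l"
proof -
  let ?v' = "weak_deriv a b 1 v" and ?c = "ae_value a b (weak_deriv a b 1 v) a"
  have v0: "weak_deriv a b 0 v = v" using sobolev_L2[OF v] by (rule weak_deriv_0)
  have D: "D1 a b v ?v'" "D1 a b ?v' 0"
    using sobolev_D1[OF v, of 0] sobolev_D1[OF v, of 1] assms(7) v0 by (simp_all add: numeral_2_eq_2)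
  have a: "a \<in> {a..b}" using \<open>a < b\<close> by simp
  have "?v' = ae_smult ?c e"
    by (rule D1_eqI[OF \<open>a < b\<close> D(2)])
      (use D1_smult[OF e(1), of ?c] ae_value_smult[OF \<open>a < b\<close> a e(1), of ?c] e(2) in auto)
  then have Dv: "D1 a b v (ae_smult ?c e)" using D(1) by simp
  have De: "D1 a b (ae_smult d e) 0" for d using D1_smult[OF e(1), of d] by simp
  show ?thesis
  proof (rule D1_eqI[OF \<open>a < b\<close> Dv])
    show "D1 a b (ae_smult (ae_value a b v a) e + ae_smult ?c l) (ae_smult ?c e)"
      using D1_add[OF De D1_smult[OF l(1)]] by simp
    show "ae_value a b v a = ae_value a b (ae_smult (ae_value a b v a) e + ae_smult ?c l) a"
      using ae_value_add[OF \<open>a < b\<close> a De D1_smult[OF l(1)], of "ae_value a b v a" ?c]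
        ae_value_smult[OF \<open>a < b\<close> a e(1), of "ae_value a b v a"] ae_value_smult[OF \<open>a < b\<close> a l(1), of ?c] e(2) l(2) by simp
  qed
qed

lemma second_antiderivative:
  assumes "a < b" and f: "f \<in> sobolev a b k"
  obtains w where "w \<in> sobolev a b (k + 2)" "weak_deriv a b 2 w = f"
proof -
  obtain v where v: "D1 a b v f" using D1_ex[OF \<open>a < b\<close> sobolev_L2[OF f], of 0] by auto
  then have vs: "v \<in> sobolev a b (Suc k)" using f sobolev_Suc_iff by blast
  obtain w where w: "D1 a b w v" using D1_ex[OF \<open>a < b\<close> sobolev_L2[OF vs], of 0] by auto
  then have ws: "w \<in> sobolev a b (Suc (Suc k))" using vs sobolev_Suc_iff by blast
  have "weak_deriv a b 2 w = f"
    using weak_deriv_Suc[OF w vs, of 1] weak_deriv_Suc[OF v f, of 0] weak_deriv_0[OF sobolev_L2[OF f]]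
    by (simp add: numeral_2_eq_2)
  with ws show ?thesis by (intro that) auto
qed

lemma sobolev_weak_deriv_2:
  assumes u: "u \<in> sobolev a b (k + 2)"
  shows "weak_deriv a b 2 u \<in> sobolev a b k"
    "\<And>j. j \<le> k \<Longrightarrow> weak_deriv a b j (weak_deriv a b 2 u) = weak_deriv a b (j + 2) u"
proof -
  let ?U = "\<lambda>j. weak_deriv a b (j + 2) u"
  have D: "D1 a b (?U j) (?U (Suc j))" if "j < k" for j
    using sobolev_D1[OF u, of "j + 2"] that by simp
  have "?U 0 \<in> L2 a b" using sobolev_weak_deriv(1)[OF u, of 2] by (simp add: numeral_2_eq_2)
  note chain = sobolev_chainI[of k a b ?U, OF D this, unfolded add_0]
  show "weak_deriv a b 2 u \<in> sobolev a b k"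
    by (rule chain(1)) simp_all
  show "weak_deriv a b j (weak_deriv a b 2 u) = weak_deriv a b (j + 2) u" if "j \<le> k" for j
    using that by (intro chain(2)) simp_all
qed

section \<open>Range and codimension of the operator\<close>

context singular_corner_toeplitz
begin

abbreviation "len \<equiv> real N + 1"

lemma R_S: "u \<in> L2 0 len \<Longrightarrow> block_op N R (block_op N S u) = u"
  unfolding block_op_comp by (subst block_op_cong[OF right_inverse]) (auto intro: block_op_id)

lemma S_R: "u \<in> L2 0 len \<Longrightarrow> block_op N S (block_op N R u) = u"
  unfolding block_op_comp by (subst block_op_cong[OF left_inverse]) (auto intro: block_op_id)

lemma dom_A_iff:
  "u \<in> dom_A N b k \<longleftrightarrow> u \<in> sobolev 0 len (k + 2) \<and> block_op N R u \<in> sobolev 0 len (k + 2) \<and>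
     ae_value 0 len u 0 = 0 \<and> ae_value 0 len u len = 0"
proof (cases "u \<in> sobolev 0 len (k + 2)")
  case True
  have uL: "u \<in> L2 0 len" using True by (rule sobolev_L2)
  have "D1 0 len u (weak_deriv 0 len 1 u)"
    using sobolev_D1[OF True, of 0] weak_deriv_0[OF uL] by simp
  then obtain g where g: "continuous_rep 0 len u g" using D1_continuous_rep[of 0 len] by auto
  have "(\<exists>g. continuous_rep 0 len u g \<and> g 0 = 0 \<and> g len = 0) \<longleftrightarrow>
      ae_value 0 len u 0 = 0 \<and> ae_value 0 len u len = 0"
  proof -
    have "ae_value 0 len u 0 = h 0" "ae_value 0 len u len = h len" if "continuous_rep 0 len u h" for h
      using ae_value_eq[OF _ that, of 0] ae_value_eq[OF _ that, of len] by auto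
    with g show ?thesis by metis
  qed
  moreover have "u \<in> sobolev 0 len 1" using sobolev_mono[OF True] by simp
  ultimately show ?thesis
    using True by (auto simp: dom_A_def sobolev1_0_def diff_op_Q_eq_block_op[OF uL])
qed (simp add: dom_A_def)

lemma op_A_eq: "u \<in> L2 0 len \<Longrightarrow> op_A N b u = - weak_deriv 0 len 2 (block_op N R u)"
  by (simp add: op_A_def diff_op_Q_eq_block_op)

text \<open>In the domain R_Q u belongs to W^{k+2}, so no jumps occur and R_Q commutes with all
  derivatives up to that order.\<close>

lemma dom_A_weak_deriv:
  assumes "u \<in> dom_A N b k" "j \<le> k + 2"
  shows "weak_deriv 0 len j (block_op N R u) = block_op N R (weak_deriv 0 len j u)"
  using assms block_op_sobolev(2)[of u N "k + 2" R j] by (simp add: dom_A_iff)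

abbreviation traces :: "nat \<Rightarrow> 'a::{real_normed_field, euclidean_space} ae_fun \<Rightarrow> nat \<Rightarrow> 'a" where
  "traces \<mu> w \<equiv> \<lambda>i. ae_value 0 len (weak_deriv 0 len \<mu> w) (real i)"

text \<open>The image of the domain under R_Q, described from the side of w by means of the inverse
  \<open>S\<close>. The range of A consists of the functions - w'' with w in this space.\<close>

definition range_space :: "nat \<Rightarrow> 'a::{real_normed_field, euclidean_space} ae_fun set" where
  "range_space k = {w \<in> sobolev 0 len (k + 2). block_op N S w \<in> dom_A N b k}"

text \<open>S w lies in W^{k+2} iff all jumps of orders up to k+1 vanish, and proportionality of the
  end values merges the two Dirichlet conditions. The condition on \<open>left_end\<close> at order
  0 is listed separately because in the dependent case the jumps do not imply it.\<close>

lemma range_space_iff: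
  assumes w: "w \<in> sobolev 0 len (k + 2)"
  shows "w \<in> range_space k \<longleftrightarrow>
    (\<forall>\<mu>\<le>k+1. block_jump N S (traces \<mu> w) pivot = 0) \<and> left_end (traces 0 w) = 0 \<and>
    (ends_independent \<longrightarrow> (\<forall>\<mu>\<le>k+1. left_end (traces \<mu> w) = 0))"
proof -
  have wL: "w \<in> L2 0 len" using w by (rule sobolev_L2)
  have w0: "weak_deriv 0 len 0 w = w" using wL by (rule weak_deriv_0)
  have D: "D1 0 len w (weak_deriv 0 len 1 w)"
    using sobolev_D1[OF w, of 0] w0 by simp
  have less: "\<mu> < k + 2 \<longleftrightarrow> \<mu> \<le> k + 1" for \<mu> by auto
  have sob: "block_op N S w \<in> sobolev 0 len (k + 2) \<longleftrightarrow> (\<forall>\<mu>\<le>k+1. \<forall>i<N. block_jump N S (traces \<mu> w) i = 0)"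
    using block_op_sobolev(1)[OF w, of S] unfolding less .
  have tr: "ae_value 0 len (block_op N S w) 0 = left_end (traces 0 w)"
    "ae_value 0 len (block_op N S w) len = of_real end_ratio * left_end (traces 0 w)"
    if "\<forall>\<mu>\<le>k+1. \<forall>i<N. block_jump N S (traces \<mu> w) i = 0"
  proof -
    have "\<And>i. i < N \<Longrightarrow> block_jump N S (\<lambda>k. ae_value 0 len w (real k)) i = 0"
      using that[rule_format, of 0] w0 by simp
    note B = block_op_D1[OF D this]
    show "ae_value 0 len (block_op N S w) 0 = left_end (traces 0 w)"
      using B(2) by (simp add: left_end_def w0)
    show "ae_value 0 len (block_op N S w) len = of_real end_ratio * left_end (traces 0 w)"
      using B(3) right_end_eq[of "traces 0 w"] by (simp add: right_end_def w0)
  qed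
  have "w \<in> range_space k \<longleftrightarrow>
      (\<forall>\<mu>\<le>k+1. \<forall>i<N. block_jump N S (traces \<mu> w) i = 0) \<and> left_end (traces 0 w) = 0"
    using w sob tr by (auto simp: range_space_def dom_A_iff R_S[OF wL])
  then show ?thesis
    unfolding all_jumps_vanish_iff by blast
qed

lemma dom_A_subspace: "ae.subspace (dom_A N b k :: 'a::{real_normed_field, euclidean_space} ae_fun set)"
proof -
  have D: "D1 0 len u (weak_deriv 0 len 1 u)" if "u \<in> sobolev 0 len (k + 2)" for u :: "'a ae_fun"
    using sobolev_D1[OF that, of 0] weak_deriv_0[OF sobolev_L2[OF that]] by simp
  have zero: "block_op N R 0 = (0 :: 'a ae_fun)"
    using block_op_linear(2)[of N R 0 0] by simp
  show ?thesis
    unfolding ae.subspace_def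
    by (auto simp: dom_A_iff zero sobolev_zero ae_value_zero block_op_linear sobolev_add(1) sobolev_smult(1)
        ae_value_add[OF _ _ D D] ae_value_smult[OF _ _ D])
qed

lemma block_op_zero: "block_op N B 0 = 0"
  using block_op_linear(2)[of N B 0 0] by simp

lemma range_space_subspace:
  "ae.subspace (range_space k :: 'a::{real_normed_field, euclidean_space} ae_fun set)"
  using ae.subspace_0[OF dom_A_subspace] ae.subspace_add[OF dom_A_subspace] ae.subspace_scale[OF dom_A_subspace]
  unfolding ae.subspace_def range_space_def
  by (auto simp: block_op_linear block_op_zero sobolev_zero sobolev_add(1) sobolev_smult(1))

lemma op_A_image: "op_A N b ` dom_A N b k = (\<lambda>w. - weak_deriv 0 len 2 w) ` range_space k"
proof (intro equalityI subsetI)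
  fix f assume "f \<in> op_A N b ` dom_A N b k"
  then obtain u where u: "u \<in> dom_A N b k" "f = op_A N b u" by blast
  have uL: "u \<in> L2 0 len" using u(1) sobolev_L2 dom_A_iff by blast
  have "block_op N R u \<in> range_space k"
    using u(1) by (auto simp: range_space_def S_R[OF uL] dom_A_iff)
  then show "f \<in> (\<lambda>w. - weak_deriv 0 len 2 w) ` range_space k"
    using u(2) op_A_eq[OF uL] by blast
next
  fix f assume "f \<in> (\<lambda>w. - weak_deriv 0 len 2 w) ` range_space k"
  then obtain w where w: "w \<in> sobolev 0 len (k + 2)" "block_op N S w \<in> dom_A N b k" "f = - weak_deriv 0 len 2 w"
    by (auto simp: range_space_def)
  have wL: "w \<in> L2 0 len" using w(1) by (rule sobolev_L2)
  have "op_A N b (block_op N S w) = f"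
    using w(3) by (simp add: op_A_eq[OF block_op_L2[OF wL]] R_S[OF wL])
  with w(2) show "f \<in> op_A N b ` dom_A N b k" by blast
qed

text \<open>If \<open>(R u)'' = 0\<close> then \<open>R u'' = 0\<close>, so \<open>u\<close> is affine and vanishes at both ends.\<close>
lemma dom_A_injective:
  assumes u: "u \<in> dom_A N b k" and z: "weak_deriv 0 len 2 (block_op N R u) = 0"
  shows "u = 0"
proof -
  have us: "u \<in> sobolev 0 len (k + 2)" and tr: "ae_value 0 len u 0 = 0" "ae_value 0 len u len = 0"
    using u by (auto simp: dom_A_iff)
  have "block_op N R (weak_deriv 0 len 2 u) = 0"
    using dom_A_weak_deriv[OF u, of 2] z by simp
  then have u2: "weak_deriv 0 len 2 u = 0"
    using S_R[OF sobolev_weak_deriv(1)[OF us, of 2]] by (simp add: block_op_zero)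
  have len: "0 < len" by simp
  obtain e l where el: "D1 0 len e 0" "D1 0 len l e" "ae_value 0 len e 0 = (1::'a)" "ae_value 0 len e len = 1"
    "ae_value 0 len l 0 = 0" "ae_value 0 len l len = of_real (len - 0)"
    by (rule affine_functions[OF len])
  let ?c = "ae_value 0 len (weak_deriv 0 len 1 u) 0"
  have ul: "u = ae_smult ?c l"
    using affine_span[OF len el(1,3,2,5) us u2] tr by simp
  have "ae_value 0 len (ae_smult ?c l) len = ?c * of_real len"
    using ae_value_smult[OF len _ el(2), of len ?c] el(6) by simp
  then have "?c * of_real len = 0" using tr(2) ul by simp
  then have "?c = 0"
    by (simp only: mult_eq_0_iff of_real_eq_0_iff) simp
  with ul show ?thesis by simp
qed

text \<open>Injectivity of A seen from the side of w = R_Q u. It lets the passage from w to - w''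
  lower the codimension by exactly 2.\<close>

lemma range_space_affine:
  assumes "w \<in> range_space k" "weak_deriv 0 len 2 w = 0" shows "w = 0"
proof -
  have w: "w \<in> L2 0 len" "block_op N S w \<in> dom_A N b k"
    using assms(1) sobolev_L2 by (auto simp: range_space_def)
  have "block_op N S w = 0"
    by (rule dom_A_injective[OF w(2)]) (simp add: R_S[OF w(1)] assms(2))
  then show ?thesis using R_S[OF w(1)] by (simp add: block_op_zero)
qed

lemma kernel_op_A: "kernel_on (dom_A N b k) (op_A N b) = {0}"
proof -
  have "u = 0" if "u \<in> dom_A N b k" "op_A N b u = 0" for u
    using that dom_A_injective[OF that(1)] op_A_eq[of u] sobolev_L2 by (auto simp: dom_A_iff)
  moreover have "(0 :: 'a ae_fun) \<in> dom_A N b k" by (rule ae.subspace_0[OF dom_A_subspace])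
  moreover have "op_A N b (0 :: 'a ae_fun) = 0"
    by (simp add: op_A_eq[OF L2_zero] block_op_zero weak_deriv_zero)
  ultimately show ?thesis by (auto simp: kernel_on_def)
qed

text \<open>The number in the index is the order of the derivative; the flag chooses between the
  pivot jump (\<open>True\<close>) and the left end value (\<open>False\<close>).\<close>

definition trace_functional :: "nat \<times> bool \<Rightarrow> 'a::{real_normed_field, euclidean_space} ae_fun \<Rightarrow> 'a" where
  "trace_functional i w = (if snd i then block_jump N S (traces (fst i) w) pivot else left_end (traces (fst i) w))"

text \<open>In the dependent case the one index with flag \<open>False\<close> is the Dirichlet
  condition; in the independent case that condition is already among those required for the jumps to
  vanish.\<close>

definition functional_indices :: "nat \<Rightarrow> (nat \<times> bool) set" where
  "functional_indices k = {..k+1} \<times> {True} \<union> (if ends_independent then {..k+1} else {0}) \<times> {False}"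

lemma Ball_functional_indices:
  "(\<forall>i\<in>functional_indices k. P i) \<longleftrightarrow>
    (\<forall>\<mu>\<le>k+1. P (\<mu>, True)) \<and> P (0, False) \<and> (ends_independent \<longrightarrow> (\<forall>\<mu>\<le>k+1. P (\<mu>, False)))"
  unfolding functional_indices_def ball_Un by (auto split: if_splits)

text \<open>The count is written as the final codimension plus 2, the dimension of the affine
  functions that are split off later.\<close>

lemma functional_indices:
  "finite (functional_indices k)" "i \<in> functional_indices k \<Longrightarrow> fst i \<le> k + 1"
  "card (functional_indices k) = (if ends_independent then 2 * (k + 1) else k + 1) + 2"
proof -
  show "finite (functional_indices k)" "i \<in> functional_indices k \<Longrightarrow> fst i \<le> k + 1"
    by (auto simp: functional_indices_def split: if_splits)
  have "card (functional_indices k) =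
      card ({..k+1} \<times> {True}) + card ((if ends_independent then {..k+1} else {0::nat}) \<times> {False})"
    unfolding functional_indices_def by (rule card_Un_disjoint) auto
  then show "card (functional_indices k) = (if ends_independent then 2 * (k + 1) else k + 1) + 2"
    by (simp add: card_cartesian_product)
qed

lemma trace_functional_linear:
  assumes u: "u \<in> sobolev 0 len (k + 2)" and v: "v \<in> sobolev 0 len (k + 2)" and i: "fst i \<le> k + 1"
  shows "trace_functional i (u + v) = trace_functional i u + trace_functional i v"
    "trace_functional i (ae_smult c u) = c * trace_functional i u"
proof -
  have D: "D1 0 len (weak_deriv 0 len (fst i) u) (weak_deriv 0 len (Suc (fst i)) u)"
    "D1 0 len (weak_deriv 0 len (fst i) v) (weak_deriv 0 len (Suc (fst i)) v)"
    using u v i by (auto intro: sobolev_D1)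
  have add: "traces (fst i) (u + v) j = traces (fst i) u j + traces (fst i) v j" if "j \<le> Suc N" for j
    using i that sobolev_add(2)[OF u v, of "fst i"] ae_value_add[OF _ _ D, of "real j"] by simp
  have scale: "traces (fst i) (ae_smult c u) j = c * traces (fst i) u j" if "j \<le> Suc N" for j
    using i that sobolev_smult(2)[OF u, of "fst i" c] ae_value_smult[OF _ _ D(1), of "real j" c] by simp
  show "trace_functional i (u + v) = trace_functional i u + trace_functional i v"
    using block_jump_cong[where B = S and i = pivot, OF add] block_row_cong[where N = N and B = S and i = 0, OF add[OF le_SucI]]
    by (simp add: trace_functional_def left_end_def block_jump_add block_row_add)
  show "trace_functional i (ae_smult c u) = c * trace_functional i u"
    using block_jump_cong[where B = S and i = pivot, OF scale] block_row_cong[where N = N and B = S and i = 0, OF scale[OF le_SucI]]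
    by (simp add: trace_functional_def left_end_def block_jump_scale block_row_scale)
qed

lemma quotient_basis_range_space:
  "\<exists>B. ae.quotient_basis (sobolev 0 len (k + 2)) (range_space k :: 'a::{real_normed_field, euclidean_space} ae_fun set) B
     \<and> card B = card (functional_indices k)"
proof -
  obtain p q :: "nat \<Rightarrow> 'a" where pq: "block_jump N S p pivot = 1" "left_end p = 0"
    "block_jump N S q pivot = 0" "left_end q = 1"
    by (rule dual_vectors)
  \<comment> \<open>Trace data of the dual family: a dual vector at the order named by the index,
    zero at all other orders.\<close>
  define c where "c i \<mu> = (if \<mu> = fst i then if snd i then p else q else (\<lambda>_. 0))" for i :: "nat \<times> bool" and \<mu>
  have "\<exists>w\<in>sobolev 0 len (k + 2). \<forall>\<mu><k+2. \<forall>j\<le>Suc N. traces \<mu> w j = c i \<mu> j" for i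
    by (rule trace_interpolation[of N "k + 2" "c i"]) blast
  then obtain e where e: "\<And>i. e i \<in> sobolev 0 len (k + 2)"
    "\<And>i \<mu> j. \<mu> < k + 2 \<Longrightarrow> j \<le> Suc N \<Longrightarrow> traces \<mu> (e i) j = c i \<mu> j"
    by metis
  have zero: "block_jump N S (\<lambda>_. 0) pivot = (0::'a)" "left_end (\<lambda>_. 0) = (0::'a)"
    by (simp_all add: block_jump_def left_end_def block_row_def)
  show ?thesis
  proof (rule ae.quotient_basis_kernel[where h = trace_functional and e = e])
    show "trace_functional i (u + v) = trace_functional i u + trace_functional i v"
      if "i \<in> functional_indices k" "u \<in> sobolev 0 len (k + 2)" "v \<in> sobolev 0 len (k + 2)" for i and u v :: "'a ae_fun"
      using that trace_functional_linear(1) functional_indices(2) by blast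
    show "trace_functional i (ae_smult c u) = c * trace_functional i u"
      if "i \<in> functional_indices k" "u \<in> sobolev 0 len (k + 2)" for i c and u :: "'a ae_fun"
      using that trace_functional_linear(2) functional_indices(2) by blast
    show "trace_functional i (e j) = (if i = j then 1 else 0)"
      if "i \<in> functional_indices k" "j \<in> functional_indices k" for i j
    proof -
      have le: "fst i < k + 2" using functional_indices(2)[OF that(1)] by simp
      have "block_jump N S (traces (fst i) (e j)) pivot = block_jump N S (c j (fst i)) pivot"
        "left_end (traces (fst i) (e j)) = left_end (c j (fst i))"
        unfolding left_end_def
        by (rule block_jump_cong, simp add: e(2)[OF le], rule block_row_cong, simp add: e(2)[OF le])
      then show ?thesis
        using pq zero by (cases i; cases j) (auto simp: trace_functional_def c_def)
    qed
    show "(range_space k :: 'a ae_fun set) = {w \<in> sobolev 0 len (k + 2). \<forall>i\<in>functional_indices k. trace_functional i w = 0}"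
    proof (rule Set.set_eqI)
      fix w :: "'a ae_fun"
      show "w \<in> range_space k \<longleftrightarrow>
          w \<in> {w \<in> sobolev 0 len (k + 2). \<forall>i\<in>functional_indices k. trace_functional i w = 0}"
      proof (cases "w \<in> sobolev 0 len (k + 2)")
        case True
        have "w \<in> range_space k \<longleftrightarrow> (\<forall>i\<in>functional_indices k. trace_functional i w = 0)"
          unfolding range_space_iff[OF True] Ball_functional_indices trace_functional_def by simp
        with True show ?thesis by (simp only: mem_Collect_eq simp_thms)
      next
        case False
        then show ?thesis by (simp add: range_space_def)
      qed
    qed
  qed (use e(1) functional_indices(1) sobolev_subspace in auto)
qed

text \<open>The map w -> - w'' takes W^{k+2} onto W^k and \<open>range_space k\<close> onto the
  range of A, and its kernel is spanned by two affine functions; \<open>quotient_basis_image\<close>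
  then subtracts 2.\<close>

lemma quotient_basis_op_A:
  "\<exists>B. ae.quotient_basis (sobolev 0 len k) (op_A N b ` (dom_A N b k :: 'a::{real_normed_field, euclidean_space} ae_fun set)) B
     \<and> card B = (if ends_independent then 2 * (k + 1) else k + 1)"
proof -
  let ?V = "sobolev 0 len (k + 2) :: 'a ae_fun set" and ?T = "\<lambda>w :: 'a ae_fun. - weak_deriv 0 len 2 w"
  obtain B where B: "ae.quotient_basis ?V (range_space k) B" "card B = card (functional_indices k)"
    using quotient_basis_range_space by blast
  have len: "0 < len" by simp
  obtain e l where el: "D1 0 len e 0" "D1 0 len l e" "ae_value 0 len e 0 = (1::'a)" "ae_value 0 len e len = 1"
    "ae_value 0 len l 0 = 0" "ae_value 0 len l len = of_real (len - 0)"
    by (rule affine_functions[OF len])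
  have "e \<noteq> l" using el by auto
  have eV: "e \<in> sobolev 0 len m" for m
    using sobolev_mono[of e 0 len "Suc m" m] sobolev_Suc_iff[of e 0 len m] el(1) sobolev_zero by auto
  have lV: "l \<in> sobolev 0 len m" for m
    using sobolev_mono[of l 0 len "Suc m" m] sobolev_Suc_iff[of l 0 len m] el(2) eV by auto
  have e1: "weak_deriv 0 len (Suc j) e = 0" for j
    using weak_deriv_Suc[OF el(1) sobolev_zero, of j j] by (simp add: weak_deriv_zero)
  have e2: "weak_deriv 0 len 2 e = 0" "weak_deriv 0 len 2 l = 0"
    using e1[of 1] e1[of 0] weak_deriv_Suc[OF el(2) eV, of 1 1] by (simp_all add: numeral_2_eq_2)
  have sum: "(\<Sum>b\<in>{e, l}. ae_smult (c b) b) = ae_smult (c e) e + ae_smult (c l) l" for c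
    using \<open>e \<noteq> l\<close> by simp
  have "\<exists>B'. ae.quotient_basis (?T ` ?V) (?T ` range_space k) B' \<and> card B' = card B - card {e, l}"
  proof (rule ae.quotient_basis_image[OF B(1) sobolev_subspace range_space_subspace])
    show "range_space k \<subseteq> ?V" by (auto simp: range_space_def)
    show "?T (u + v) = ?T u + ?T v" if "u \<in> ?V" "v \<in> ?V" for u v
      using that by (simp add: sobolev_add(2))
    show "?T (ae_smult c u) = ae_smult c (?T u)" if "u \<in> ?V" for c u
      using that by (simp add: sobolev_smult(2))
    show "{e, l} \<subseteq> ?V" using eV lV by simp
    show "?T p = 0" if "p \<in> {e, l}" for p using that e2 by auto
    show "\<exists>c. v = (\<Sum>b\<in>{e, l}. ae_smult (c b) b)" if "v \<in> ?V" "?T v = 0" for v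
    proof -
      have "weak_deriv 0 len 2 v = 0" using that(2) by simp
      from affine_span[OF len el(1,3,2,5) that(1) this] \<open>e \<noteq> l\<close> show ?thesis
        unfolding sum
        by (intro exI[of _ "\<lambda>x. if x = e then ae_value 0 len v 0 else ae_value 0 len (weak_deriv 0 len 1 v) 0"]) simp
    qed
    \<comment> \<open>An affine function in \<open>range_space k\<close> is zero; its values at 0
      and N+1 then yield the two coefficients.\<close>
    show "c x = 0" if c: "(\<Sum>b\<in>{e, l}. ae_smult (c b) b) \<in> range_space k" and x: "x \<in> {e, l}" for c x
    proof -
      let ?w = "ae_smult (c e) e + ae_smult (c l) l"
      have ce: "ae_smult (c e) e \<in> sobolev 0 len 2" "ae_smult (c l) l \<in> sobolev 0 len 2"
        by (intro sobolev_smult(1) eV lV)+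
      have "weak_deriv 0 len 2 ?w = 0"
        using sobolev_add(2)[OF ce, of 2] sobolev_smult(2)[OF eV[of 2], of 2 "c e"]
          sobolev_smult(2)[OF lV[of 2], of 2 "c l"] e2 by simp
      then have w0: "?w = 0" using range_space_affine c unfolding sum by blast
      have tr: "ae_value 0 len ?w y = c e * ae_value 0 len e y + c l * ae_value 0 len l y" if "y \<in> {0..len}" for y
        using ae_value_add[OF len that D1_smult[OF el(1)] D1_smult[OF el(2)]]
          ae_value_smult[OF len that el(1)] ae_value_smult[OF len that el(2)] by simp
      have tr0: "c e * ae_value 0 len e y + c l * ae_value 0 len l y = 0" if "y \<in> {0..len}" for y
        using tr[OF that] ae_value_zero[OF len that, where 'a = 'a] unfolding w0 by simp
      have "c e = 0" using tr0[of 0] el(3,5) by simp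
      moreover from this have "c l * of_real len = 0" using tr0[of len] el(6) by simp
      then have "c l = 0"
        by (simp only: mult_eq_0_iff of_real_eq_0_iff) simp
      ultimately show ?thesis using x by auto
    qed
  qed simp
  moreover have "?T ` ?V = sobolev 0 len k"
  proof (intro equalityI subsetI)
    fix f assume "f \<in> ?T ` ?V"
    then show "f \<in> sobolev 0 len k"
      using sobolev_weak_deriv_2(1) ae.subspace_neg[OF sobolev_subspace] by blast
  next
    fix f :: "'a ae_fun" assume "f \<in> sobolev 0 len k"
    then have "- f \<in> sobolev 0 len k" by (rule ae.subspace_neg[OF sobolev_subspace])
    then obtain w where "w \<in> ?V" "weak_deriv 0 len 2 w = - f" by (rule second_antiderivative[OF len])
    then show "f \<in> ?T ` ?V" by (intro image_eqI[of _ _ w]) auto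
  qed
  moreover have "card B - card {e, l} = (if ends_independent then 2 * (k + 1) else k + 1)"
    using B(2) \<open>e \<noteq> l\<close> by (simp add: functional_indices(3))
  ultimately show ?thesis by (metis op_A_image)
qed

end

section \<open>Closedness\<close>

text \<open>Traces are continuous in the norm of W^1: integration by parts with t - a leaves only
  the value at b, with t - b only the value at a.\<close>

lemma ae_value_tendsto:
  assumes "a < b" and DU: "\<And>n. D1 a b (U n) (V n)" and D: "D1 a b u v"
    and lim: "(\<lambda>n. L2_norm (U n - u)) \<longlonglongrightarrow> 0" "(\<lambda>n. L2_norm (V n - v)) \<longlonglongrightarrow> 0"
  shows "(\<lambda>n. ae_value a b (U n) a) \<longlonglongrightarrow> ae_value a b u a" "(\<lambda>n. ae_value a b (U n) b) \<longlonglongrightarrow> ae_value a b u b"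
proof -
  have L: "U n \<in> L2 a b" "V n \<in> L2 a b" "u \<in> L2 a b" "v \<in> L2 a b" for n
    using DU D by (auto simp: D1_def)
  have ibp: "\<phi> b *\<^sub>R ae_value a b w b - \<phi> a *\<^sub>R ae_value a b w a = pairing \<phi>' w + pairing \<phi> z"
    if "D1 a b w z" "\<And>x. (\<phi> has_field_derivative \<phi>' x) (at x)" "continuous_on UNIV \<phi>'" for w z \<phi> \<phi>'
    using D1_integration_by_parts[OF \<open>a < b\<close> that(1) _ _ _ that(2,3), of a b] \<open>a < b\<close> that(1)
    by (simp add: D1_def L2_restr_eq)
  have lim': "(\<lambda>n. \<phi> b *\<^sub>R ae_value a b (U n) b - \<phi> a *\<^sub>R ae_value a b (U n) a) \<longlonglongrightarrow>
      \<phi> b *\<^sub>R ae_value a b u b - \<phi> a *\<^sub>R ae_value a b u a"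
    if \<phi>: "\<And>x. (\<phi> has_field_derivative \<phi>' x) (at x)" "continuous_on UNIV \<phi>'" for \<phi> \<phi>'
  proof -
    have c: "continuous_on UNIV \<phi>" by (rule DERIV_continuous_on[OF has_field_derivative_at_within[OF \<phi>(1)]])
    show ?thesis
      unfolding ibp[OF DU \<phi>] ibp[OF D \<phi>]
      by (intro tendsto_add pairing_tendsto[OF \<phi>(2) L(1,3) lim(1)] pairing_tendsto[OF c L(2,4) lim(2)])
  qed
  have d: "((\<lambda>t. t - y) has_field_derivative 1) (at x)" for x y :: real
    by (auto intro!: derivative_eq_intros)
  have "(\<lambda>n. (b - a) *\<^sub>R ae_value a b (U n) b) \<longlonglongrightarrow> (b - a) *\<^sub>R ae_value a b u b"
    using lim'[OF d continuous_on_const, of a] by (simp only: diff_self scaleR_zero_left diff_0_right)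
  then have "(\<lambda>n. inverse (b - a) *\<^sub>R (b - a) *\<^sub>R ae_value a b (U n) b) \<longlonglongrightarrow> inverse (b - a) *\<^sub>R (b - a) *\<^sub>R ae_value a b u b"
    by (rule tendsto_scaleR[OF tendsto_const])
  moreover have "inverse (b - a) *\<^sub>R (b - a) *\<^sub>R y = y" for y :: 'a
    using \<open>a < b\<close> by simp
  ultimately show "(\<lambda>n. ae_value a b (U n) b) \<longlonglongrightarrow> ae_value a b u b" by (simp only:)
  have "(\<lambda>n. - ((a - b) *\<^sub>R ae_value a b (U n) a)) \<longlonglongrightarrow> - ((a - b) *\<^sub>R ae_value a b u a)"
    using lim'[OF d continuous_on_const, of b] by (simp only: diff_self scaleR_zero_left diff_0)
  then have "(\<lambda>n. inverse (b - a) *\<^sub>R - ((a - b) *\<^sub>R ae_value a b (U n) a)) \<longlonglongrightarrow> inverse (b - a) *\<^sub>R - ((a - b) *\<^sub>R ae_value a b u a)"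
    by (rule tendsto_scaleR[OF tendsto_const])
  moreover have "inverse (b - a) *\<^sub>R - ((a - b) *\<^sub>R y) = y" for y :: 'a
  proof -
    have "inverse (b - a) *\<^sub>R - ((a - b) *\<^sub>R y) = inverse (b - a) *\<^sub>R ((b - a) *\<^sub>R y)"
      by (simp add: scaleR_left_diff_distrib)
    then show ?thesis using \<open>a < b\<close> by simp
  qed
  ultimately show "(\<lambda>n. ae_value a b (U n) a) \<longlonglongrightarrow> ae_value a b u a" by (simp only:)
qed

text \<open>A Poincare inequality. The value at t is the integral of \<open>v\<close> over (a,t),
  bounded by the norm of \<open>v\<close> uniformly in t; squaring and integrating gives the factor
  sqrt (b - a).\<close>

lemma D1_norm_bound:
  assumes "a < b"
  obtains C where "\<And>u v :: 'a::{real_normed_field, euclidean_space} ae_fun.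
    D1 a b u v \<Longrightarrow> ae_value a b u a = 0 \<Longrightarrow> L2_norm u \<le> C * L2_norm v"
proof -
  obtain M where M: "\<And>u :: 'a ae_fun. u \<in> L2 a b \<Longrightarrow> norm (pairing (\<lambda>_. 1) u) \<le> M * L2_norm u"
    using pairing_bound[OF continuous_on_const] by blast
  define M' where "M' = max M 0"
  have M': "norm (pairing (\<lambda>_. 1) u) \<le> M' * L2_norm u" if "u \<in> L2 a b" for u :: "'a ae_fun"
    using M[OF that] mult_right_mono[OF max.cobounded1[of M 0] L2_norm_nonneg[of u]] unfolding M'_def by linarith
  have "M' \<ge> 0" by (simp add: M'_def)
  have "L2_norm u \<le> (sqrt (b - a) * M') * L2_norm v" if D: "D1 a b u v" "ae_value a b u a = 0" for u v :: "'a ae_fun"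
  proof -
    have v: "v \<in> L2 a b" using D by (simp add: D1_def)
    obtain f where f: "L2_rep a b f v" using v L2_obtain by blast
    obtain C where C: "continuous_rep a b u (\<lambda>t. C + prim f t)"
      "L2_rep a b (\<lambda>t. if t \<in> {a<..<b} then C + prim f t else 0) u"
      using D1_rep[OF \<open>a < b\<close> D(1) f] by blast
    have pt: "norm (C + prim f t) \<le> M' * L2_norm v" if t: "t \<in> {a<..<b}" for t
    proof -
      have "C + prim f t = ae_value a b u t"
        using ae_value_eq[OF \<open>a < b\<close> C(1), of t] t by simp
      also have "\<dots> = pairing (\<lambda>_. 1) (restr a t v)"
        using D1_increment[OF \<open>a < b\<close> D(1), of a t] D(2) t by simp
      finally have "norm (C + prim f t) \<le> M' * L2_norm (restr a t v)"
        using M'[OF restr_L2[OF v]] by simp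
      also have "\<dots> \<le> M' * L2_norm v"
        by (intro mult_left_mono L2_norm_restr[OF v] \<open>M' \<ge> 0\<close>)
      finally show ?thesis .
    qed
    have "(L2_norm u)\<^sup>2 \<le> (LINT t|lborel. indicator {a<..<b} t * (M' * L2_norm v)\<^sup>2)"
      unfolding L2_norm_rep[OF C(2)]
    proof (intro integral_mono L2_repD(4)[OF C(2)])
      show "integrable lborel (\<lambda>t. indicator {a<..<b} t * (M' * L2_norm v)\<^sup>2)"
        using \<open>a < b\<close> by (intro integrable_mult_left) (simp add: integrable_indicator_iff)
      show "(norm (if t \<in> {a<..<b} then C + prim f t else 0))\<^sup>2 \<le> indicator {a<..<b} t * (M' * L2_norm v)\<^sup>2" for t
        using pt[of t] by (auto intro!: power_mono)
    qed
    also have "\<dots> = (sqrt (b - a) * M' * L2_norm v)\<^sup>2"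
      using \<open>a < b\<close> by (simp add: power_mult_distrib mult_ac)
    finally have "(L2_norm u)\<^sup>2 \<le> (sqrt (b - a) * M' * L2_norm v)\<^sup>2" .
    then show ?thesis
      by (rule power2_le_imp_le) (use \<open>M' \<ge> 0\<close> \<open>a < b\<close> L2_norm_nonneg[of v] in simp)
  qed
  then show ?thesis by (rule that)
qed

lemma L2_limit_unique:
  assumes "\<And>n. U n \<in> L2 a b" "u \<in> L2 a b" "v \<in> L2 a b"
    "(\<lambda>n. L2_norm (U n - u)) \<longlonglongrightarrow> 0" "(\<lambda>n. L2_norm (U n - v)) \<longlonglongrightarrow> 0"
  shows "u = v"
proof -
  have "L2_norm (u - v) \<le> L2_norm (U n - u) + L2_norm (U n - v)" for n
    using L2_norm_triangle[OF L2_neg[OF L2_diff[OF assms(1,2)]] L2_diff[OF assms(1,3)], of n n]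
      L2_norm_minus[OF L2_diff[OF assms(1,2)], of n] by simp
  moreover have "(\<lambda>n. L2_norm (U n - u) + L2_norm (U n - v)) \<longlonglongrightarrow> 0 + 0"
    by (intro tendsto_add assms)
  ultimately have "L2_norm (u - v) \<le> 0"
    by (intro LIMSEQ_le_const[of _ 0]) auto
  then have "u - v = 0"
    using L2_norm_nonneg[of "u - v"] by (intro L2_norm_eq_0[OF L2_diff[OF assms(2,3)]]) simp
  then show ?thesis by simp
qed

lemma block_op_tendsto:
  assumes U: "\<And>n. U n \<in> L2 a b" "u \<in> L2 a b" "(\<lambda>n. L2_norm (U n - u)) \<longlonglongrightarrow> 0"
  shows "(\<lambda>n. L2_norm (block_op N B (U n) - block_op N B u)) \<longlonglongrightarrow> 0"
proof (rule tendsto_sandwich[of "\<lambda>_. 0"])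
  show "eventually (\<lambda>n. L2_norm (block_op N B (U n) - block_op N B u) \<le> (\<Sum>i\<le>N. \<Sum>k\<le>N. \<bar>B i k\<bar>) * L2_norm (U n - u)) sequentially"
    using L2_norm_block_op[OF L2_diff[OF U(1,2)], of N B] by (simp add: block_op_diff)
  show "(\<lambda>n. (\<Sum>i\<le>N. \<Sum>k\<le>N. \<bar>B i k\<bar>) * L2_norm (U n - u)) \<longlonglongrightarrow> 0"
    using tendsto_mult_right_zero[OF U(3)] by simp
qed (simp_all add: L2_norm_nonneg)

subsection \<open>The norm topology of Sobolev spaces\<close>

lemma sobolev_norm_L2_set:
  "sobolev_norm a b k u = L2_set (\<lambda>j. L2_norm (weak_deriv a b j u)) {..k}"
  by (simp add: sobolev_norm_def L2_set_def)

lemma weak_deriv_norm_le: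
  assumes "j \<le> k" shows "L2_norm (weak_deriv a b j u) \<le> sobolev_norm a b k u"
  unfolding sobolev_norm_L2_set by (rule member_le_L2_set) (use assms in auto)

lemma has_weak_deriv_minus: "has_weak_deriv a b j (- u) (- v) \<longleftrightarrow> has_weak_deriv a b j u v"
  by transfer simp

text \<open>Metric spaces require symmetry of the distance outside the carrier as well, where weak derivatives
  need not exist.\<close>
lemma L2_norm_weak_deriv_minus: "L2_norm (weak_deriv a b j (- u)) = L2_norm (weak_deriv a b j u)"
proof (cases "\<exists>v\<in>L2 a b. has_weak_deriv a b j u v")
  case True
  then obtain v where v: "v \<in> L2 a b" "has_weak_deriv a b j u v" by blast
  then have "has_weak_deriv a b j (- u) (- v)" by (simp add: has_weak_deriv_minus)
  then have "weak_deriv a b j (- u) = - v" "weak_deriv a b j u = v"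
    unfolding weak_deriv_def
    using has_weak_deriv_unique v L2_neg[OF v(1)] by (intro the_equality; blast)+
  then show ?thesis using v(1) by (simp add: L2_norm_minus)
next
  case False
  have "\<not> (\<exists>v\<in>L2 a b. has_weak_deriv a b j (- u) v)"
  proof
    assume "\<exists>v\<in>L2 a b. has_weak_deriv a b j (- u) v"
    then obtain v where "v \<in> L2 a b" "has_weak_deriv a b j (- u) v" by blast
    then have "- v \<in> L2 a b" "has_weak_deriv a b j u (- v)"
      using has_weak_deriv_minus[of a b j u "- v"] by (simp_all add: L2_neg)
    with False show False by blast
  qed
  with False have "(\<lambda>w. w \<in> L2 a b \<and> has_weak_deriv a b j (- u) w) = (\<lambda>w. w \<in> L2 a b \<and> has_weak_deriv a b j u w)"
    by blast
  then show ?thesis by (simp add: weak_deriv_def)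
qed

text \<open>The Sobolev norm is the Euclidean norm \<open>L2_set\<close> of the L_2 norms of the
  derivatives, so the triangle inequality is Minkowski's inequality used once in L_2 and once for
  finite sequences.\<close>

lemma sobolev_metric:
  "Metric_space (sobolev a b k) (\<lambda>x y :: 'a::{real_normed_field, euclidean_space} ae_fun. sobolev_norm a b k (x - y))"
proof
  fix x y z :: "'a ae_fun"
  show "0 \<le> sobolev_norm a b k (x - y)" by (simp add: sobolev_norm_L2_set L2_set_nonneg)
  note sub = sobolev_subspace
  show comm: "sobolev_norm a b k (x - y) = sobolev_norm a b k (y - x)"
    using L2_norm_weak_deriv_minus[of a b _ "x - y"] by (simp add: sobolev_norm_L2_set)
  assume x: "x \<in> sobolev a b k" and y: "y \<in> sobolev a b k"
  have xy: "x - y \<in> sobolev a b k" by (rule ae.subspace_diff[OF sub x y])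
  show "sobolev_norm a b k (x - y) = 0 \<longleftrightarrow> x = y"
  proof
    assume "sobolev_norm a b k (x - y) = 0"
    then have "L2_norm (x - y) = 0"
      using weak_deriv_norm_le[of 0 k a b "x - y"] weak_deriv_0[OF sobolev_L2[OF xy]] L2_norm_nonneg[of "x - y"] by simp
    then show "x = y" using L2_norm_eq_0[OF sobolev_L2[OF xy]] by simp
  next
    assume "x = y"
    then show "sobolev_norm a b k (x - y) = 0"
      by (simp add: sobolev_norm_L2_set L2_norm_zero weak_deriv_zero L2_set_def)
  qed
  assume z: "z \<in> sobolev a b k"
  have yz: "y - z \<in> sobolev a b k" by (rule ae.subspace_diff[OF sub y z])
  have "L2_norm (weak_deriv a b j (x - z)) \<le> L2_norm (weak_deriv a b j (x - y)) + L2_norm (weak_deriv a b j (y - z))"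
    if "j \<le> k" for j
    using sobolev_add(2)[OF xy yz that]
      L2_norm_triangle[OF sobolev_weak_deriv(1)[OF xy that] sobolev_weak_deriv(1)[OF yz that]] by simp
  then have "sobolev_norm a b k (x - z) \<le>
      L2_set (\<lambda>j. L2_norm (weak_deriv a b j (x - y)) + L2_norm (weak_deriv a b j (y - z))) {..k}"
    unfolding sobolev_norm_L2_set by (intro L2_set_mono) (auto simp: L2_norm_nonneg)
  also have "\<dots> \<le> sobolev_norm a b k (x - y) + sobolev_norm a b k (y - z)"
    unfolding sobolev_norm_L2_set by (rule L2_set_triangle_ineq)
  finally show "sobolev_norm a b k (x - z) \<le> sobolev_norm a b k (x - y) + sobolev_norm a b k (y - z)" .
qed

lemma L2_norm_minus_diff: "x \<in> L2 a b \<Longrightarrow> y \<in> L2 a b \<Longrightarrow> L2_norm (- x - - y) = L2_norm (x - y)"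
  using L2_norm_minus[OF L2_diff, of x a b y] by (simp add: algebra_simps)

lemma closedin_norm_topology:
  fixes nrm :: "'a::ab_group_add \<Rightarrow> real"
  assumes "Metric_space V (\<lambda>x y. nrm (x - y))"
  shows "closedin (norm_topology V nrm) S \<longleftrightarrow> S \<subseteq> V \<and>
    (\<forall>\<sigma> l. range \<sigma> \<subseteq> S \<and> l \<in> V \<and> (\<lambda>n. nrm (\<sigma> n - l)) \<longlonglongrightarrow> 0 \<longrightarrow> l \<in> S)"
proof -
  interpret Metric_space V "\<lambda>x y. nrm (x - y)" by fact
  have "range \<sigma> \<subseteq> S \<and> l \<in> V \<and> (\<forall>\<^sub>F n in sequentially. \<sigma> n \<in> V) \<and> (\<lambda>n. nrm (\<sigma> n - l)) \<longlonglongrightarrow> 0 \<longleftrightarrow>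
      range \<sigma> \<subseteq> S \<and> l \<in> V \<and> (\<lambda>n. nrm (\<sigma> n - l)) \<longlonglongrightarrow> 0" if "S \<subseteq> V" for \<sigma> :: "nat \<Rightarrow> 'a" and l
    using that by (auto intro!: always_eventually)
  then show ?thesis
    unfolding norm_topology_def metric_closedin_iff_sequentially_closed limitin_metric_dist_null
    by (cases "S \<subseteq> V") simp_all
qed

text \<open>Convergence in the product of two metric topologies is componentwise, which reduces
  closedness of the graph to the usual statement about sequences.\<close>

lemma closedin_graph_norm_topology:
  assumes "Metric_space V (\<lambda>x y. nV (x - y))" "Metric_space W (\<lambda>x y. nW (x - y))"
    and D: "D \<subseteq> V" "T ` D \<subseteq> W"
    and lim: "\<And>\<sigma> u f. (\<And>n. \<sigma> n \<in> D) \<Longrightarrow> u \<in> V \<Longrightarrow> f \<in> W \<Longrightarrow> (\<lambda>n. nV (\<sigma> n - u)) \<longlonglongrightarrow> 0 \<Longrightarrow>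
      (\<lambda>n. nW (T (\<sigma> n) - f)) \<longlonglongrightarrow> 0 \<Longrightarrow> u \<in> D \<and> T u = f"
  shows "closedin (prod_topology (norm_topology V nV) (norm_topology W nW)) ((\<lambda>u. (u, T u)) ` D)"
proof -
  interpret Metric_space12 V "\<lambda>x y. nV (x - y)" W "\<lambda>x y. nW (x - y)"
    unfolding Metric_space12_def using assms by blast
  have "closedin Prod_metric.mtopology ((\<lambda>u. (u, T u)) ` D)"
    unfolding Prod_metric.metric_closedin_iff_sequentially_closed
  proof (intro conjI allI impI)
    show "(\<lambda>u. (u, T u)) ` D \<subseteq> V \<times> W" using D by auto
    fix \<tau> l assume \<tau>: "range \<tau> \<subseteq> (\<lambda>u. (u, T u)) ` D \<and> limitin Prod_metric.mtopology \<tau> l sequentially"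
    define \<sigma> where "\<sigma> n = fst (\<tau> n)" for n
    have \<sigma>: "\<sigma> n \<in> D" "snd (\<tau> n) = T (\<sigma> n)" for n
    proof -
      have "\<tau> n \<in> (\<lambda>u. (u, T u)) ` D" using \<tau> by blast
      then show "\<sigma> n \<in> D" "snd (\<tau> n) = T (\<sigma> n)" by (auto simp: \<sigma>_def)
    qed
    have "limitin M1.mtopology (fst \<circ> \<tau>) (fst l) sequentially" "limitin M2.mtopology (snd \<circ> \<tau>) (snd l) sequentially"
      using \<tau> by (auto simp: mtopology_prod_metric limitin_pairwise)
    then have "fst l \<in> D \<and> T (fst l) = snd l"
      by (intro lim[of \<sigma>]) (auto simp: M1.limitin_metric_dist_null M2.limitin_metric_dist_null \<sigma> \<sigma>_def[symmetric])
    then show "l \<in> (\<lambda>u. (u, T u)) ` D" by (intro image_eqI[of _ _ "fst l"]) auto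
  qed
  then show ?thesis
    by (simp add: norm_topology_def mtopology_prod_metric)
qed

lemma sobolev_norm_tendsto:
  assumes "\<And>n. U n \<in> sobolev a b k" "u \<in> sobolev a b k" "(\<lambda>n. sobolev_norm a b k (U n - u)) \<longlonglongrightarrow> 0" "j \<le> k"
  shows "(\<lambda>n. L2_norm (weak_deriv a b j (U n) - weak_deriv a b j u)) \<longlonglongrightarrow> 0"
proof (rule tendsto_sandwich[of "\<lambda>_. 0"])
  show "eventually (\<lambda>n. L2_norm (weak_deriv a b j (U n) - weak_deriv a b j u) \<le> sobolev_norm a b k (U n - u)) sequentially"
    unfolding weak_deriv_diff[OF assms(1,2,4), symmetric]
    by (intro always_eventually allI weak_deriv_norm_le assms(4))
qed (use assms(3) in \<open>simp_all add: L2_norm_nonneg\<close>)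

text \<open>The limit solves \<open>v'' = z\<close> with zero boundary values: subtracting antiderivatives of \<open>z\<close> from \<open>u n\<close> leaves
  an error bounded by \<open>u n'' - z\<close>, up to an affine function whose slope is fixed by the value at \<open>b\<close>.\<close>
lemma dirichlet_problem_limit:
  fixes u :: "nat \<Rightarrow> 'a::{real_normed_field, euclidean_space} ae_fun"
  assumes "a < b" and u: "\<And>n. u n \<in> sobolev a b 2" "\<And>n. ae_value a b (u n) a = 0" "\<And>n. ae_value a b (u n) b = 0"
    and z: "z \<in> L2 a b" "(\<lambda>n. L2_norm (weak_deriv a b 2 (u n) - z)) \<longlonglongrightarrow> 0"
  obtains v w where "v \<in> L2 a b" "w \<in> L2 a b" "(\<lambda>n. L2_norm (u n - v)) \<longlonglongrightarrow> 0"
    "(\<lambda>n. L2_norm (weak_deriv a b 1 (u n) - w)) \<longlonglongrightarrow> 0"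
proof -
  have ab: "a \<in> {a..b}" "b \<in> {a..b}" using \<open>a < b\<close> by auto
  obtain e l :: "'a ae_fun" where el: "D1 a b e 0" "D1 a b l e" "ae_value a b e a = 1" "ae_value a b e b = 1"
    "ae_value a b l a = 0" "ae_value a b l b = of_real (b - a)"
    by (rule affine_functions[OF \<open>a < b\<close>])
  obtain C where C: "\<And>u v :: 'a ae_fun. D1 a b u v \<Longrightarrow> ae_value a b u a = 0 \<Longrightarrow> L2_norm u \<le> C * L2_norm v"
    using D1_norm_bound[OF \<open>a < b\<close>] by blast
  obtain w0 where w0: "D1 a b w0 z" "ae_value a b w0 a = 0" by (rule D1_ex[OF \<open>a < b\<close> z(1)])
  then have w0L: "w0 \<in> L2 a b" by (simp add: D1_def)
  obtain v0 where v0: "D1 a b v0 w0" "ae_value a b v0 a = 0" by (rule D1_ex[OF \<open>a < b\<close> w0L])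
  then have v0L: "v0 \<in> L2 a b" by (simp add: D1_def)
  have wd0: "weak_deriv a b 0 (u n) = u n" for n using u(1) sobolev_L2 weak_deriv_0 by blast
  have Du: "D1 a b (u n) (weak_deriv a b 1 (u n))" "D1 a b (weak_deriv a b 1 (u n)) (weak_deriv a b 2 (u n))" for n
    using sobolev_D1[OF u(1), of 0] sobolev_D1[OF u(1), of 1] wd0 by (simp_all add: numeral_2_eq_2)
  define c where "c n = ae_value a b (weak_deriv a b 1 (u n)) a" for n
  have scale_D: "D1 a b (ae_smult d e) 0" "D1 a b (ae_smult d l) (ae_smult d e)" for d
    using D1_smult[OF el(1), of d] D1_smult[OF el(2), of d] by simp_all
  have eL: "e \<in> L2 a b" and lL: "l \<in> L2 a b" using el by (auto simp: D1_def)
  have tr_diff: "ae_value a b (x - y) t = ae_value a b x t - ae_value a b y t"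
    if "D1 a b x x'" "D1 a b y y'" "t \<in> {a..b}" for x y x' y' :: "'a ae_fun" and t
    using ae_value_add[OF \<open>a < b\<close> that(3,1) D1_minus[OF that(2)]] ae_value_smult[OF \<open>a < b\<close> that(3,2), of "- 1"]
    by (simp add: ae_smult_minus_one)
  \<comment> \<open>Both errors vanish at \<open>a\<close>, the derivative of \<open>q n\<close> is
    \<open>p n\<close>, and that of \<open>p n\<close> is u n'' - z, so the Poincare bound applies
    twice. The slope to remove is u n'(a) because w0 vanishes at \<open>a\<close>.\<close>
  define p where "p n = weak_deriv a b 1 (u n) - w0 - ae_smult (c n) e" for n
  define q where "q n = u n - v0 - ae_smult (c n) l" for n
  have Dp: "D1 a b (p n) (weak_deriv a b 2 (u n) - z)" for n
    using D1_diff[OF D1_diff[OF Du(2) w0(1)] scale_D(1), of n "c n"] by (simp add: p_def)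
  have Dq: "D1 a b (q n) (p n)" for n
    using D1_diff[OF D1_diff[OF Du(1) v0(1)] scale_D(2), of n "c n"] by (simp add: p_def q_def)
  have pa: "ae_value a b (p n) a = 0" for n
    using tr_diff[OF D1_diff[OF Du(2) w0(1)] scale_D(1) ab(1), of n "c n"] tr_diff[OF Du(2) w0(1) ab(1), of n]
      ae_value_smult[OF \<open>a < b\<close> ab(1) el(1), of "c n"] by (simp add: p_def c_def w0(2) el(3))
  have qtr: "ae_value a b (q n) t = ae_value a b (u n) t - ae_value a b v0 t - c n * ae_value a b l t" if "t \<in> {a..b}" for n t
    using tr_diff[OF D1_diff[OF Du(1) v0(1)] scale_D(2) that, of n "c n"] tr_diff[OF Du(1) v0(1) that, of n]
      ae_value_smult[OF \<open>a < b\<close> that el(2), of "c n"] by (simp add: q_def)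
  have qa: "ae_value a b (q n) a = 0" for n
    using qtr[OF ab(1)] u(2) v0(2) el(5) by simp
  have to_0: "(\<lambda>n. L2_norm (p n)) \<longlonglongrightarrow> 0" "(\<lambda>n. L2_norm (q n)) \<longlonglongrightarrow> 0"
  proof -
    have "(\<lambda>n. C * L2_norm (weak_deriv a b 2 (u n) - z)) \<longlonglongrightarrow> 0"
      using tendsto_mult_right_zero[OF z(2)] .
    then show p0: "(\<lambda>n. L2_norm (p n)) \<longlonglongrightarrow> 0"
      by (rule tendsto_sandwich[OF _ _ tendsto_const, rotated 2]) (use C[OF Dp pa] in \<open>auto simp: L2_norm_nonneg\<close>)
    have "(\<lambda>n. C * L2_norm (p n)) \<longlonglongrightarrow> 0"
      using tendsto_mult_right_zero[OF p0] .
    then show "(\<lambda>n. L2_norm (q n)) \<longlonglongrightarrow> 0"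
      by (rule tendsto_sandwich[OF _ _ tendsto_const, rotated 2]) (use C[OF Dq qa] in \<open>auto simp: L2_norm_nonneg\<close>)
  qed
  have zero: "(\<lambda>n. L2_norm (0 - (0 :: 'a ae_fun))) \<longlonglongrightarrow> 0" by (simp add: L2_norm_zero)
  \<comment> \<open>As u n(b) = 0 and q n(b) tends to 0, the slopes can only tend to the solution d
    of v0(b) + d (b - a) = 0.\<close>
  define d where "d = - ae_value a b v0 b / of_real (b - a)"
  have "c \<longlonglongrightarrow> d"
  proof -
    have "(\<lambda>n. ae_value a b (q n) b) \<longlonglongrightarrow> ae_value a b (0 :: 'a ae_fun) b"
      using to_0 by (intro ae_value_tendsto(2)[OF \<open>a < b\<close> Dq D1_zero]) simp_all
    then have "(\<lambda>n. - ae_value a b v0 b - c n * of_real (b - a)) \<longlonglongrightarrow> 0"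
      using qtr[OF ab(2)] u(3) el(6) ae_value_zero[OF \<open>a < b\<close> ab(2), where 'a = 'a] by simp
    then have "(\<lambda>n. (- ae_value a b v0 b - (- ae_value a b v0 b - c n * of_real (b - a))) / of_real (b - a)) \<longlonglongrightarrow>
        (- ae_value a b v0 b - 0) / of_real (b - a)"
      by (intro tendsto_divide tendsto_diff tendsto_const) (use \<open>a < b\<close> in auto)
    then show ?thesis using \<open>a < b\<close> by (simp add: d_def)
  qed
  have scaled: "(\<lambda>n. L2_norm (x n + ae_smult (c n - d) y)) \<longlonglongrightarrow> 0"
    if "\<And>n. x n \<in> L2 a b" "y \<in> L2 a b" "(\<lambda>n. L2_norm (x n)) \<longlonglongrightarrow> 0" for x and y :: "'a ae_fun"
  proof (rule tendsto_sandwich[of "\<lambda>_. 0"])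
    show "eventually (\<lambda>n. L2_norm (x n + ae_smult (c n - d) y) \<le> L2_norm (x n) + norm (c n - d) * L2_norm y) sequentially"
      unfolding L2_norm_smult[OF that(2), symmetric]
      by (intro always_eventually allI L2_norm_triangle[OF that(1) L2_smult[OF that(2)]])
    have "(\<lambda>n. L2_norm (x n) + norm (c n - d) * L2_norm y) \<longlonglongrightarrow> 0 + 0 * L2_norm y"
      using \<open>c \<longlonglongrightarrow> d\<close> by (intro tendsto_add tendsto_mult that tendsto_const tendsto_norm_zero) (simp add: LIM_zero_iff)
    then show "(\<lambda>n. L2_norm (x n) + norm (c n - d) * L2_norm y) \<longlonglongrightarrow> 0" by simp
  qed (simp_all add: L2_norm_nonneg)
  have pL: "p n \<in> L2 a b" and qL: "q n \<in> L2 a b" for n using Dp Dq by (auto simp: D1_def)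
  have "(\<lambda>n. L2_norm (u n - (v0 + ae_smult d l))) \<longlonglongrightarrow> 0"
    using scaled[OF qL lL to_0(2)] by (simp add: q_def ae.scale_left_diff_distrib algebra_simps)
  moreover have "(\<lambda>n. L2_norm (weak_deriv a b 1 (u n) - (w0 + ae_smult d e))) \<longlonglongrightarrow> 0"
    using scaled[OF pL eL to_0(1)] by (simp add: p_def ae.scale_left_diff_distrib algebra_simps)
  ultimately show ?thesis
    by (intro that[of "v0 + ae_smult d l" "w0 + ae_smult d e"] L2_add L2_smult v0L w0L eL lL)
qed

section \<open>Closed graph and closed range of the operator\<close>

context singular_corner_toeplitz
begin

text \<open>\<open>U \<mu>\<close> is the L_2 limit of the derivatives of order \<mu>. The chains of
  u n and of R u n both pass to the limit, since R is bounded on L_2, and the boundary values follow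
  by continuity of traces. Closed graph and closed range share this argument.\<close>

lemma dom_A_limit:
  fixes u U :: "nat \<Rightarrow> 'a::{real_normed_field, euclidean_space} ae_fun"
  assumes u: "\<And>n. u n \<in> dom_A N b k" and UL: "\<And>\<mu>. \<mu> \<le> k + 2 \<Longrightarrow> U \<mu> \<in> L2 0 len"
    and lim: "\<And>\<mu>. \<mu> \<le> k + 2 \<Longrightarrow> (\<lambda>n. L2_norm (weak_deriv 0 len \<mu> (u n) - U \<mu>)) \<longlonglongrightarrow> 0"
  shows "U 0 \<in> dom_A N b k" "op_A N b (U 0) = - block_op N R (U 2)"
proof -
  have us: "u n \<in> sobolev 0 len (k + 2)" "block_op N R (u n) \<in> sobolev 0 len (k + 2)"
    "ae_value 0 len (u n) 0 = 0" "ae_value 0 len (u n) len = 0" for n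
    using u by (auto simp: dom_A_iff)
  have D: "D1 0 len (U \<mu>) (U (Suc \<mu>))" if "\<mu> < k + 2" for \<mu>
    unfolding D1_iff
  proof (intro conjI UL)
    show "has_weak_deriv 0 len 1 (U \<mu>) (U (Suc \<mu>))"
      by (rule has_weak_deriv_tendsto[where U = "\<lambda>n. weak_deriv 0 len \<mu> (u n)" and V = "\<lambda>n. weak_deriv 0 len (Suc \<mu>) (u n)"])
        (use that sobolev_D1[OF us(1) that] UL lim in \<open>auto simp: D1_iff\<close>)
  qed (use that in auto)
  have DR: "D1 0 len (block_op N R (U \<mu>)) (block_op N R (U (Suc \<mu>)))" if "\<mu> < k + 2" for \<mu>
    unfolding D1_iff
  proof (intro conjI block_op_L2)
    have L: "weak_deriv 0 len \<nu> (u n) \<in> L2 0 len" if "\<nu> \<le> k + 2" for \<nu> n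
      using sobolev_weak_deriv(1)[OF us(1) that] .
    show "has_weak_deriv 0 len 1 (block_op N R (U \<mu>)) (block_op N R (U (Suc \<mu>)))"
    proof (rule has_weak_deriv_tendsto[where U = "\<lambda>n. block_op N R (weak_deriv 0 len \<mu> (u n))"
          and V = "\<lambda>n. block_op N R (weak_deriv 0 len (Suc \<mu>) (u n))"])
      show "(\<lambda>n. L2_norm (block_op N R (weak_deriv 0 len \<mu> (u n)) - block_op N R (U \<mu>))) \<longlonglongrightarrow> 0"
        using that by (intro block_op_tendsto[OF L UL lim]) auto
      show "(\<lambda>n. L2_norm (block_op N R (weak_deriv 0 len (Suc \<mu>) (u n)) - block_op N R (U (Suc \<mu>)))) \<longlonglongrightarrow> 0"
        using that by (intro block_op_tendsto[OF L UL lim]) auto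
      show "has_weak_deriv 0 len 1 (block_op N R (weak_deriv 0 len \<mu> (u n))) (block_op N R (weak_deriv 0 len (Suc \<mu>) (u n)))" for n
        using sobolev_D1[OF us(2) that] dom_A_weak_deriv[OF u] that by (simp add: D1_iff)
    qed (use that L UL in \<open>auto intro!: block_op_L2[of _ 0 len]\<close>)
    show "U \<mu> \<in> L2 0 len" "U (Suc \<mu>) \<in> L2 0 len" using that UL by auto
  qed
  have U0: "U 0 \<in> L2 0 len" using UL by simp
  note chain = sobolev_chainI[of "k + 2" 0 len U, OF D U0]
  note chainR = sobolev_chainI[of "k + 2" 0 len "\<lambda>\<mu>. block_op N R (U \<mu>)", OF DR block_op_L2[OF U0]]
  have w0: "weak_deriv 0 len 0 (u n) = u n" for n using us(1) sobolev_L2 weak_deriv_0 by blast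
  have Du: "D1 0 len (u n) (weak_deriv 0 len 1 (u n))" for n
    using sobolev_D1[OF us(1), of 0] w0 by simp
  have lim0: "(\<lambda>n. L2_norm (u n - U 0)) \<longlonglongrightarrow> 0" "(\<lambda>n. L2_norm (weak_deriv 0 len 1 (u n) - U 1)) \<longlonglongrightarrow> 0"
    using lim[of 0] lim[of 1] w0 by simp_all
  have D0: "D1 0 len (U 0) (U 1)" using D[of 0] by simp
  have "ae_value 0 len (U 0) 0 = 0" "ae_value 0 len (U 0) len = 0"
    using ae_value_tendsto[OF _ Du D0 lim0] us(3,4) by (simp_all add: LIMSEQ_const_iff)
  with chain(1) chainR(1) show "U 0 \<in> dom_A N b k"
    by (simp add: dom_A_iff)
  show "op_A N b (U 0) = - block_op N R (U 2)"
    using chainR(2)[of 2] by (simp add: op_A_eq[OF U0])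
qed

lemma op_A_weak_deriv:
  assumes u: "u \<in> dom_A N b k"
  shows "op_A N b u \<in> sobolev 0 len k"
    "j \<le> k \<Longrightarrow> weak_deriv 0 len j (op_A N b u) = - block_op N R (weak_deriv 0 len (j + 2) u)"
proof -
  have us: "block_op N R u \<in> sobolev 0 len (k + 2)" and uL: "u \<in> L2 0 len"
    using u sobolev_L2 by (auto simp: dom_A_iff)
  note w = sobolev_weak_deriv_2[OF us]
  show "op_A N b u \<in> sobolev 0 len k"
    unfolding op_A_eq[OF uL] by (rule ae.subspace_neg[OF sobolev_subspace w(1)])
  show "weak_deriv 0 len j (op_A N b u) = - block_op N R (weak_deriv 0 len (j + 2) u)" if "j \<le> k"
    using sobolev_smult(2)[OF w(1) that, of "- 1"] w(2)[OF that] dom_A_weak_deriv[OF u, of "j + 2"] that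
    by (simp add: op_A_eq[OF uL] ae_smult_minus_one)
qed

text \<open>Convergence in W^{k+2} provides the limits of all derivatives, so the limit stays in the
  domain. The images tend in L_2 both to f and to - R u'', which must agree.\<close>

lemma op_A_closed_graph:
  "closedin (prod_topology (norm_topology (sobolev 0 len (k + 2)) (sobolev_norm 0 len (k + 2)))
      (norm_topology (sobolev 0 len k) (sobolev_norm 0 len k)))
    ((\<lambda>u. (u, op_A N b u)) ` (dom_A N b k :: 'a::{real_normed_field, euclidean_space} ae_fun set))"
proof (rule closedin_graph_norm_topology[OF sobolev_metric sobolev_metric])
  show "dom_A N b k \<subseteq> (sobolev 0 len (k + 2) :: 'a ae_fun set)" by (auto simp: dom_A_iff)
  show "op_A N b ` dom_A N b k \<subseteq> (sobolev 0 len k :: 'a ae_fun set)" using op_A_weak_deriv(1) by blast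
  fix \<sigma> :: "nat \<Rightarrow> 'a ae_fun" and u f
  assume \<sigma>: "\<And>n. \<sigma> n \<in> dom_A N b k" and u: "u \<in> sobolev 0 len (k + 2)" and f: "f \<in> sobolev 0 len k"
    and lim: "(\<lambda>n. sobolev_norm 0 len (k + 2) (\<sigma> n - u)) \<longlonglongrightarrow> 0" "(\<lambda>n. sobolev_norm 0 len k (op_A N b (\<sigma> n) - f)) \<longlonglongrightarrow> 0"
  have \<sigma>s: "\<sigma> n \<in> sobolev 0 len (k + 2)" for n using \<sigma> by (auto simp: dom_A_iff)
  note l = sobolev_norm_tendsto[OF \<sigma>s u lim(1)]
  have u0: "weak_deriv 0 len 0 u = u" using u sobolev_L2 weak_deriv_0 by blast
  note D = dom_A_limit[of \<sigma> k "\<lambda>\<mu>. weak_deriv 0 len \<mu> u", OF \<sigma> sobolev_weak_deriv(1)[OF u] l, unfolded u0]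
  have L: "weak_deriv 0 len 2 (\<sigma> n) \<in> L2 0 len" "weak_deriv 0 len 2 u \<in> L2 0 len" for n
    using sobolev_weak_deriv(1)[OF \<sigma>s] sobolev_weak_deriv(1)[OF u] by auto
  have fL: "f \<in> L2 0 len" using f by (rule sobolev_L2)
  have As: "op_A N b (\<sigma> n) \<in> sobolev 0 len k" for n using op_A_weak_deriv(1)[OF \<sigma>] .
  have eq: "op_A N b (\<sigma> n) = - block_op N R (weak_deriv 0 len 2 (\<sigma> n))" for n
    using op_A_weak_deriv(2)[OF \<sigma>, of 0] weak_deriv_0[OF sobolev_L2[OF As]] by (simp add: numeral_2_eq_2)
  have lim2: "(\<lambda>n. L2_norm (op_A N b (\<sigma> n) - f)) \<longlonglongrightarrow> 0"
    using sobolev_norm_tendsto[OF As f lim(2), of 0] weak_deriv_0[OF sobolev_L2[OF As]] weak_deriv_0[OF fL] by simp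
  have "(\<lambda>n. L2_norm (block_op N R (weak_deriv 0 len 2 (\<sigma> n)) - block_op N R (weak_deriv 0 len 2 u))) \<longlonglongrightarrow> 0"
    by (rule block_op_tendsto[OF L l]) simp
  moreover have "L2_norm (op_A N b (\<sigma> n) - (- block_op N R (weak_deriv 0 len 2 u))) =
      L2_norm (block_op N R (weak_deriv 0 len 2 (\<sigma> n)) - block_op N R (weak_deriv 0 len 2 u))" for n
    unfolding eq by (rule L2_norm_minus_diff[OF block_op_L2[OF L(1)] block_op_L2[OF L(2)]])
  ultimately have "f = - block_op N R (weak_deriv 0 len 2 u)"
    by (intro L2_limit_unique[of "\<lambda>n. op_A N b (\<sigma> n)" 0 len] lim2 fL sobolev_L2[OF As] L2_neg block_op_L2[OF L(2)]) simp
  with D show "u \<in> dom_A N b k \<and> op_A N b u = f" by simp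
qed

text \<open>Only the images are known to converge. Applying \<open>S\<close> to their derivatives
  gives convergence of the derivatives of u n of orders 2 to k+2; the orders 0 and 1 come from the
  Dirichlet problem with right side - S f.\<close>

lemma op_A_closed_range:
  "closedin (norm_topology (sobolev 0 len k) (sobolev_norm 0 len k))
    (op_A N b ` (dom_A N b k :: 'a::{real_normed_field, euclidean_space} ae_fun set))"
  unfolding closedin_norm_topology[OF sobolev_metric]
proof (intro conjI allI impI)
  show "op_A N b ` dom_A N b k \<subseteq> (sobolev 0 len k :: 'a ae_fun set)" using op_A_weak_deriv(1) by blast
  fix \<sigma> :: "nat \<Rightarrow> 'a ae_fun" and f
  assume A: "range \<sigma> \<subseteq> op_A N b ` dom_A N b k \<and> f \<in> sobolev 0 len k \<and> (\<lambda>n. sobolev_norm 0 len k (\<sigma> n - f)) \<longlonglongrightarrow> 0"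
  then have f: "f \<in> sobolev 0 len k" and fL: "f \<in> L2 0 len" using sobolev_L2 by auto
  have "\<forall>n. \<exists>u. u \<in> dom_A N b k \<and> \<sigma> n = op_A N b u" using A by blast
  then obtain u where u: "\<And>n. u n \<in> dom_A N b k" "\<And>n. \<sigma> n = op_A N b (u n)" by metis
  have us: "u n \<in> sobolev 0 len (k + 2)" "ae_value 0 len (u n) 0 = 0" "ae_value 0 len (u n) len = 0" for n
    using u(1) by (auto simp: dom_A_iff)
  have \<sigma>s: "\<sigma> n \<in> sobolev 0 len k" for n using op_A_weak_deriv(1)[OF u(1)] u(2) by simp
  have L: "weak_deriv 0 len j (\<sigma> n) \<in> L2 0 len" "weak_deriv 0 len j f \<in> L2 0 len" if "j \<le> k" for j n
    using sobolev_weak_deriv(1)[OF \<sigma>s that] sobolev_weak_deriv(1)[OF f that] by auto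
  have wd: "weak_deriv 0 len (j + 2) (u n) = - block_op N S (weak_deriv 0 len j (\<sigma> n))" if "j \<le> k" for j n
    using op_A_weak_deriv(2)[OF u(1) that] S_R[OF sobolev_weak_deriv(1)[OF us(1), of "j + 2"]] that
    by (simp add: u(2) block_op_minus)
  have lim: "(\<lambda>n. L2_norm (weak_deriv 0 len (j + 2) (u n) - (- block_op N S (weak_deriv 0 len j f)))) \<longlonglongrightarrow> 0"
    if "j \<le> k" for j
  proof -
    have "(\<lambda>n. L2_norm (weak_deriv 0 len j (\<sigma> n) - weak_deriv 0 len j f)) \<longlonglongrightarrow> 0"
      using A by (intro sobolev_norm_tendsto[OF \<sigma>s f _ that]) simp
    then have "(\<lambda>n. L2_norm (block_op N S (weak_deriv 0 len j (\<sigma> n)) - block_op N S (weak_deriv 0 len j f))) \<longlonglongrightarrow> 0"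
      by (rule block_op_tendsto[OF L[OF that]])
    moreover have "L2_norm (- block_op N S (weak_deriv 0 len j (\<sigma> n)) - (- block_op N S (weak_deriv 0 len j f))) =
        L2_norm (block_op N S (weak_deriv 0 len j (\<sigma> n)) - block_op N S (weak_deriv 0 len j f))" for n
      by (rule L2_norm_minus_diff[OF block_op_L2[OF L(1)[OF that]] block_op_L2[OF L(2)[OF that]]])
    ultimately show ?thesis unfolding wd[OF that] by simp
  qed
  have f0: "weak_deriv 0 len 0 f = f" by (rule weak_deriv_0[OF fL])
  have SfL: "- block_op N S f \<in> L2 0 len" by (intro L2_neg block_op_L2[OF fL])
  have us2: "u n \<in> sobolev 0 len 2" for n by (rule sobolev_mono[OF us(1)]) simp
  have lim2: "(\<lambda>n. L2_norm (weak_deriv 0 len 2 (u n) - (- block_op N S f))) \<longlonglongrightarrow> 0"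
    using lim[of 0] f0 by (simp add: numeral_2_eq_2)
  obtain v w where vw: "v \<in> L2 0 len" "w \<in> L2 0 len" "(\<lambda>n. L2_norm (u n - v)) \<longlonglongrightarrow> 0"
    "(\<lambda>n. L2_norm (weak_deriv 0 len 1 (u n) - w)) \<longlonglongrightarrow> 0"
    by (rule dirichlet_problem_limit[OF _ us2 us(2,3) SfL lim2]) simp_all
  \<comment> \<open>Order \<mu> \<ge> 2 of the preimage corresponds to order \<mu> - 2 of f; the two
    lowest orders are those supplied by the Dirichlet problem.\<close>
  define U where "U \<mu> = (if \<mu> = 0 then v else if \<mu> = 1 then w else - block_op N S (weak_deriv 0 len (\<mu> - 2) f))" for \<mu>
  have UL: "U \<mu> \<in> L2 0 len" if "\<mu> \<le> k + 2" for \<mu>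
    using vw(1,2) that L(2)[of "\<mu> - 2"] by (auto simp: U_def intro!: L2_neg block_op_L2[of _ 0 len])
  have Ulim: "(\<lambda>n. L2_norm (weak_deriv 0 len \<mu> (u n) - U \<mu>)) \<longlonglongrightarrow> 0" if "\<mu> \<le> k + 2" for \<mu>
  proof -
    consider "\<mu> = 0" | "\<mu> = 1" | j where "\<mu> = j + 2" using that by (metis One_nat_def add_2_eq_Suc' not0_implies_Suc)
    then show ?thesis
    proof cases
      case 1
      then show ?thesis using vw(3) weak_deriv_0[OF sobolev_L2[OF us(1)]] by (simp add: U_def)
    next
      case 2
      then show ?thesis using vw(4) by (simp add: U_def)
    next
      case 3
      then show ?thesis using lim[of j] that by (simp add: U_def)
    qed
  qed
  note D = dom_A_limit[OF u(1) UL Ulim]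
  have "op_A N b (U 0) = f"
    using D(2) R_S[OF fL] by (simp add: U_def block_op_minus f0)
  with D(1) show "f \<in> op_A N b ` dom_A N b k" by blast
qed

lemma op_A_linear: "ae.linear_operator_on (dom_A N b k) (op_A N b :: 'a::{real_normed_field, euclidean_space} ae_fun \<Rightarrow> 'a ae_fun)"
  unfolding ae.linear_operator_on_def
proof (intro conjI ballI allI dom_A_subspace)
  have L: "u \<in> L2 0 len" "block_op N R u \<in> sobolev 0 len (k + 2)" if "u \<in> dom_A N b k" for u :: "'a ae_fun"
    using that sobolev_L2 by (auto simp: dom_A_iff)
  show "op_A N b (u + v) = op_A N b u + op_A N b v" if "u \<in> dom_A N b k" "v \<in> dom_A N b k" for u v :: "'a ae_fun"
    using sobolev_add(2)[OF L(2)[OF that(1)] L(2)[OF that(2)], of 2]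
    by (simp add: op_A_eq L(1) that L2_add block_op_linear)
  show "op_A N b (ae_smult c u) = ae_smult c (op_A N b u)" if "u \<in> dom_A N b k" for c and u :: "'a ae_fun"
    using sobolev_smult(2)[OF L(2)[OF that], of 2 c]
    by (simp add: op_A_eq L(1) that L2_smult block_op_linear)
qed

end

theorem theorem5:
  fixes N k :: nat and b :: "int \<Rightarrow> real"
  assumes "N \<ge> 1"
    and "Determinant.det (mat_R1 N b) \<noteq> 0"
    and "Determinant.det (mat_R2 N b) = 0"
  shows "ae.fredholm
           (sobolev 0 (real N + 1) (k + 2)) (sobolev_norm 0 (real N + 1) (k + 2))
           (sobolev 0 (real N + 1) k) (sobolev_norm 0 (real N + 1) k)
           (dom_A N b k) (op_A N b :: 'a::{real_normed_field, euclidean_space} ae_fun \<Rightarrow> 'a ae_fun)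
       \<and> ae.dim (kernel_on (dom_A N b k) (op_A N b :: 'a ae_fun \<Rightarrow> 'a ae_fun)) = 0
       \<and> ae.codim (sobolev 0 (real N + 1) k) ((op_A N b :: 'a ae_fun \<Rightarrow> 'a ae_fun) ` dom_A N b k) =
           (if lin_indep_pair (vec_G1 N b) (vec_G2 N b) then 2 * (k + 1) else k + 1)"
proof -
  obtain S where "singular_corner_toeplitz N b S"
    by (rule singular_corner_toeplitz_ex[OF assms(2,3)])
  then interpret singular_corner_toeplitz N b S .
  obtain B where B: "ae.quotient_basis (sobolev 0 len k) (op_A N b ` (dom_A N b k :: 'a ae_fun set)) B"
    "card B = (if ends_independent then 2 * (k + 1) else k + 1)"
    using quotient_basis_op_A by blast
  have range: "ae.subspace (op_A N b ` (dom_A N b k :: 'a ae_fun set))"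
    by (rule ae.linear_operator_on_image[OF op_A_linear])
  have "ae.finite_dim {0 :: 'a ae_fun}"
    unfolding ae.finite_dim_def by (intro exI[of _ "{}"]) simp
  moreover have "ae.dim {0 :: 'a ae_fun} = 0"
    using ae.dim_eq_card[of "{}" "{0 :: 'a ae_fun}"] ae.span_insert_0[of "{} :: 'a ae_fun set"] ae.independent_empty by simp
  moreover have "ae.finite_codim (sobolev 0 len k) (op_A N b ` (dom_A N b k :: 'a ae_fun set))"
    using B(1) unfolding ae.finite_codim_def by blast
  moreover have "ends_independent \<longleftrightarrow> lin_indep_pair (vec_G1 N b) (vec_G2 N b)"
    unfolding lin_indep_pair_ends ends_independent_def ..
  ultimately show ?thesis
    using op_A_linear[of k, where 'a = 'a] op_A_closed_graph[of k, where 'a = 'a]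
      op_A_closed_range[of k, where 'a = 'a] ae.codim_eq[OF B(1) sobolev_subspace range] B(2)
    unfolding ae.fredholm_def kernel_op_A by simp
qed

end
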